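(* Let $f,g:\mathbb{N}\to\mathbb{U}$ be multiplicative functions and let $t,u\in\mathbb{R}$ be such that $\mathbb{D}(f,n^{it};\infty)<\infty$ and $\mathbb{D}(g,n^{iu};\infty)<\infty$. Write $f_0(n)=f(n)/n^{it}$ and $g_0(n)=g(n)/n^{iu}$. Let $a,b\ge1$ and $c,d$ be integers with $(a,c)=(b,d)=1$ and $ad\ne bc$, and put $P(n)=an+c$, $Q(n)=bn+d$. Then, as $x\to\infty$, $$\frac1x\sum_{n\le x}f(an+c)\,g(bn+d)=M_i(f(P),g(Q),x)\prod_{p\le x}M_p(f_0(P),g_0(Q))+o(1),$$ where $M_i(f(P),g(Q),x)=\frac1x\sum_{n\le x}P(n)^{it}Q(n)^{iu}$ satisfies $$M_i(f(P),g(Q),x)\sim\frac{a^{it}b^{iu}x^{i(t+u)}}{1+i(t+u)}.$$ Moreover, the local factors are as follows. (i) If $p\mid(a,b)$, then $M_p(f_0(P),g_0(Q))=1$. (ii) If $p\nmid ab(ad-bc)$, then $$M_p(f_0(P),g_0(Q))=M_p(f_0(P))+M_p(g_0(Q))-1=1-\frac2p+\left(1-\frac1p\right)\left(\sum_{j\ge1}\frac{f_0(p^j)}{p^j}+\sum_{j\ge1}\frac{g_0(p^j)}{p^j}\right).$$ (iii) In general, if $p\nmid(a,b)$ and $k\ge0$ is the integer with $p^k\|ad-bc$, then $$M_p(f_0(P),g_0(Q))=\sum_{0\le i\le k}\left(\frac{\theta(p^i)\gamma(p^i)}{p^i}+\delta_b\sum_{j>i}\frac{\theta(p^i)\gamma(p^j)}{p^j}+\delta_a\sum_{j>i}\frac{\gamma(p^i)\theta(p^j)}{p^j}\right),$$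 where $f_0=1*\theta$, $g_0=1*\gamma$, and $\delta_l=0$ if $p\mid l$, $\delta_l=1$ otherwise.
   Context: $\mathbb{U}=\{z\in\mathbb{C}:|z|\le1\}$; $p$ denotes primes; sums over $n\le x$ run over positive integers, the finitely many $n$ with $an+c\le0$ or $bn+d\le0$ being omitted. $(\cdot,\cdot)$ is the gcd, $p^k\|m$ means $p^k\mid m$, $p^{k+1}\nmid m$, and $*$ is Dirichlet convolution. (In formula (iii) $i$ is a summation index; in exponents such as $n^{it}$ it is the imaginary unit.) $\mathbb{D}(f,g;\infty)=\left(\sum_{p}\frac{1-\operatorname{Re}(f(p)\overline{g(p)})}{p}\right)^{1/2}$. For a multiplicative $h$ and a prime $p$, $h_p$ is the multiplicative function with $h_p(p^k)=h(p^k)$ and $h_p(q^k)=1$ for primes $q\ne p$, $k\ge1$. The local factors are $$M_p(h(P))=\lim_{x\to\infty}\frac1x\sum_{n\le x}h_p(P(n)),\qquad M_p(f_0(P),g_0(Q))=\lim_{x\to\infty}\frac1x\sum_{n\le x}(f_0)_p(P(n))\,(g_0)_p(Q(n)).$$ *)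

theory Defs
  imports "HOL-Analysis.Analysis" "HOL-Library.Landau_Symbols" "HOL-Computational_Algebra.Primes"
begin

text \<open>Arithmetic functions on the positive integers are modelled as functions on \<^typ>\<open>nat\<close>; the
  value at 0 is never used.\<close>

definition multiplicative_fun :: "(nat \<Rightarrow> complex) \<Rightarrow> bool" where
  "multiplicative_fun h \<longleftrightarrow>
     h 1 = 1 \<and> (\<forall>m n. m > 0 \<longrightarrow> n > 0 \<longrightarrow> coprime m n \<longrightarrow> h (m * n) = h m * h n)"

lemma multiplicative_funD:
  "multiplicative_fun h \<Longrightarrow> coprime m n \<Longrightarrow> m > 0 \<Longrightarrow> n > 0 \<Longrightarrow> h (m * n) = h m * h n"
  by (simp add: multiplicative_fun_def)

definition dirichlet_conv :: "(nat \<Rightarrow> complex) \<Rightarrow> (nat \<Rightarrow> complex) \<Rightarrow> nat \<Rightarrow> complex" where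
  "dirichlet_conv h h' n = (\<Sum>d | d dvd n. h d * h' (n div d))"

text \<open>The function \<open>n \<mapsto> n\<^sup>i\<^sup>t\<close>.\<close>

definition n_it :: "real \<Rightarrow> nat \<Rightarrow> complex" where
  "n_it t n = of_nat n powr (\<i> * of_real t)"

text \<open>The distance \<open>\<D>(f, g; \<infinity>)\<close>. For functions into the unit disc all summands are nonnegative, so
  the value is \<open>\<infinity>\<close> exactly when the series diverges.\<close>

definition pret_dist :: "(nat \<Rightarrow> complex) \<Rightarrow> (nat \<Rightarrow> complex) \<Rightarrow> ennreal" where
  "pret_dist f g =
     (if (\<lambda>p. (1 - Re (f p * cnj (g p))) / real p) summable_on {p. prime p}
      then ennreal (sqrt (\<Sum>\<^sub>\<infinity>p\<in>{p. prime p}. (1 - Re (f p * cnj (g p))) / real p))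
      else \<infinity>)"

text \<open>For multiplicative \<open>h\<close> and prime \<open>p\<close>, \<open>local_part p h\<close> is \<open>h\<^sub>p\<close>, the multiplicative function
  that agrees with \<open>h\<close> at powers of \<open>p\<close> and is 1 at powers of all other primes; see the three
  lemmas below.\<close>

definition local_part :: "nat \<Rightarrow> (nat \<Rightarrow> complex) \<Rightarrow> nat \<Rightarrow> complex" where
  "local_part p h n = h (p ^ multiplicity p n)"

lemma local_part_multiplicative:
  assumes "multiplicative_fun h" "prime p"
  shows "multiplicative_fun (local_part p h)"
proof -
  have "local_part p h (m * n) = local_part p h m * local_part p h n"
    if "m > 0" "n > 0" "coprime m n" for m n
  proof -
    have "multiplicity p m = 0 \<or> multiplicity p n = 0"
      using that assms(2) by (metis coprime_common_divisor not_dvd_imp_multiplicity_0 not_prime_unit)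
    then show ?thesis
      using that assms
      by (auto simp: local_part_def multiplicative_fun_def prime_elem_multiplicity_mult_distrib)
  qed
  then show ?thesis
    using assms by (auto simp: multiplicative_fun_def local_part_def)
qed

lemma local_part_prime_power:
  assumes "multiplicative_fun h" "prime p" "prime q"
  shows "local_part p h (q ^ k) = (if q = p then h (p ^ k) else 1)"
  using assms
  by (auto simp: local_part_def multiplicative_fun_def multiplicity_distinct_prime_power)

lemma local_part_unique:
  assumes h: "multiplicative_fun h" and p: "prime p" and H: "multiplicative_fun H"
    and "\<And>q k. prime q \<Longrightarrow> H (q ^ k) = (if q = p then h (p ^ k) else 1)"
    and "n > 0"
  shows "H n = local_part p h n"
  using \<open>n > 0\<close>
proof (induction n rule: less_induct)
  case (less n)
  show ?case
  proof (cases "n = 1")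
    case True
    then show ?thesis
      using H local_part_multiplicative[OF h p] by (simp add: multiplicative_fun_def)
  next
    case False
    then obtain q where q: "prime q" "q dvd n" using prime_factor_nat by blast
    define k where "k = multiplicity q n"
    obtain m where m: "n = q ^ k * m" "\<not> q dvd m"
      using multiplicity_decompose'[of n q] less.prems q(1) not_prime_1 unfolding k_def
      by (metis not_gr_zero not_prime_unit)
    have "k > 0" using q less.prems by (simp add: k_def prime_multiplicity_gt_zero_iff)
    have "m > 0" using m less.prems by (cases m) auto
    have "q ^ k > 1" using \<open>k > 0\<close> q(1) prime_gt_1_nat one_less_power by blast
    then have "m < n" using m \<open>m > 0\<close> by simp
    have cop: "coprime (q ^ k) m" using q m prime_imp_coprime by auto
    have "H n = H (q ^ k) * H m"
      unfolding m(1) using \<open>m > 0\<close> \<open>q ^ k > 1\<close> by (intro multiplicative_funD[OF H cop]) linarith+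
    also have "\<dots> = local_part p h (q ^ k) * local_part p h m"
      using less.IH[OF \<open>m < n\<close> \<open>m > 0\<close>] assms(4)[OF q(1)] local_part_prime_power[OF h p q(1)]
      by simp
    also have "\<dots> = local_part p h n"
      unfolding m(1) using \<open>m > 0\<close> \<open>q ^ k > 1\<close>
      by (intro multiplicative_funD[OF local_part_multiplicative[OF h p] cop, symmetric]) linarith+
    finally show ?thesis .
  qed
qed

text \<open>Averages over \<open>1 \<le> n \<le> x\<close>, omitting the \<open>n\<close> at which \<open>P\<close> (or \<open>Q\<close>) is not positive.\<close>

definition mean_along :: "(nat \<Rightarrow> complex) \<Rightarrow> (nat \<Rightarrow> int) \<Rightarrow> real \<Rightarrow> complex" where
  "mean_along h P x =
     1 / of_real x * (\<Sum>n | 1 \<le> n \<and> real n \<le> x \<and> P n > 0. h (nat (P n)))"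

definition corr_along ::
  "(nat \<Rightarrow> complex) \<Rightarrow> (nat \<Rightarrow> int) \<Rightarrow> (nat \<Rightarrow> complex) \<Rightarrow> (nat \<Rightarrow> int) \<Rightarrow> real \<Rightarrow> complex" where
  "corr_along h P h' Q x =
     1 / of_real x *
     (\<Sum>n | 1 \<le> n \<and> real n \<le> x \<and> P n > 0 \<and> Q n > 0. h (nat (P n)) * h' (nat (Q n)))"

text \<open>\<open>local_mean p h P\<close> is \<open>M\<^sub>p(h(P))\<close> and \<open>local_corr p h P h' Q\<close> is \<open>M\<^sub>p(h(P), h'(Q))\<close>.\<close>

definition local_mean :: "nat \<Rightarrow> (nat \<Rightarrow> complex) \<Rightarrow> (nat \<Rightarrow> int) \<Rightarrow> complex" where
  "local_mean p h P = Lim at_top (mean_along (local_part p h) P)"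

definition local_corr ::
  "nat \<Rightarrow> (nat \<Rightarrow> complex) \<Rightarrow> (nat \<Rightarrow> int) \<Rightarrow> (nat \<Rightarrow> complex) \<Rightarrow> (nat \<Rightarrow> int) \<Rightarrow> complex" where
  "local_corr p h P h' Q =
     Lim at_top (corr_along (local_part p h) P (local_part p h') Q)"

text \<open>Every arithmetic function is of the form \<open>1 * \<theta>\<close>, and \<open>\<theta>\<close> is determined on the positive
  integers.\<close>

lemma one_conv_ex: "\<exists>\<theta>. \<forall>n>0. h n = dirichlet_conv (\<lambda>_. 1) \<theta> n"
proof -
  define \<theta> where "\<theta> = wfrec less_than (\<lambda>\<theta> n. h n - (\<Sum>d | d dvd n \<and> d < n. \<theta> d))"
  have rec: "\<theta> n = h n - (\<Sum>d | d dvd n \<and> d < n. \<theta> d)" for n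
    unfolding \<theta>_def
    by (subst wfrec) (auto simp: cut_def intro!: sum.cong)
  have "dirichlet_conv (\<lambda>_. 1) \<theta> n = h n" if "n > 0" for n
  proof -
    have "dirichlet_conv (\<lambda>_. 1) \<theta> n = (\<Sum>d | d dvd n. \<theta> (n div d))"
      by (simp add: dirichlet_conv_def)
    also have "\<dots> = (\<Sum>d | d dvd n. \<theta> d)"
      using that by (intro sum.reindex_bij_witness[of _ "\<lambda>d. n div d" "\<lambda>d. n div d"]) auto
    also have "{d. d dvd n} = insert n {d. d dvd n \<and> d < n}"
      using that by (auto dest: dvd_imp_le)
    also have "sum \<theta> \<dots> = h n"
      using rec[of n] by (subst sum.insert) auto
    finally show ?thesis .
  qed
  then show ?thesis by (metis)
qed

lemma one_conv_unique:
  assumes "\<forall>n>0. dirichlet_conv (\<lambda>_. 1) \<theta> n = dirichlet_conv (\<lambda>_. 1) \<theta>' n" and "n > 0"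
  shows "\<theta> n = \<theta>' n"
  using \<open>n > 0\<close>
proof (induction n rule: less_induct)
  case (less n)
  have fin: "finite {d. d dvd n}" using less.prems by simp
  have eq: "{d. d dvd n} = insert 1 ({d. d dvd n} - {1})" by auto
  have conv: "dirichlet_conv (\<lambda>_. 1) \<eta> n = \<eta> n + (\<Sum>d\<in>{d. d dvd n} - {1}. \<eta> (n div d))" for \<eta>
    unfolding dirichlet_conv_def by (subst eq, subst sum.insert) (use fin in auto)
  have "\<theta> (n div d) = \<theta>' (n div d)" if "d \<in> {d. d dvd n} - {1}" for d
  proof -
    have "d > 1" using that less.prems by (cases d) auto
    then show ?thesis
      using that less.prems by (intro less.IH) (auto simp: dvd_imp_le div_greater_zero_iff)
  qed
  then have "(\<Sum>d\<in>{d. d dvd n} - {1}. \<theta> (n div d)) = (\<Sum>d\<in>{d. d dvd n} - {1}. \<theta>' (n div d))"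
    by (intro sum.cong) auto
  then show ?case using conv[of \<theta>] conv[of \<theta>'] assms(1) less.prems by simp
qed

end

theory Submission
  imports Defs "HOL-Number_Theory.Cong" "HOL-Real_Asymp.Real_Asymp"
begin

text \<open>
  Write \<open>f(n) = n\<^sup>i\<^sup>t f\<^sub>0(n)\<close> and \<open>g(n) = n\<^sup>i\<^sup>u g\<^sub>0(n)\<close>. On the unit disc \<open>|1 - z|\<^sup>2 \<le> 2(1 - Re z)\<close>,
  so finite distance gives \<open>\<Sum> |1 - f\<^sub>0(p)|\<^sup>2/p < \<infinity>\<close>, and likewise for \<open>g\<^sub>0\<close>. Fix \<open>y\<close> and
  separate the primes up to \<open>y\<close>, which behave periodically, from the primes beyond \<open>y\<close>, at
  which \<open>f\<^sub>0\<close> is close to 1.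

  Large primes. The product of \<open>f\<^sub>0(p\<^sup>v)\<close> over the \<open>p\<^sup>v\<close> exactly dividing \<open>P(n)\<close> with \<open>p > y\<close> is
  close to \<open>exp (h(n))\<close>, where \<open>h(n)\<close> is the sum of \<open>f\<^sub>0(p) - 1\<close> over the same primes. A
  Turan--Kubilius inequality shows that \<open>h(n)\<close> is, on average over \<open>n \<le> N\<close>, close to the
  constant \<open>\<mu> = \<Sum> (f\<^sub>0(p) - 1)/p\<close>, summed over \<open>y < p \<le> N\<close>, with an error governed by the
  tail of \<open>\<Sum> |1 - f\<^sub>0(p)|\<^sup>2/p\<close>. So the rough part may be replaced by \<open>exp \<mu>\<close> for all large
  \<open>N\<close> (\<open>rough_part_concentration\<close>). The variance argument handles \<open>p\<^sup>2 \<le> N\<close>; the larger primes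
  are harmless because an integer of size \<open>O(N)\<close> has at most two of them as divisors, which
  bounds the sum of their reciprocals (\<open>sum_inverse_large_primes_le\<close>).

  Small primes. Outside a set of \<open>n\<close> of small density, the contribution of the primes \<open>p \<le> y\<close>
  depends only on \<open>n\<close> modulo \<open>\<Prod> p\<^sup>K\<close>, and by the Chinese remainder theorem its mean is a
  product of local means. The twist \<open>P(n)\<^sup>i\<^sup>t Q(n)\<^sup>i\<^sup>u\<close> varies so slowly that partial summation
  decouples it from any periodic function (\<open>periodic_times_slow\<close>). Hence for fixed \<open>y\<close> the
  twisted smooth part has mean \<open>M\<^sub>i\<close> times the product of the \<open>M\<^sub>p\<close> with \<open>p \<le> y\<close>, up to \<open>o(1)\<close>
  (\<open>smooth_part_mean\<close>).

  Gluing. For \<open>p > y\<close> the local factor is \<open>exp ((f\<^sub>0(p) - 1 + g\<^sub>0(p) - 1)/p) + O(p\<^sup>-\<^sup>2)\<close>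
  (\<open>euler_factor_near_exp\<close>), so the two constants \<open>exp \<mu>\<close> multiply to the product of the \<open>M\<^sub>p\<close>
  with \<open>y < p \<le> N\<close>, up to \<open>O(1/y)\<close>. Letting \<open>N\<close> and then \<open>y\<close> tend to infinity gives the
  asymptotics (\<open>correlation_asymptotics\<close>).

  Local factors. With \<open>f\<^sub>0 = 1 * \<theta>\<close> and \<open>g\<^sub>0 = 1 * \<gamma>\<close>, the factor at \<open>p\<close> is the sum of
  \<open>\<theta>(p\<^sup>i) \<gamma>(p\<^sup>j)\<close> times the density of the \<open>n\<close> with \<open>p\<^sup>i | P(n)\<close> and \<open>p\<^sup>j | Q(n)\<close>. The identity
  \<open>a Q(n) - b P(n) = ad - bc\<close> determines these densities (\<open>joint_density\<close>), and the three
  formulas are read off.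
\<close>

section \<open>Exponentials and averages\<close>

lemma norm_exp_diff_le:
  fixes z w :: complex
  assumes "Re z \<le> 0" "Re w \<le> 0"
  shows "norm (exp z - exp w) \<le> norm (z - w)"
proof -
  have "norm (exp z - exp w) \<le> 1 * norm (z - w)"
  proof (rule field_differentiable_bound[where S = "{z. Re z \<le> 0}" and f' = exp])
    show "convex {z. Re z \<le> 0}" by (rule convex_halfspace_Re_le)
  qed (use assms in \<open>auto intro!: derivative_eq_intros\<close>)
  then show ?thesis by simp
qed

text \<open>
  The derivative \<open>exp z - 1\<close> of \<open>exp z - z\<close> is at most \<open>|z|\<close> on the left half-plane, by the
  preceding bound.
\<close>

lemma norm_exp_minus_linear_le:
  fixes w :: complex
  assumes "Re w \<le> 0"
  shows "norm (exp w - (1 + w)) \<le> (norm w)\<^sup>2"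
proof -
  have "norm ((exp w - (1 + w)) - (exp 0 - (1 + 0))) \<le> norm w * norm (w - 0)"
  proof (rule field_differentiable_bound[where S = "{z. Re z \<le> 0} \<inter> cball 0 (norm w)"
        and f' = "\<lambda>z. exp z - 1"])
    show "convex ({z. Re z \<le> 0} \<inter> cball 0 (norm w))"
      by (intro convex_Int convex_halfspace_Re_le convex_cball)
    show "norm (exp z - 1) \<le> norm w" if "z \<in> {z. Re z \<le> 0} \<inter> cball 0 (norm w)" for z
      using norm_exp_diff_le[of z 0] that by (auto intro: order_trans)
  qed (use assms in \<open>auto intro!: derivative_eq_intros\<close>)
  then show ?thesis by (simp add: power2_eq_square)
qed

text \<open>
  Cesaro's theorem for null sequences. It turns every pointwise asymptotic comparison below
  into a comparison of averages.
\<close>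

lemma cesaro_null:
  fixes z :: "nat \<Rightarrow> complex"
  assumes "z \<longlonglongrightarrow> 0"
  shows "(\<lambda>N. (\<Sum>n<N. z n) / of_nat N) \<longlonglongrightarrow> 0"
proof (rule LIMSEQ_I)
  fix e :: real assume e: "e > 0"
  obtain M where M: "\<And>n. n \<ge> M \<Longrightarrow> norm (z n) < e / 2"
    using LIMSEQ_D[OF assms, of "e / 2"] e by auto
  define B where "B = (\<Sum>n<M. norm (z n))"
  have B0: "B \<ge> 0" unfolding B_def by (simp add: sum_nonneg)
  obtain L :: nat where L: "real L > 2 * B / e" using reals_Archimedean2 by blast
  show "\<exists>no. \<forall>N\<ge>no. norm ((\<Sum>n<N. z n) / of_nat N - 0) < e"
  proof (intro exI[of _ "max (Suc M) (Suc L)"] allI impI)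
    fix N assume N: "N \<ge> max (Suc M) (Suc L)"
    have "norm (\<Sum>n<N. z n) \<le> (\<Sum>n<N. norm (z n))" by (rule norm_sum)
    also have "\<dots> = B + (\<Sum>n=M..<N. norm (z n))"
      using N unfolding B_def lessThan_atLeast0 by (subst sum.atLeastLessThan_concat) auto
    also have "(\<Sum>n=M..<N. norm (z n)) \<le> (\<Sum>n=M..<N. e / 2)"
      using M by (intro sum_mono) (auto intro: less_imp_le)
    also have "\<dots> \<le> real N * (e / 2)" using e by (auto intro!: mult_right_mono)
    also have "B < real N * (e / 2)"
    proof -
      have "2 * B / e < real N" using L N by linarith
      then show ?thesis using e by (simp add: field_simps)
    qed
    finally have "norm (\<Sum>n<N. z n) < e * real N" by (simp add: algebra_simps)
    then show "norm ((\<Sum>n<N. z n) / of_nat N - 0) < e"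
      using N by (simp add: norm_divide field_simps)
  qed
qed

section \<open>Terms of a linear form in a residue class\<close>

text \<open>
  As \<open>a\<close> is invertible modulo \<open>d\<close>, divisibility of \<open>a n + c\<close> by \<open>d\<close> singles out one residue
  class of \<open>n\<close>.
\<close>

lemma linear_form_residue:
  fixes a c :: int and d :: nat
  assumes "coprime (int d) a" "d > 0"
  obtains r where "r < d" "\<And>n. int d dvd a * int n + c \<longleftrightarrow> n mod d = r"
proof -
  obtain x where x: "[a * x = 1] (mod int d)"
    using assms(1) cong_solve_coprime_int[of a "int d"] by (auto simp: coprime_commute)
  have s: "[a * (x * - c) = - c] (mod int d)"
    using cong_mult[OF x cong_refl[of "- c"]] by (simp add: mult.assoc)
  define s where "s = x * - c"
  define r where "r = nat (s mod int d)"
  have r: "int r = s mod int d" "r < d" using assms(2) by (auto simp: r_def nat_less_iff)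
  show thesis
  proof (rule that[OF r(2)])
    fix n
    have "int d dvd a * int n + c \<longleftrightarrow> [a * int n = - c] (mod int d)"
      by (simp add: cong_iff_dvd_diff)
    also have "\<dots> \<longleftrightarrow> [a * int n = a * s] (mod int d)"
      using s unfolding s_def by (meson cong_sym cong_trans)
    also have "\<dots> \<longleftrightarrow> [int n = s] (mod int d)"
      using assms(1) by (intro cong_mult_lcancel) (simp add: coprime_commute)
    also have "\<dots> \<longleftrightarrow> int n mod int d = int r"
      using r by (simp add: cong_def)
    also have "\<dots> \<longleftrightarrow> n mod d = r"
      by (metis of_nat_eq_iff of_nat_mod)
    finally show "int d dvd a * int n + c \<longleftrightarrow> n mod d = r" .
  qed
qed

lemma card_residue_class:
  fixes d r N :: nat
  assumes "r < d"
  shows "card {n. n < N \<and> n mod d = r} = (N + d - 1 - r) div d"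
proof -
  have *: "k * d + r < N \<longleftrightarrow> k < (N + d - 1 - r) div d" for k
  proof -
    have "k < (N + d - 1 - r) div d \<longleftrightarrow> Suc k \<le> (N + d - 1 - r) div d" by (simp only: Suc_le_eq)
    also have "\<dots> \<longleftrightarrow> Suc k * d \<le> N + d - 1 - r"
      using assms by (intro less_eq_div_iff_mult_less_eq) simp
    also have "\<dots> \<longleftrightarrow> k * d + r < N" using assms by auto
    finally show ?thesis by simp
  qed
  have "{n. n < N \<and> n mod d = r} = (\<lambda>k. k * d + r) ` {..<(N + d - 1 - r) div d}"
  proof (intro set_eqI iffI)
    fix n assume "n \<in> {n. n < N \<and> n mod d = r}"
    then have "n = n div d * d + r" "n < N" using div_mult_mod_eq[of n d] by auto
    then show "n \<in> (\<lambda>k. k * d + r) ` {..<(N + d - 1 - r) div d}"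
      using *[of "n div d"] by (intro image_eqI[of _ _ "n div d"]) auto
  next
    fix n assume "n \<in> (\<lambda>k. k * d + r) ` {..<(N + d - 1 - r) div d}"
    then obtain k where k: "n = k * d + r" "k < (N + d - 1 - r) div d" by blast
    have "n < N" using *[of k] k by blast
    moreover have "n mod d = r" using assms by (simp add: k(1))
    ultimately show "n \<in> {n. n < N \<and> n mod d = r}" by simp
  qed
  also have "card \<dots> = (N + d - 1 - r) div d"
    using assms by (subst card_image) (auto simp: inj_on_def)
  finally show ?thesis .
qed

definition hits :: "int \<Rightarrow> int \<Rightarrow> nat \<Rightarrow> nat \<Rightarrow> nat" where
  "hits a c d N = card {n. n < N \<and> int d dvd a * int n + c}"

lemma hits_approx:
  assumes "coprime (int d) a" "d > 0"
  shows "\<bar>real (hits a c d N) - real N / real d\<bar> \<le> 1"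
proof -
  obtain r where r: "r < d" "\<And>n. int d dvd a * int n + c \<longleftrightarrow> n mod d = r"
    using linear_form_residue[OF assms] by blast
  define m where "m = N + d - 1 - r"
  have h: "hits a c d N = m div d"
    unfolding hits_def r(2) m_def by (rule card_residue_class[OF r(1)])
  have m: "real m = real N + real d - 1 - real r" using r(1) by (simp add: m_def of_nat_diff)
  have "real m = real (m div d) * real d + real (m mod d)"
    by (metis div_mult_mod_eq of_nat_add of_nat_mult)
  moreover have "m mod d < d" using assms by simp
  ultimately have "real N - real d \<le> real (m div d) * real d"
    "real (m div d) * real d \<le> real N + real d"
    using m r(1) by linarith+
  then show ?thesis
    using assms(2) h by (auto simp: abs_le_iff field_simps)
qed

lemma hits_exact:
  assumes "coprime (int d) a" "d > 0" "d dvd N"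
  shows "real (hits a c d N) = real N / real d"
proof -
  obtain r where r: "r < d" "\<And>n. int d dvd a * int n + c \<longleftrightarrow> n mod d = r"
    using linear_form_residue[OF assms(1,2)] by blast
  obtain q where q: "N = d * q" using assms(3) by blast
  have "hits a c d N = (N + d - 1 - r) div d"
    unfolding hits_def r(2) by (rule card_residue_class[OF r(1)])
  also have "\<dots> = (d * q + (d - 1 - r)) div d" using r(1) q by simp
  also have "\<dots> = q" using r(1) by (subst div_mult_self4) auto
  finally show ?thesis using q assms by simp
qed

lemma not_dvd_linear_form:
  assumes "gcd a c = 1" "prime p" "int p dvd a"
  shows "\<not> int p dvd a * n + c"
proof
  assume "int p dvd a * n + c"
  then have "int p dvd c" using assms(3) by (simp add: dvd_add_right_iff)
  then have "int p dvd gcd a c" using assms(3) by simp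
  then have "p dvd 1" unfolding assms(1) by (metis int_dvd_int_iff of_nat_1)
  then show False using assms(2) by simp
qed

lemma hits_eq_0:
  assumes "gcd a c = 1" "prime p" "int p dvd a" "int p dvd int d"
  shows "hits a c d N = 0"
proof -
  have "\<not> int d dvd a * int n + c" for n
    using not_dvd_linear_form[OF assms(1-3)] assms(4) dvd_trans by blast
  then show ?thesis by (simp add: hits_def)
qed

text \<open>
  If \<open>p\<close> divides \<open>a\<close>, then \<open>p\<close> never divides \<open>a n + c\<close>, so this upper bound, unlike the
  two-sided one, holds at every prime.
\<close>

lemma hits_prime_power_le:
  assumes "gcd a c = 1" "prime p"
  shows "real (hits a c (p ^ k) N) \<le> real N / real p ^ k + 1"
proof (cases "int p dvd a \<and> k > 0")
  case True
  then have "hits a c (p ^ k) N = 0" using assms by (intro hits_eq_0[of a c p]) auto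
  then show ?thesis using assms by simp
next
  case False
  then have "coprime (int (p ^ k)) a"
    using assms(2) by (cases "k = 0") (auto intro!: prime_imp_coprime)
  then show ?thesis using hits_approx[of "p ^ k" a c N] assms(2) prime_gt_0_nat by auto
qed

section \<open>A Turan--Kubilius inequality\<close>

text \<open>
  With \<open>s\<close> the largest element, there are at most \<open>s\<close> elements of size at most \<open>s\<close>, and
  \<open>s\<^sup>2 \<le> N\<close>. In the Turan--Kubilius inequality this absorbs the bounded errors of all pairs of
  primes up to \<open>\<surd>N\<close>.
\<close>

lemma sum_le_of_squares_le:
  assumes "finite S" "\<And>p. p \<in> S \<Longrightarrow> p > 0 \<and> p\<^sup>2 \<le> (N :: nat)"
  shows "\<Sum>S \<le> N"
proof (cases "S = {}")
  case False
  define s where "s = Max S"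
  have s: "s \<in> S" "\<And>p. p \<in> S \<Longrightarrow> p \<le> s"
    using assms False by (auto simp: s_def)
  have "S \<subseteq> {1..s}" using s(2) assms(2) by force
  then have "card S \<le> s" using card_mono[of "{1..s}" S] by simp
  have "\<Sum>S \<le> card S * s" using s(2) sum_bounded_above[of S "\<lambda>p. p" s] by simp
  also have "\<dots> \<le> s * s" using \<open>card S \<le> s\<close> by simp
  also have "\<dots> \<le> N" using assms(2)[OF s(1)] by (simp add: power2_eq_square)
  finally show ?thesis .
qed simp

text \<open>
  The events \<open>p | a n + c\<close> and \<open>q | a n + c\<close> with \<open>p \<noteq> q\<close> are independent up to a bounded
  error, since \<open>a n + c\<close> is divisible by \<open>pq\<close> for \<open>N/(pq) + O(1)\<close> of the \<open>n < N\<close>. On the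
  diagonal the variance is \<open>O(N/p)\<close>.
\<close>

lemma covariance_le:
  fixes a c :: int and p q N :: nat
  assumes pq: "prime p" "prime q" and cop: "coprime (int p) a" "coprime (int q) a"
    and N: "p\<^sup>2 \<le> N"
  shows "\<bar>\<Sum>n<N. (of_bool (int p dvd a * int n + c) - 1 / real p)
             * (of_bool (int q dvd a * int n + c) - 1 / real q)\<bar>
         \<le> (if p = q then 3 * real N / real p else 0) + 3"
proof -
  define H where "H d = real (hits a c d N)" for d
  have H: "(\<Sum>n<N. of_bool (int d dvd a * int n + c)) = H d" for d
  proof -
    have "(\<Sum>n<N. of_bool (int d dvd a * int n + c) :: real)
        = real (card ({..<N} \<inter> {n. int d dvd a * int n + c}))"
      by (simp add: sum_of_bool_eq)
    also have "{..<N} \<inter> {n. int d dvd a * int n + c} = {n. n < N \<and> int d dvd a * int n + c}"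
      by auto
    finally show ?thesis by (simp add: H_def hits_def)
  qed
  have p0: "real p \<ge> 2" "real q \<ge> 2" using pq prime_ge_2_nat by force+
  define B where "B n = (of_bool (int p dvd a * int n + c \<and> int q dvd a * int n + c) :: real)" for n
  have expand: "(\<Sum>n<N. (of_bool (int p dvd a * int n + c) - 1 / real p)
             * (of_bool (int q dvd a * int n + c) - 1 / real q))
      = (\<Sum>n<N. B n) - H p / real q - H q / real p + real N / (real p * real q)"
  proof -
    have "(\<Sum>n<N. (of_bool (int p dvd a * int n + c) - 1 / real p)
             * (of_bool (int q dvd a * int n + c) - 1 / real q))
      = (\<Sum>n<N. B n - of_bool (int p dvd a * int n + c) / real q
          - of_bool (int q dvd a * int n + c) / real p + 1 / (real p * real q))"
      by (intro sum.cong refl) (auto simp: B_def algebra_simps)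
    also have "\<dots> = (\<Sum>n<N. B n) - H p / real q - H q / real p + real N / (real p * real q)"
      by (simp add: sum.distrib sum_subtractf H flip: sum_divide_distrib)
    finally show ?thesis .
  qed
  have hp: "\<bar>H p - real N / real p\<bar> \<le> 1" "\<bar>H q - real N / real q\<bar> \<le> 1"
    using hits_approx cop p0 unfolding H_def by auto
  show ?thesis
  proof (cases "p = q")
    case True
    have "p \<le> N" using N by (metis le_trans self_le_power prime_gt_0_nat pq(1) Suc_leI pos2 One_nat_def)
    have "(\<Sum>n<N. B n) = H p" using True by (simp add: B_def H[symmetric])
    then have "\<bar>(\<Sum>n<N. B n) - H p / real q - H q / real p + real N / (real p * real q)\<bar>
        = \<bar>H p * (1 - 2 / real p) + real N / (real p)\<^sup>2\<bar>"
      using True by (simp add: algebra_simps power2_eq_square)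
    also have "\<dots> = H p * (1 - 2 / real p) + real N / (real p)\<^sup>2"
      using p0 by (intro abs_of_nonneg add_nonneg_nonneg mult_nonneg_nonneg) (auto simp: H_def)
    also have "\<dots> \<le> H p * 1 + real N / real p"
    proof (intro add_mono mult_left_mono)
      show "real N / (real p)\<^sup>2 \<le> real N / real p"
        using p0 by (intro divide_left_mono) (auto simp: power2_eq_square)
    qed (use p0 in \<open>auto simp: H_def\<close>)
    also have "\<dots> \<le> 2 * real N / real p + 1" using hp(1) by (auto simp: abs_le_iff)
    also have "\<dots> \<le> 3 * real N / real p + 3"
      by (intro add_mono divide_right_mono) auto
    finally show ?thesis using True expand by simp
  next
    case False
    have cpq: "coprime p q" using False pq primes_coprime by blast
    have "B n = of_bool (int (p * q) dvd a * int n + c)" for n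
    proof -
      have "int p dvd x \<and> int q dvd x \<longleftrightarrow> int (p * q) dvd x" for x
        using cpq divides_mult[of "int p" x "int q"] by (auto dest: dvd_mult_left dvd_mult_right)
      then show ?thesis by (simp add: B_def)
    qed
    then have BH: "(\<Sum>n<N. B n) = H (p * q)" by (simp only: H)
    have "coprime (int (p * q)) a" using cop by simp
    then have h3: "\<bar>H (p * q) - real N / real (p * q)\<bar> \<le> 1"
      unfolding H_def using hits_approx[of "p * q" a c N] p0 by simp
    have le1: "\<bar>u / r - v / r\<bar> \<le> 1" if "\<bar>u - v\<bar> \<le> 1" "r \<ge> (2 :: real)" for u v r
      using that by (simp add: flip: diff_divide_distrib)
    have "\<bar>H p / real q - real N / (real p * real q)\<bar> \<le> 1"
      "\<bar>H q / real p - real N / (real p * real q)\<bar> \<le> 1"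
      using le1[OF hp(1) p0(2)] le1[OF hp(2) p0(1)] by (simp_all add: mult.commute)
    then show ?thesis unfolding expand BH using h3 False by (simp add: abs_le_iff)
  qed
qed

text \<open>
  Expanding the square leaves a diagonal, which has the claimed size, and a bounded covariance
  for each pair of primes. The latter contribute \<open>O((\<Sum> |w(p)|)\<^sup>2)\<close>. By Cauchy--Schwarz,
  \<open>(\<Sum> |w(p)|)\<^sup>2 \<le> (\<Sum> |w(p)|\<^sup>2/p) (\<Sum> p)\<close>, and \<open>\<Sum> p \<le> N\<close> because only primes
  up to \<open>\<surd>N\<close> occur.
\<close>

lemma turan_kubilius:
  fixes a c :: int and S :: "nat set" and N :: nat and w :: "nat \<Rightarrow> complex"
  assumes fin: "finite S"
    and S: "\<And>p. p \<in> S \<Longrightarrow> prime p \<and> coprime (int p) a \<and> p\<^sup>2 \<le> N"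
  shows "(\<Sum>n<N. (norm (\<Sum>p\<in>S. w p * of_real (of_bool (int p dvd a * int n + c) - 1 / real p)))\<^sup>2)
         \<le> 6 * real N * (\<Sum>p\<in>S. (norm (w p))\<^sup>2 / real p)"
proof -
  define e where "e p n = (of_bool (int p dvd a * int n + c) - 1 / real p)" for p n
  define R where "R p q = (\<Sum>n<N. e p n * e q n)" for p q
  define E where "E = (\<Sum>p\<in>S. (norm (w p))\<^sup>2 / real p)"
  have p0: "real p > 0" if "p \<in> S" for p using S[OF that] prime_gt_0_nat by auto
  have R: "\<bar>R p q\<bar> \<le> (if p = q then 3 * real N / real p else 0) + 3" if "p \<in> S" "q \<in> S" for p q
    unfolding R_def e_def using S[OF that(1)] S[OF that(2)] by (intro covariance_le) auto
  have "complex_of_real (\<Sum>n<N. (norm (\<Sum>p\<in>S. w p * of_real (e p n)))\<^sup>2)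
      = (\<Sum>n<N. (\<Sum>p\<in>S. w p * of_real (e p n)) * cnj (\<Sum>p\<in>S. w p * of_real (e p n)))"
    by (simp only: of_real_sum complex_norm_square)
  also have "\<dots> = (\<Sum>n<N. \<Sum>p\<in>S. \<Sum>q\<in>S. w p * cnj (w q) * of_real (e p n * e q n))"
    by (simp add: sum_product mult_ac)
  also have "\<dots> = (\<Sum>p\<in>S. \<Sum>n<N. \<Sum>q\<in>S. w p * cnj (w q) * of_real (e p n * e q n))"
    by (rule sum.swap)
  also have "\<dots> = (\<Sum>p\<in>S. \<Sum>q\<in>S. \<Sum>n<N. w p * cnj (w q) * of_real (e p n * e q n))"
    by (rule sum.cong[OF refl], rule sum.swap)
  also have "\<dots> = (\<Sum>p\<in>S. \<Sum>q\<in>S. w p * cnj (w q) * of_real (R p q))"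
    unfolding R_def of_real_sum sum_distrib_left by (rule refl)
  finally have *: "complex_of_real (\<Sum>n<N. (norm (\<Sum>p\<in>S. w p * of_real (e p n)))\<^sup>2)
      = (\<Sum>p\<in>S. \<Sum>q\<in>S. w p * cnj (w q) * of_real (R p q))" .
  have "(\<Sum>n<N. (norm (\<Sum>p\<in>S. w p * of_real (e p n)))\<^sup>2)
      = norm (\<Sum>p\<in>S. \<Sum>q\<in>S. w p * cnj (w q) * of_real (R p q))"
    unfolding *[symmetric] norm_of_real by (intro abs_of_nonneg[symmetric] sum_nonneg) simp
  also have "\<dots> \<le> (\<Sum>p\<in>S. \<Sum>q\<in>S. norm (w p) * norm (w q) * \<bar>R p q\<bar>)"
    by (intro order_trans[OF norm_sum] sum_mono) (simp add: norm_mult)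
  also have "\<dots> \<le> (\<Sum>p\<in>S. \<Sum>q\<in>S. norm (w p) * norm (w q) * ((if p = q then 3 * real N / real p else 0) + 3))"
    by (intro sum_mono mult_left_mono R) auto
  also have "\<dots> = (\<Sum>p\<in>S. \<Sum>q\<in>S. (if p = q then (norm (w p))\<^sup>2 * (3 * real N / real p) else 0)
                      + 3 * (norm (w p) * norm (w q)))"
    by (intro sum.cong refl) (auto simp: power2_eq_square algebra_simps)
  also have "\<dots> = (\<Sum>p\<in>S. (norm (w p))\<^sup>2 * (3 * real N / real p)) + 3 * (\<Sum>p\<in>S. norm (w p))\<^sup>2"
    using fin by (simp add: sum.distrib power2_eq_square sum_product flip: sum_distrib_left)
  also have "(\<Sum>p\<in>S. (norm (w p))\<^sup>2 * (3 * real N / real p)) = 3 * real N * E"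
    unfolding E_def sum_distrib_left by (intro sum.cong refl) simp
  also have "(\<Sum>p\<in>S. norm (w p))\<^sup>2 \<le> E * real N"
  proof -
    have "(\<Sum>p\<in>S. norm (w p)) = (\<Sum>p\<in>S. (norm (w p) / sqrt (real p)) * sqrt (real p))"
      using p0 by (intro sum.cong refl) (auto simp: less_imp_neq)
    also have "\<dots>\<^sup>2 \<le> (\<Sum>p\<in>S. (norm (w p) / sqrt (real p))\<^sup>2) * (\<Sum>p\<in>S. (sqrt (real p))\<^sup>2)"
      by (rule Cauchy_Schwarz_ineq_sum)
    also have "\<dots> = E * real (\<Sum>S)"
      by (simp add: E_def power_divide)
    also have "\<dots> \<le> E * real N"
    proof (intro mult_left_mono)
      show "real (\<Sum>S) \<le> real N"
        using fin S prime_gt_0_nat by (subst of_nat_le_iff, intro sum_le_of_squares_le) auto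
    qed (simp add: E_def sum_nonneg)
    finally show ?thesis .
  qed
  finally show ?thesis unfolding e_def E_def by (simp add: algebra_simps)
qed

text \<open>
  A bound for \<open>\<Sum> 1/p\<close> over \<open>M\<^sup>1\<^sup>/\<^sup>3 < p \<le> M\<close> by double counting: the pairs \<open>(p, m)\<close> with
  \<open>p | m \<le> M\<close> number at least \<open>\<Sum> (M/p - 1)\<close>, and at most \<open>2M\<close> because three such primes
  have a product exceeding \<open>M\<close>.
\<close>

lemma sum_inverse_large_primes_le:
  fixes M :: nat
  assumes "finite S" "\<And>p. p \<in> S \<Longrightarrow> prime p \<and> p \<le> M \<and> p ^ 3 > M"
  shows "(\<Sum>p\<in>S. 1 / real p) \<le> 3"
proof (cases "M = 0")
  case True
  then have "S = {}" using assms(2) by (auto dest: prime_gt_0_nat)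
  then show ?thesis by simp
next
  case False
  have few: "card {p\<in>S. p dvd m} \<le> 2" if m: "0 < m" "m \<le> M" for m
  proof (rule ccontr)
    assume "\<not> card {p\<in>S. p dvd m} \<le> 2"
    then have "3 \<le> card {p\<in>S. p dvd m}" by simp
    then obtain T where T: "T \<subseteq> {p\<in>S. p dvd m}" "card T = 3"
      by (rule obtain_subset_with_card_n)
    obtain p q r where pqr: "T = {p, q, r}" "p \<noteq> q" "q \<noteq> r" "p \<noteq> r"
      using iffD1[OF card_3_iff T(2)] by (elim exE conjE) (rule that)
    have mem: "p \<in> S" "q \<in> S" "r \<in> S" "p dvd m" "q dvd m" "r dvd m"
      using T(1) unfolding pqr(1) by auto
    then have "p * q dvd m" using assms(2) pqr by (intro divides_mult) (auto intro: primes_coprime)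
    then have "p * q * r dvd m"
      using assms(2) pqr mem by (intro divides_mult) (auto intro: primes_coprime)
    then have "p * q * r \<le> M" using m by (meson dvd_imp_le le_trans)
    moreover have "M ^ 3 < (p * q * r) ^ 3"
    proof -
      have "M * M * M < p ^ 3 * q ^ 3 * r ^ 3"
        using assms(2) mem False by (intro mult_strict_mono) (auto intro: prime_gt_0_nat)
      then show ?thesis unfolding power_mult_distrib power3_eq_cube[of M] .
    qed
    ultimately show False by (meson not_less power_mono zero_le)
  qed
  have "(\<Sum>p\<in>S. real M / real p - 1) \<le> (\<Sum>p\<in>S. real (hits 1 1 p M))"
  proof (intro sum_mono)
    fix p assume "p \<in> S"
    then have "p > 0" using assms(2) prime_gt_0_nat by blast
    then show "real M / real p - 1 \<le> real (hits 1 1 p M)"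
      using hits_approx[of p 1 1 M] by (auto simp: abs_le_iff)
  qed
  also have "\<dots> = (\<Sum>p\<in>S. \<Sum>n<M. of_bool (p dvd Suc n))"
  proof (intro sum.cong refl)
    fix p
    have "int p dvd 1 * int n + 1 \<longleftrightarrow> p dvd Suc n" for n
      by (metis int_dvd_int_iff mult_1 of_nat_Suc add.commute)
    then have "{n. n < M \<and> int p dvd 1 * int n + 1} = {..<M} \<inter> {n. p dvd Suc n}" by auto
    then show "real (hits 1 1 p M) = (\<Sum>n<M. of_bool (p dvd Suc n))"
      by (simp only: hits_def) (simp add: sum_of_bool_eq)
  qed
  also have "\<dots> = (\<Sum>n<M. real (card {p\<in>S. p dvd Suc n}))"
    using assms(1) by (subst sum.swap) (simp add: sum_of_bool_eq Int_def)
  also have "\<dots> \<le> (\<Sum>n<M. 2)"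
  proof (intro sum_mono)
    fix n assume "n \<in> {..<M}"
    then show "real (card {p\<in>S. p dvd Suc n}) \<le> 2" using few[of "Suc n"] by simp
  qed
  finally have "real M * (\<Sum>p\<in>S. 1 / real p) \<le> 2 * real M + real (card S)"
    by (simp add: sum_subtractf sum_distrib_left)
  moreover have "card S \<le> M"
  proof -
    have "S \<subseteq> {1..M}" using assms(2) prime_gt_0_nat by (auto simp: Suc_le_eq)
    then show ?thesis using card_mono[of "{1..M}" S] by simp
  qed
  ultimately have "real M * (\<Sum>p\<in>S. 1 / real p) \<le> real M * 3" by linarith
  then show ?thesis using False by simp
qed

lemma sum_large_primes_le:
  fixes M :: nat and w :: "nat \<Rightarrow> real"
  assumes "finite S" "\<And>p. p \<in> S \<Longrightarrow> prime p \<and> p \<le> M \<and> p ^ 3 > M"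
  shows "(\<Sum>p\<in>S. w p / real p) \<le> sqrt (3 * (\<Sum>p\<in>S. (w p)\<^sup>2 / real p))"
proof -
  have p0: "real p > 0" if "p \<in> S" for p using assms(2)[OF that] prime_gt_0_nat by auto
  have "(\<Sum>p\<in>S. w p / real p) = (\<Sum>p\<in>S. (w p / sqrt (real p)) * (1 / sqrt (real p)))"
    using p0 by (intro sum.cong refl) (auto simp: less_imp_le)
  also have "\<dots>\<^sup>2 \<le> (\<Sum>p\<in>S. (w p / sqrt (real p))\<^sup>2) * (\<Sum>p\<in>S. (1 / sqrt (real p))\<^sup>2)"
    by (rule Cauchy_Schwarz_ineq_sum)
  also have "\<dots> = (\<Sum>p\<in>S. (w p)\<^sup>2 / real p) * (\<Sum>p\<in>S. 1 / real p)"
    by (simp add: power_divide)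
  also have "\<dots> \<le> (\<Sum>p\<in>S. (w p)\<^sup>2 / real p) * 3"
    using assms by (intro mult_left_mono sum_inverse_large_primes_le[of S M]) (auto intro!: sum_nonneg)
  finally show ?thesis by (intro real_le_rsqrt) (simp add: mult.commute)
qed

section \<open>Concentration of the rough part\<close>

text \<open>
  The tail is bounded through finite sets, since only finitely many primes are relevant for
  each \<open>N\<close>.
\<close>

lemma summable_tail_small:
  fixes f :: "nat \<Rightarrow> real"
  assumes "f summable_on A" "\<And>p. p \<in> A \<Longrightarrow> f p \<ge> 0" "e > 0"
  obtains y where "\<And>S. finite S \<Longrightarrow> S \<subseteq> A \<Longrightarrow> (\<And>p. p \<in> S \<Longrightarrow> y < p) \<Longrightarrow> sum f S \<le> e"
proof -
  have hs: "(f has_sum infsum f A) A" using assms(1) by (rule has_sum_infsum)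
  obtain F where F: "finite F" "F \<subseteq> A" "dist (sum f F) (infsum f A) \<le> e"
    using has_sum_finite_approximation[OF hs assms(3)] by blast
  show thesis
  proof (rule that[of "Max (insert 0 F)"])
    fix S assume S: "finite S" "S \<subseteq> A" "\<And>p. p \<in> S \<Longrightarrow> Max (insert 0 F) < p"
    have "F \<inter> S = {}"
    proof -
      have "x \<le> Max (insert 0 F)" if "x \<in> F" for x using F(1) that by simp
      then show ?thesis using S(3) by (meson disjoint_iff not_less)
    qed
    then have "sum f F + sum f S = sum f (F \<union> S)"
      using F(1) S(1) by (simp add: sum.union_disjoint)
    also have "\<dots> \<le> infsum f A"
      using F S assms by (intro finite_sum_le_infsum) auto
    finally show "sum f S \<le> e" using F(3) by (simp add: dist_real_def)
  qed
qed

lemma sum_inverse_squares_tail_le: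
  fixes S :: "nat set"
  assumes "finite S" "\<And>p. p \<in> S \<Longrightarrow> y < p" "y > 0"
  shows "(\<Sum>p\<in>S. 1 / (real p)\<^sup>2) \<le> 1 / real y"
proof -
  have *: "(\<Sum>k\<in>{y<..m}. 1 / (real k)\<^sup>2) \<le> 1 / real y - 1 / real m" if "m \<ge> y" for m
    using that
  proof (induction m rule: dec_induct)
    case (step m)
    have m: "m > 0" using step assms(3) by simp
    have "{y<..Suc m} = insert (Suc m) {y<..m}" using step by auto
    then have "(\<Sum>k\<in>{y<..Suc m}. 1 / (real k)\<^sup>2)
        = 1 / (real (Suc m))\<^sup>2 + (\<Sum>k\<in>{y<..m}. 1 / (real k)\<^sup>2)" by simp
    also have "1 / (real (Suc m))\<^sup>2 \<le> 1 / (real m * real (Suc m))"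
      using m by (intro divide_left_mono) (auto simp: power2_eq_square)
    also have "\<dots> = 1 / real m - 1 / real (Suc m)" using m by (simp add: field_simps)
    finally show ?case using step.IH by simp
  qed simp
  define m where "m = max y (Max (insert 0 S))"
  have "S \<subseteq> {y<..m}"
  proof
    fix p assume "p \<in> S"
    then have "p \<le> Max (insert 0 S)" using assms(1) by simp
    then show "p \<in> {y<..m}" using assms(2)[OF \<open>p \<in> S\<close>] by (auto simp: m_def)
  qed
  then have "(\<Sum>p\<in>S. 1 / (real p)\<^sup>2) \<le> (\<Sum>k\<in>{y<..m}. 1 / (real k)\<^sup>2)"
    by (intro sum_mono2) auto
  also have "\<dots> \<le> 1 / real y - 1 / real m" by (intro *) (simp add: m_def)
  also have "\<dots> \<le> 1 / real y" by simp
  finally show ?thesis .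
qed

definition rough_part :: "nat \<Rightarrow> (nat \<Rightarrow> complex) \<Rightarrow> nat \<Rightarrow> complex" where
  "rough_part y f m = (\<Prod>p | prime p \<and> p dvd m \<and> y < p. f (p ^ multiplicity p m))"

lemma finite_prime_divisors:
  "(m :: nat) > 0 \<Longrightarrow> finite {p. prime p \<and> p dvd m \<and> Q p}"
  by (rule finite_subset[of _ "{..m}"]) (auto dest: dvd_imp_le)

lemma norm_rough_part_le:
  assumes "\<And>n. n > 0 \<Longrightarrow> norm (f n) \<le> 1"
  shows "norm (rough_part y f m) \<le> 1"
  unfolding rough_part_def prod_norm[symmetric]
  using assms by (intro prod_le_1) (auto simp: prime_gt_0_nat)

lemma Re_minus_1_le: "norm (z :: complex) \<le> 1 \<Longrightarrow> Re (z - 1) \<le> 0"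
  using complex_Re_le_cmod[of z] by simp

lemma multiplicative_fun_prod_prime_powers:
  assumes "multiplicative_fun h" "finite A" "\<And>p. p \<in> A \<Longrightarrow> prime p"
  shows "h (\<Prod>p\<in>A. p ^ e p) = (\<Prod>p\<in>A. h (p ^ e p))"
  using assms(2,3)
proof (induction A rule: finite_induct)
  case empty
  then show ?case using assms(1) by (simp add: multiplicative_fun_def)
next
  case (insert q A)
  have "coprime (q ^ e q) (p ^ e p)" if "p \<in> A" for p
  proof -
    have "prime q" "prime p" "q \<noteq> p" using that insert by auto
    from primes_coprime[OF this] show ?thesis by simp
  qed
  then have "coprime (q ^ e q) (\<Prod>p\<in>A. p ^ e p)" by (intro prod_coprime_right)
  moreover have "q ^ e q > 0" "(\<Prod>p\<in>A. p ^ e p) > 0"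
    using insert.prems by (auto intro!: prod_pos simp: prime_gt_0_nat)
  ultimately have "h (q ^ e q * (\<Prod>p\<in>A. p ^ e p)) = h (q ^ e q) * h (\<Prod>p\<in>A. p ^ e p)"
    by (rule multiplicative_funD[OF assms(1)])
  then show ?case using insert by simp
qed

lemma smooth_rough_factorization:
  assumes h: "multiplicative_fun h" and m: "m > 0"
  shows "h m = (\<Prod>p | prime p \<and> p \<le> y. h (p ^ multiplicity p m)) * rough_part y h m"
proof -
  define A where "A = {p. prime p \<and> p dvd m}"
  have fin: "finite A" unfolding A_def using finite_prime_divisors[OF m, of "\<lambda>_. True"] by simp
  have PF: "prime_factors m = A" using m by (simp add: A_def prime_factors_dvd)
  have h1: "h 1 = 1" using h by (simp add: multiplicative_fun_def)
  have "h m = h (\<Prod>p\<in>A. p ^ multiplicity p m)"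
    using prime_factorization_nat[OF m] PF by simp
  also have "\<dots> = (\<Prod>p\<in>A. h (p ^ multiplicity p m))"
    using fin by (intro multiplicative_fun_prod_prime_powers h) (auto simp: A_def)
  also have "A = {p\<in>A. p \<le> y} \<union> {p\<in>A. y < p}" by auto
  also have "(\<Prod>p\<in>\<dots>. h (p ^ multiplicity p m))
      = (\<Prod>p\<in>{p\<in>A. p \<le> y}. h (p ^ multiplicity p m)) * (\<Prod>p\<in>{p\<in>A. y < p}. h (p ^ multiplicity p m))"
    using fin by (intro prod.union_disjoint) auto
  also have "(\<Prod>p\<in>{p\<in>A. p \<le> y}. h (p ^ multiplicity p m)) = (\<Prod>p | prime p \<and> p \<le> y. h (p ^ multiplicity p m))"
  proof (intro prod.mono_neutral_left ballI)
    fix p assume "p \<in> {p. prime p \<and> p \<le> y} - {p\<in>A. p \<le> y}"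
    then have "\<not> p dvd m" by (auto simp: A_def)
    then show "h (p ^ multiplicity p m) = 1" using h1 by (simp add: not_dvd_imp_multiplicity_0)
  qed (auto simp: A_def)
  also have "{p\<in>A. y < p} = {p. prime p \<and> p dvd m \<and> y < p}" by (auto simp: A_def)
  finally show ?thesis by (simp add: rough_part_def)
qed

text \<open>
  Factor by factor: a prime that divides \<open>m\<close> once contributes
  \<open>f(p) = exp (f(p) - 1) + O(|f(p) - 1|\<^sup>2)\<close>, and the primes whose square divides \<open>m\<close>, rare
  among large primes, are estimated trivially. All factors lie in the unit disc, so the errors
  add up.
\<close>

lemma norm_rough_part_minus_exp_le:
  assumes f: "\<And>n. n > 0 \<Longrightarrow> norm (f n) \<le> 1" and m: "m > 0"
  shows "norm (rough_part y f m - exp (\<Sum>p | prime p \<and> p dvd m \<and> y < p. f p - 1))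
         \<le> (\<Sum>p | prime p \<and> p dvd m \<and> y < p. (norm (f p - 1))\<^sup>2 + 2 * of_bool (p\<^sup>2 dvd m))"
proof -
  define T where "T = {p. prime p \<and> p dvd m \<and> y < p}"
  have fin: "finite T" unfolding T_def by (rule finite_prime_divisors[OF m])
  have fp: "norm (f p) \<le> 1" if "p \<in> T" for p
    using that f by (auto simp: T_def prime_gt_0_nat)
  have ex: "norm (exp (f p - 1)) \<le> 1" if "p \<in> T" for p
    using Re_minus_1_le[OF fp[OF that]] by simp
  have "norm ((\<Prod>p\<in>T. f (p ^ multiplicity p m)) - (\<Prod>p\<in>T. exp (f p - 1)))
      \<le> (\<Sum>p\<in>T. norm (f (p ^ multiplicity p m) - exp (f p - 1)))"
  proof (rule norm_prod_diff)
    show "norm (f (p ^ multiplicity p m)) \<le> 1" if "p \<in> T" for p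
      using that f by (auto simp: T_def prime_gt_0_nat)
  qed (use ex in auto)
  also have "\<dots> \<le> (\<Sum>p\<in>T. (norm (f p - 1))\<^sup>2 + 2 * of_bool (p\<^sup>2 dvd m))"
  proof (intro sum_mono)
    fix p assume p: "p \<in> T"
    then have pr: "prime p" "p dvd m" by (auto simp: T_def)
    have p1: "\<not> is_unit p" using pr(1) by auto
    show "norm (f (p ^ multiplicity p m) - exp (f p - 1))
        \<le> (norm (f p - 1))\<^sup>2 + 2 * of_bool (p\<^sup>2 dvd m)"
    proof (cases "p\<^sup>2 dvd m")
      case True
      have "norm (f (p ^ multiplicity p m) - exp (f p - 1)) \<le> 1 + 1"
        using pr f ex[OF p] by (intro order_trans[OF norm_triangle_ineq4] add_mono) (auto simp: prime_gt_0_nat)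
      then show ?thesis using True by (simp add: add_increasing)
    next
      case False
      then have "multiplicity p m < 2" using multiplicity_dvd' by (metis not_less)
      moreover have "multiplicity p m > 0"
        using pr m by (simp add: prime_multiplicity_gt_zero_iff)
      ultimately have "multiplicity p m = 1" by linarith
      then show ?thesis
        using norm_exp_minus_linear_le[OF Re_minus_1_le[OF fp[OF p]]] False
        by (simp add: norm_minus_commute)
    qed
  qed
  finally show ?thesis using fin by (simp add: rough_part_def T_def exp_sum)
qed

text \<open>
  The rough part is compared first with \<open>exp (h n)\<close>, where \<open>h\<close> is the additive function with
  \<open>h(p) = f(p) - 1\<close> at the large primes, and then \<open>h n\<close> with its mean value. The primes with
  \<open>p\<^sup>2 \<le> N\<close> are covered by the Turan--Kubilius inequality. The remaining ones, which satisfy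
  \<open>p\<^sup>3 > A N\<close>, contribute little both to \<open>h\<close> and to its mean, by Cauchy--Schwarz and the bound
  on the sum of their reciprocals. The quantity \<open>A\<close> is chosen such that \<open>a n + c \<le> A N\<close> for
  \<open>n < N\<close>.
\<close>

lemma rough_part_L1_le:
  fixes a c :: int and N y A :: nat and f :: "nat \<Rightarrow> complex"
  assumes a: "a \<ge> 1" and ac: "gcd a c = 1" and f: "\<And>n. n > 0 \<Longrightarrow> norm (f n) \<le> 1"
    and y: "a \<le> int y" and A: "A = nat a + nat \<bar>c\<bar>" and N: "A\<^sup>2 \<le> N"
    and E: "E = (\<Sum>p | prime p \<and> y < p \<and> p \<le> A * N. (norm (f p - 1))\<^sup>2 / real p)"
  shows "(\<Sum>n | n < N \<and> a * int n + c > 0.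
            norm (rough_part y f (nat (a * int n + c))
                  - exp (\<Sum>p | prime p \<and> y < p \<and> p \<le> N. (f p - 1) / of_nat p)))
         \<le> real N * ((real A + 1) * E + 2 / real y + (real A + 3) * sqrt (6 * E))
           + 2 * sqrt (real (A * N))"
proof -
  define P where "P n = a * int n + c" for n
  define M where "M = A * N"
  define S where "S = {p. prime p \<and> y < p \<and> p \<le> M}"
  define S1 where "S1 = {p\<in>S. p\<^sup>2 \<le> N}"
  define S2 where "S2 = {p\<in>S. \<not> p\<^sup>2 \<le> N}"
  define G where "G = {n. n < N \<and> P n > 0}"
  define w where "w p = f p - 1" for p
  define mu where "mu = (\<Sum>p | prime p \<and> y < p \<and> p \<le> N. w p / of_nat p)"
  define h where "h n = (\<Sum>p\<in>S. w p * of_bool (int p dvd P n))" for n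
  have finS: "finite S" "finite S1" "finite S2" "finite G"
    by (auto simp: S_def S1_def S2_def G_def)
  have A1: "A \<ge> 1" using a A by simp
  have y1: "y > 0" using a y by simp
  have N1: "N \<ge> 1" using N A1 by (metis le_trans one_le_power)
  have NM: "N \<le> M" using A1 by (simp add: M_def)
  have SP: "prime p" "y < p" "p \<le> M" "p > 0" if "p \<in> S" for p
    using that by (auto simp: S_def prime_gt_0_nat)
  have EE: "E = (\<Sum>p\<in>S. (norm (w p))\<^sup>2 / real p)" by (simp add: E S_def w_def M_def)
  have E0: "E \<ge> 0" unfolding EE by (intro sum_nonneg) auto
  have w0: "Re (w p) \<le> 0" if "p > 0" for p
    using Re_minus_1_le[OF f[OF that]] by (simp add: w_def)
  have PM: "nat (P n) \<le> M" "nat (P n) > 0" if "n \<in> G" for n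
  proof -
    have "P n \<le> a * int N + \<bar>c\<bar> * int N"
    proof -
      have "a * int n \<le> a * int N" using that a by (intro mult_left_mono) (auto simp: G_def)
      moreover have "c \<le> \<bar>c\<bar> * int N"
        using N1 mult_left_mono[of 1 "int N" "\<bar>c\<bar>"] by simp
      ultimately show ?thesis by (simp add: P_def)
    qed
    also have "\<dots> = int M" using a by (simp add: M_def A algebra_simps)
    finally show "nat (P n) \<le> M" by simp
    show "nat (P n) > 0" using that by (simp add: G_def)
  qed
  have dv: "d dvd nat (P n) \<longleftrightarrow> int d dvd P n" if "n \<in> G" for n d
    using that by (simp add: G_def flip: int_dvd_int_iff)
  have T: "{p. prime p \<and> p dvd nat (P n) \<and> y < p} = {p\<in>S. int p dvd P n}" if n: "n \<in> G" for n
  proof -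
    have "p \<le> M" if "int p dvd P n" for p
      using that dv[OF n, of p] PM[OF n] by (meson dvd_imp_le le_trans)
    then show ?thesis using dv[OF n] by (auto simp: S_def)
  qed
  have hits: "real (hits a c p N) \<le> (real A + 1) * real N / real p" if "p \<in> S" for p
  proof -
    have "real (hits a c p N) \<le> real N / real p + 1"
      using hits_prime_power_le[OF ac SP(1)[OF that], of 1 N] by simp
    also have "1 \<le> real A * real N / real p"
      using SP[OF that] by (simp add: M_def flip: of_nat_mult)
    finally show ?thesis by (simp add: algebra_simps add_divide_distrib)
  qed
  have cnt: "(\<Sum>n\<in>G. of_bool (int d dvd P n)) \<le> real (hits a c d N)" for d
  proof -
    have "(\<Sum>n\<in>G. of_bool (int d dvd P n)) = real (card (G \<inter> {n. int d dvd P n}))"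
      using finS by (simp add: sum_of_bool_eq)
    also have "\<dots> \<le> real (hits a c d N)"
      unfolding hits_def of_nat_le_iff by (intro card_mono) (auto simp: G_def P_def)
    finally show ?thesis .
  qed

  have 1: "(\<Sum>n\<in>G. norm (rough_part y f (nat (P n)) - exp (h n)))
      \<le> real N * ((real A + 1) * E + 2 / real y) + 2 * sqrt (real M)"
  proof -
    have "(\<Sum>n\<in>G. norm (rough_part y f (nat (P n)) - exp (h n)))
        \<le> (\<Sum>n\<in>G. \<Sum>p\<in>S. (norm (w p))\<^sup>2 * of_bool (int p dvd P n) + 2 * of_bool (int (p\<^sup>2) dvd P n))"
    proof (intro sum_mono)
      fix n assume n: "n \<in> G"
      have "h n = (\<Sum>p\<in>{p\<in>S. int p dvd P n}. f p - 1)"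
        unfolding h_def w_def using finS by (intro sum.mono_neutral_cong_right) auto
      then have "norm (rough_part y f (nat (P n)) - exp (h n))
          \<le> (\<Sum>p\<in>{p\<in>S. int p dvd P n}. (norm (f p - 1))\<^sup>2 + 2 * of_bool (p\<^sup>2 dvd nat (P n)))"
        using norm_rough_part_minus_exp_le[of f "nat (P n)" y, OF f PM(2)[OF n]] by (simp add: T[OF n])
      also have "\<dots> = (\<Sum>p\<in>S. (norm (w p))\<^sup>2 * of_bool (int p dvd P n) + 2 * of_bool (int (p\<^sup>2) dvd P n))"
      proof (intro sum.mono_neutral_cong_left)
        show "\<forall>i\<in>S - {p \<in> S. int p dvd P n}. (norm (w i))\<^sup>2 * of_bool (int i dvd P n)
            + 2 * of_bool (int (i\<^sup>2) dvd P n) = 0"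
        proof
          fix i assume i: "i \<in> S - {p \<in> S. int p dvd P n}"
          then have "\<not> int (i\<^sup>2) dvd P n" by (auto simp: power2_eq_square dest: dvd_mult_left)
          then show "(norm (w i))\<^sup>2 * of_bool (int i dvd P n) + 2 * of_bool (int (i\<^sup>2) dvd P n) = 0"
            using i by simp
        qed
      qed (use finS dv[OF n] in \<open>auto simp: w_def\<close>)
      finally show "norm (rough_part y f (nat (P n)) - exp (h n)) \<le> \<dots>" .
    qed
    also have "\<dots> = (\<Sum>p\<in>S. (norm (w p))\<^sup>2 * (\<Sum>n\<in>G. of_bool (int p dvd P n))
                    + 2 * (\<Sum>n\<in>G. of_bool (int (p\<^sup>2) dvd P n)))"
      by (subst sum.swap) (simp add: sum.distrib sum_distrib_left)
    also have "\<dots> \<le> (\<Sum>p\<in>S. (real A + 1) * real N * ((norm (w p))\<^sup>2 / real p)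
                    + 2 * (if p\<^sup>2 \<le> M then real N / (real p)\<^sup>2 + 1 else 0))"
    proof (intro sum_mono add_mono)
      fix p assume p: "p \<in> S"
      have "(norm (w p))\<^sup>2 * (\<Sum>n\<in>G. of_bool (int p dvd P n))
          \<le> (norm (w p))\<^sup>2 * ((real A + 1) * real N / real p)"
        using order_trans[OF cnt hits[OF p]] by (intro mult_left_mono) auto
      then show "(norm (w p))\<^sup>2 * (\<Sum>n\<in>G. of_bool (int p dvd P n))
          \<le> (real A + 1) * real N * ((norm (w p))\<^sup>2 / real p)" by (simp add: mult_ac)
      show "2 * (\<Sum>n\<in>G. of_bool (int (p\<^sup>2) dvd P n))
          \<le> 2 * (if p\<^sup>2 \<le> M then real N / (real p)\<^sup>2 + 1 else 0)"
      proof (cases "p\<^sup>2 \<le> M")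
        case True
        then show ?thesis
          using order_trans[OF cnt hits_prime_power_le[OF ac SP(1)[OF p], of 2 N]] by simp
      next
        case False
        have "\<not> int (p\<^sup>2) dvd P n" if "n \<in> G" for n
          using False dv[OF that, of "p\<^sup>2"] PM[OF that] dvd_imp_le by (metis le_trans)
        then show ?thesis using False by simp
      qed
    qed
    also have "\<dots> = (real A + 1) * real N * E
        + 2 * (\<Sum>p\<in>{p\<in>S. p\<^sup>2 \<le> M}. real N * (1 / (real p)\<^sup>2) + 1)"
      unfolding EE sum.distrib sum_distrib_left
      using finS by (simp add: sum.If_cases Int_def if_distrib[of "\<lambda>x. 2 * x"] sum.distrib
          sum_distrib_left)
    also have "\<dots> = (real A + 1) * real N * E
        + 2 * (real N * (\<Sum>p\<in>{p\<in>S. p\<^sup>2 \<le> M}. 1 / (real p)\<^sup>2) + real (card {p\<in>S. p\<^sup>2 \<le> M}))"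
      by (simp only: sum.distrib sum_distrib_left) simp
    also have "\<dots> \<le> (real A + 1) * real N * E + 2 * (real N * (1 / real y) + sqrt (real M))"
    proof (intro add_mono mult_left_mono order_refl)
      show "(\<Sum>p\<in>{p\<in>S. p\<^sup>2 \<le> M}. 1 / (real p)\<^sup>2) \<le> 1 / real y"
        using finS SP y1 by (intro sum_inverse_squares_tail_le) auto
      define s where "s = nat \<lfloor>sqrt (real M)\<rfloor>"
      have "{p\<in>S. p\<^sup>2 \<le> M} \<subseteq> {1..s}"
      proof
        fix p assume p: "p \<in> {p\<in>S. p\<^sup>2 \<le> M}"
        then have "real p \<le> sqrt (real M)"
          by (intro real_le_rsqrt) (simp flip: of_nat_power)
        then have "p \<le> s" unfolding s_def by (simp add: le_nat_floor)
        then show "p \<in> {1..s}" using p SP(4)[of p] by simp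
      qed
      then have "card {p\<in>S. p\<^sup>2 \<le> M} \<le> s" using card_mono[of "{1..s}"] by fastforce
      also have "real s \<le> sqrt (real M)" by (simp add: s_def)
      finally show "real (card {p\<in>S. p\<^sup>2 \<le> M}) \<le> sqrt (real M)" by simp
    qed auto
    finally show ?thesis by (simp add: algebra_simps)
  qed

  have E1: "(\<Sum>p\<in>S1. (norm (w p))\<^sup>2 / real p) \<le> E"
    unfolding EE using finS by (intro sum_mono2) (auto simp: S1_def)
  have large: "(\<Sum>p\<in>S2. norm (w p) / real p) \<le> sqrt (6 * E)"
  proof -
    have "(\<Sum>p\<in>S2. norm (w p) / real p) \<le> sqrt (3 * (\<Sum>p\<in>S2. (norm (w p))\<^sup>2 / real p))"
    proof (intro sum_large_primes_le[of _ M])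
      fix p assume "p \<in> S2"
      then have p: "p \<in> S" "\<not> p\<^sup>2 \<le> N" by (auto simp: S2_def)
      \<comment> \<open>If \<open>p\<^sup>3 \<le> M = A N\<close>, then \<open>p\<^sup>6 \<le> A\<^sup>2 N\<^sup>2 \<le> N\<^sup>3\<close>, contrary to \<open>p\<^sup>2 > N\<close>.\<close>
      have "M < p ^ 3"
      proof (rule ccontr)
        assume "\<not> M < p ^ 3"
        then have "(p ^ 3)\<^sup>2 \<le> M\<^sup>2" by (intro power_mono) auto
        also have "\<dots> = A\<^sup>2 * N\<^sup>2" by (simp add: M_def power_mult_distrib)
        also have "\<dots> \<le> N * N\<^sup>2" using N by (intro mult_right_mono) auto
        also have "\<dots> = N ^ 3" by (simp add: power2_eq_square power3_eq_cube)
        also have "\<dots> < (p\<^sup>2) ^ 3" using p by (intro power_strict_mono) auto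
        finally show False by (simp flip: power_mult)
      qed
      then show "prime p \<and> p \<le> M \<and> M < p ^ 3" using SP[OF p(1)] by simp
    qed (use finS in auto)
    also have "\<dots> \<le> sqrt (6 * E)"
    proof -
      have "(\<Sum>p\<in>S2. (norm (w p))\<^sup>2 / real p) \<le> E"
        unfolding EE using finS by (intro sum_mono2) (auto simp: S2_def)
      then show ?thesis using E0 by (intro real_sqrt_le_mono) linarith
    qed
    finally show ?thesis .
  qed

  have 2: "(\<Sum>n\<in>G. norm (h n - mu)) \<le> real N * ((real A + 3) * sqrt (6 * E))"
  proof -
    define e where "e p n = of_bool (int p dvd P n) - 1 / real p" for p n
    have mu: "mu = (\<Sum>p\<in>S1. w p / of_nat p) + (\<Sum>p\<in>{p\<in>S2. p \<le> N}. w p / of_nat p)"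
    proof -
      have "p \<le> N" if "p \<in> S1" for p
        using that self_le_power[of p 2] SP(4)[of p] by (auto simp: S1_def)
      then have "{p. prime p \<and> y < p \<and> p \<le> N} = S1 \<union> {p\<in>S2. p \<le> N}"
        using NM by (auto simp: S1_def S2_def S_def)
      moreover have "S1 \<inter> {p\<in>S2. p \<le> N} = {}" by (auto simp: S1_def S2_def)
      ultimately show ?thesis unfolding mu_def using finS by (simp add: sum.union_disjoint)
    qed
    have hsplit: "h n = (\<Sum>p\<in>S1. w p * of_bool (int p dvd P n)) + (\<Sum>p\<in>S2. w p * of_bool (int p dvd P n))" for n
    proof -
      have S12: "S = S1 \<union> S2" "S1 \<inter> S2 = {}" by (auto simp: S1_def S2_def)
      show ?thesis unfolding h_def S12(1) using finS(2,3) S12(2) by (rule sum.union_disjoint)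
    qed
    have split: "h n - mu = (\<Sum>p\<in>S1. w p * of_real (e p n))
        + ((\<Sum>p\<in>S2. w p * of_bool (int p dvd P n)) - (\<Sum>p\<in>{p\<in>S2. p \<le> N}. w p / of_nat p))" for n
    proof -
      have "(\<Sum>p\<in>S1. w p * of_real (e p n))
          = (\<Sum>p\<in>S1. w p * of_bool (int p dvd P n)) - (\<Sum>p\<in>S1. w p / of_nat p)"
        unfolding sum_subtractf[symmetric]
        by (intro sum.cong refl) (auto simp: e_def of_bool_def algebra_simps)
      then show ?thesis by (simp add: mu hsplit)
    qed
    have a1: "(\<Sum>n\<in>G. norm (\<Sum>p\<in>S1. w p * of_real (e p n))) \<le> real N * sqrt (6 * E)"
    proof -
      have "(\<Sum>n\<in>G. norm (\<Sum>p\<in>S1. w p * of_real (e p n)))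
          \<le> (\<Sum>n<N. norm (\<Sum>p\<in>S1. w p * of_real (e p n)))"
        by (intro sum_mono2) (auto simp: G_def)
      also have "\<dots> \<le> sqrt (real N * (real N * (6 * E)))"
      proof (rule real_le_rsqrt)
        have "(\<Sum>n<N. norm (\<Sum>p\<in>S1. w p * of_real (e p n)))\<^sup>2
            \<le> real N * (\<Sum>n<N. (norm (\<Sum>p\<in>S1. w p * of_real (e p n)))\<^sup>2)"
          using Cauchy_Schwarz_ineq_sum[of "\<lambda>_. 1" "\<lambda>n. norm (\<Sum>p\<in>S1. w p * of_real (e p n))" "{..<N}"]
          by simp
        also have "(\<Sum>n<N. (norm (\<Sum>p\<in>S1. w p * of_real (e p n)))\<^sup>2)
            \<le> 6 * real N * (\<Sum>p\<in>S1. (norm (w p))\<^sup>2 / real p)"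
          unfolding e_def P_def
        proof (rule turan_kubilius)
          fix p assume p: "p \<in> S1"
          then have pS: "p \<in> S" by (simp add: S1_def)
          have "\<not> int p dvd a"
            using zdvd_imp_le[of "int p" a] a y SP(2)[OF pS] by auto
          then show "prime p \<and> coprime (int p) a \<and> p\<^sup>2 \<le> N"
            using p SP(1)[OF pS] by (auto simp: S1_def intro!: prime_imp_coprime)
        qed (use finS in auto)
        also have "\<dots> \<le> 6 * real N * E" using E1 by (intro mult_left_mono) auto
        finally show "(\<Sum>n<N. norm (\<Sum>p\<in>S1. w p * of_real (e p n)))\<^sup>2 \<le> real N * (real N * (6 * E))"
          by (simp add: mult_left_mono mult_right_mono mult_ac)
      qed
      also have "\<dots> = real N * sqrt (6 * E)"
        by (simp add: real_sqrt_mult flip: mult.assoc)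
      finally show ?thesis .
    qed
    have a2: "(\<Sum>n\<in>G. norm (\<Sum>p\<in>S2. w p * of_bool (int p dvd P n))) \<le> (real A + 1) * real N * sqrt (6 * E)"
    proof -
      have "(\<Sum>n\<in>G. norm (\<Sum>p\<in>S2. w p * of_bool (int p dvd P n)))
          \<le> (\<Sum>n\<in>G. \<Sum>p\<in>S2. norm (w p) * of_bool (int p dvd P n))"
        by (intro sum_mono order_trans[OF norm_sum]) (auto simp: norm_mult)
      also have "\<dots> = (\<Sum>p\<in>S2. norm (w p) * (\<Sum>n\<in>G. of_bool (int p dvd P n)))"
        by (subst sum.swap) (simp add: sum_distrib_left)
      also have "\<dots> \<le> (\<Sum>p\<in>S2. norm (w p) * ((real A + 1) * real N / real p))"
        using order_trans[OF cnt hits] by (intro sum_mono mult_left_mono) (auto simp: S2_def)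
      also have "\<dots> = (real A + 1) * real N * (\<Sum>p\<in>S2. norm (w p) / real p)"
        by (simp add: sum_distrib_left mult_ac)
      also have "\<dots> \<le> (real A + 1) * real N * sqrt (6 * E)"
        using large by (intro mult_left_mono) auto
      finally show ?thesis .
    qed
    have a3: "norm (\<Sum>p\<in>{p\<in>S2. p \<le> N}. w p / of_nat p) \<le> sqrt (6 * E)"
    proof -
      have "norm (\<Sum>p\<in>{p\<in>S2. p \<le> N}. w p / of_nat p) \<le> (\<Sum>p\<in>{p\<in>S2. p \<le> N}. norm (w p) / real p)"
        by (intro order_trans[OF norm_sum] sum_mono) (simp add: norm_divide)
      also have "\<dots> \<le> (\<Sum>p\<in>S2. norm (w p) / real p)"
        using finS by (intro sum_mono2) auto
      finally show ?thesis using large by simp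
    qed
    have cG: "real (card G) \<le> real N"
      using card_mono[of "{..<N}" G] by (auto simp: G_def)
    have "(\<Sum>n\<in>G. norm (h n - mu))
        \<le> (\<Sum>n\<in>G. norm (\<Sum>p\<in>S1. w p * of_real (e p n))
            + (norm (\<Sum>p\<in>S2. w p * of_bool (int p dvd P n))
               + norm (\<Sum>p\<in>{p\<in>S2. p \<le> N}. w p / of_nat p)))"
      unfolding split
      by (intro sum_mono order_trans[OF norm_triangle_ineq] add_mono order_refl norm_triangle_ineq4)
    also have "\<dots> = (\<Sum>n\<in>G. norm (\<Sum>p\<in>S1. w p * of_real (e p n)))
            + ((\<Sum>n\<in>G. norm (\<Sum>p\<in>S2. w p * of_bool (int p dvd P n)))
               + real (card G) * norm (\<Sum>p\<in>{p\<in>S2. p \<le> N}. w p / of_nat p))"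
      by (simp only: sum.distrib sum_constant)
    also have "\<dots> \<le> real N * sqrt (6 * E) + ((real A + 1) * real N * sqrt (6 * E) + real N * sqrt (6 * E))"
      using a1 a2 a3 cG by (intro add_mono mult_mono) auto
    also have "\<dots> = real N * ((real A + 3) * sqrt (6 * E))" by (simp add: algebra_simps)
    finally show ?thesis .
  qed

  have Rh: "Re (h n) \<le> 0" for n
    unfolding h_def Re_sum using w0 SP(4) by (intro sum_nonpos) (auto simp: of_bool_def)
  have Rmu: "Re mu \<le> 0"
    unfolding mu_def Re_sum using w0
    by (intro sum_nonpos) (auto simp: Re_divide_of_nat divide_nonpos_nonneg prime_gt_0_nat)
  have "(\<Sum>n\<in>G. norm (rough_part y f (nat (P n)) - exp mu))
      \<le> (\<Sum>n\<in>G. norm (rough_part y f (nat (P n)) - exp (h n)) + norm (h n - mu))"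
  proof (intro sum_mono)
    fix n
    show "norm (rough_part y f (nat (P n)) - exp mu)
        \<le> norm (rough_part y f (nat (P n)) - exp (h n)) + norm (h n - mu)"
      using norm_triangle_ineq[of "rough_part y f (nat (P n)) - exp (h n)" "exp (h n) - exp mu"]
        norm_exp_diff_le[OF Rh Rmu, of n] by simp
  qed
  also have "\<dots> \<le> (real N * ((real A + 1) * E + 2 / real y) + 2 * sqrt (real M))
      + real N * ((real A + 3) * sqrt (6 * E))"
    using 1 2 by (simp add: sum.distrib)
  finally show ?thesis
    unfolding G_def P_def mu_def w_def M_def by (simp add: algebra_simps)
qed


text \<open>
  The order of the quantifiers matters: the error is small for fixed \<open>y\<close> as \<open>N\<close> grows, so the
  primes up to \<open>y\<close> can be treated with \<open>y\<close> fixed.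
\<close>

lemma rough_part_concentration:
  fixes a c :: int and f :: "nat \<Rightarrow> complex"
  assumes a: "a \<ge> 1" and ac: "gcd a c = 1" and f: "\<And>n. n > 0 \<Longrightarrow> norm (f n) \<le> 1"
    and sm: "(\<lambda>p. (norm (f p - 1))\<^sup>2 / real p) summable_on {p. prime p}" and e: "e > 0"
  shows "\<forall>\<^sub>F y in sequentially. \<forall>\<^sub>F N in sequentially.
          (\<Sum>n | n < N \<and> a * int n + c > 0.
            norm (rough_part y f (nat (a * int n + c))
                  - exp (\<Sum>p | prime p \<and> y < p \<and> p \<le> N. (f p - 1) / of_nat p))) \<le> e * real N"
proof -
  define A where "A = nat a + nat \<bar>c\<bar>"
  define B where "B = real A + 3"
  have B: "B \<ge> 3" by (simp add: B_def)
  \<comment> \<open>The four error terms of \<open>rough_part_L1_le\<close>, divided by \<open>N\<close>, become at most \<open>e/8\<close>, \<open>e/4\<close>, \<open>3e/8\<close> and \<open>e/4\<close>.\<close>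
  define E where "E = min (e / (8 * B)) ((e / (8 * B))\<^sup>2)"
  have E: "E > 0" using e B by (simp add: E_def)
  obtain y0 where y0: "\<And>S. finite S \<Longrightarrow> S \<subseteq> {p. prime p} \<Longrightarrow> (\<And>p. p \<in> S \<Longrightarrow> y0 < p)
      \<Longrightarrow> (\<Sum>p\<in>S. (norm (f p - 1))\<^sup>2 / real p) \<le> E"
    using summable_tail_small[OF sm _ E] by auto
  obtain y1 :: nat where y1: "real y1 > 8 / e" using reals_Archimedean2 by blast
  have "y1 > 0" using y1 e by (metis divide_pos_pos gr0I less_asym of_nat_0 zero_less_numeral)
  show ?thesis
    unfolding eventually_sequentially
  proof (intro exI allI impI)
    fix y N assume y: "y \<ge> max (nat a) (max y0 y1)"
      and N: "N \<ge> max (A\<^sup>2) (nat \<lceil>64 * real A / e\<^sup>2\<rceil>)"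
    define E' where "E' = (\<Sum>p | prime p \<and> y < p \<and> p \<le> A * N. (norm (f p - 1))\<^sup>2 / real p)"
    have E': "E' \<le> E" unfolding E'_def using y by (intro y0) auto
    have E'0: "E' \<ge> 0" unfolding E'_def by (intro sum_nonneg) auto
    have "(real A + 1) * E' \<le> B * (e / (8 * B))"
      using E' E'0 B e by (intro mult_mono) (auto simp: B_def E_def)
    also have "\<dots> = e / 8" using B by simp
    finally have 1: "(real A + 1) * E' \<le> e / 8" .
    have "2 / real y \<le> 2 / real y1"
      using y \<open>y1 > 0\<close> by (intro divide_left_mono) auto
    also have "\<dots> \<le> e / 4" using y1 e \<open>y1 > 0\<close> by (simp add: field_simps)
    finally have 2: "2 / real y \<le> e / 4" .
    have "sqrt (6 * E') \<le> sqrt ((3 * (e / (8 * B)))\<^sup>2)"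
    proof (intro real_sqrt_le_mono)
      have "6 * E' \<le> 9 * E" using E' E'0 by simp
      also have "\<dots> \<le> 9 * (e / (8 * B))\<^sup>2" by (simp add: E_def)
      finally show "6 * E' \<le> (3 * (e / (8 * B)))\<^sup>2" unfolding power_mult_distrib by simp
    qed
    also have "\<dots> = 3 * (e / (8 * B))" using e B by (simp add: real_sqrt_abs)
    finally have "B * sqrt (6 * E') \<le> B * (3 * (e / (8 * B)))"
      using B by (intro mult_left_mono) auto
    also have "\<dots> = 3 * e / 8" using B by simp
    finally have 3: "(real A + 3) * sqrt (6 * E') \<le> 3 * e / 8" by (simp add: B_def)
    have 4: "2 * sqrt (real (A * N)) \<le> e / 4 * real N"
    proof -
      have "64 * real A / e\<^sup>2 \<le> real N" using N by linarith
      then have "real A * real N \<le> (real N * e\<^sup>2 / 64) * real N"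
        using e by (intro mult_right_mono) (auto simp: field_simps)
      also have "\<dots> = (real N * e / 8)\<^sup>2" by (simp add: power2_eq_square)
      finally have "sqrt (real (A * N)) \<le> real N * e / 8"
        using e by (intro real_le_lsqrt) auto
      then show ?thesis by (simp add: mult.commute)
    qed
    have "(\<Sum>n | n < N \<and> a * int n + c > 0.
            norm (rough_part y f (nat (a * int n + c))
                  - exp (\<Sum>p | prime p \<and> y < p \<and> p \<le> N. (f p - 1) / of_nat p)))
         \<le> real N * ((real A + 1) * E' + 2 / real y + (real A + 3) * sqrt (6 * E'))
           + 2 * sqrt (real (A * N))"
      using y N by (intro rough_part_L1_le[OF a ac f _ A_def _ E'_def]) auto
    also have "\<dots> \<le> real N * (e / 8 + e / 4 + 3 * e / 8) + e / 4 * real N"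
      using 1 2 3 4 by (intro add_mono mult_left_mono) auto
    also have "\<dots> = e * real N" by (simp add: algebra_simps)
    finally show "(\<Sum>n | n < N \<and> a * int n + c > 0.
            norm (rough_part y f (nat (a * int n + c))
                  - exp (\<Sum>p | prime p \<and> y < p \<and> p \<le> N. (f p - 1) / of_nat p))) \<le> e * real N" .
  qed
qed

section \<open>Mean values of periodic functions\<close>

lemma periodic_add_mult:
  fixes T :: "nat \<Rightarrow> 'a"
  assumes "\<And>n. T (n + q) = T n"
  shows "T (n + q * k) = T n"
proof (induction k)
  case (Suc k)
  have "T (n + q * Suc k) = T (n + q * k + q)" by (simp add: algebra_simps)
  then show ?case using Suc assms by simp
qed simp

lemma periodic_mod:
  fixes T :: "nat \<Rightarrow> 'a"
  assumes "\<And>n. T (n + q) = T n"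
  shows "T (n mod q) = T n"
  using periodic_add_mult[of T q "n mod q" "n div q", OF assms] by (simp add: add.commute)

lemma sum_coprime_periods:
  fixes T1 T2 :: "nat \<Rightarrow> complex"
  assumes "coprime q1 q2" "q1 > 0" "q2 > 0"
    and "\<And>n. T1 (n + q1) = T1 n" "\<And>n. T2 (n + q2) = T2 n"
  shows "(\<Sum>n<q1 * q2. T1 n * T2 n) = (\<Sum>n<q1. T1 n) * (\<Sum>n<q2. T2 n)"
proof -
  define g where "g n = (n mod q1, n mod q2)" for n
  have inj: "inj_on g {..<q1 * q2}"
  proof (rule inj_onI)
    fix m n assume mn: "m \<in> {..<q1 * q2}" "n \<in> {..<q1 * q2}" "g m = g n"
    then have "[m = n] (mod q1)" "[m = n] (mod q2)" by (auto simp: g_def cong_def)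
    then have "[m = n] (mod q1 * q2)" using assms(1) by (rule coprime_cong_mult_nat)
    then show "m = n" using mn by (auto intro: cong_less_modulus_unique_nat)
  qed
  have "g ` {..<q1 * q2} = {..<q1} \<times> {..<q2}"
  proof (rule card_subset_eq)
    show "g ` {..<q1 * q2} \<subseteq> {..<q1} \<times> {..<q2}" using assms by (auto simp: g_def)
    show "card (g ` {..<q1 * q2}) = card ({..<q1} \<times> {..<q2})"
      using card_image[OF inj] by (simp add: card_cartesian_product)
  qed simp
  then have bij: "bij_betw g {..<q1 * q2} ({..<q1} \<times> {..<q2})" using inj by (simp add: bij_betw_def)
  have "(\<Sum>n<q1 * q2. T1 n * T2 n) = (\<Sum>n<q1 * q2. (\<lambda>(i, j). T1 i * T2 j) (g n))"
    unfolding g_def using periodic_mod[of T1 q1, OF assms(4)] periodic_mod[of T2 q2, OF assms(5)] by simp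
  also have "\<dots> = (\<Sum>(i, j)\<in>{..<q1} \<times> {..<q2}. T1 i * T2 j)"
    by (rule sum.reindex_bij_betw[OF bij])
  also have "\<dots> = (\<Sum>n<q1. T1 n) * (\<Sum>n<q2. T2 n)"
    by (simp add: sum_product sum.cartesian_product)
  finally show ?thesis .
qed

lemma sum_prod_coprime_periods:
  fixes T :: "'i \<Rightarrow> nat \<Rightarrow> complex" and q :: "'i \<Rightarrow> nat"
  assumes "finite X"
    and "\<And>i j. i \<in> X \<Longrightarrow> j \<in> X \<Longrightarrow> i \<noteq> j \<Longrightarrow> coprime (q i) (q j)"
    and "\<And>i. i \<in> X \<Longrightarrow> q i > 0" and "\<And>i n. i \<in> X \<Longrightarrow> T i (n + q i) = T i n"
  shows "(\<Prod>i\<in>X. T i (n + prod q X)) = (\<Prod>i\<in>X. T i n)"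
    and "(\<Sum>n<prod q X. \<Prod>i\<in>X. T i n) = (\<Prod>i\<in>X. \<Sum>n<q i. T i n)"
proof -
  have shift: "T i (n + m) = T i n" if "i \<in> X" "q i dvd m" for i n m
  proof -
    from that(2) obtain k where "m = q i * k" by blast
    then show ?thesis using periodic_add_mult[of "T i" "q i", OF assms(4)[OF that(1)]] by simp
  qed
  have *: "(\<Prod>i\<in>Y. T i (n + prod q Y)) = (\<Prod>i\<in>Y. T i n)" if "Y \<subseteq> X" for Y n
    using that finite_subset[OF that assms(1)]
    by (intro prod.cong refl shift) (auto intro: dvd_prodI)
  show "(\<Prod>i\<in>X. T i (n + prod q X)) = (\<Prod>i\<in>X. T i n)" by (rule *) simp
  have "(\<Sum>n<prod q Y. \<Prod>i\<in>Y. T i n) = (\<Prod>i\<in>Y. \<Sum>n<q i. T i n)" if "Y \<subseteq> X" for Y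
    using finite_subset[OF that assms(1)] that
  proof (induction Y rule: finite_induct)
    case (insert x Y)
    have "(\<Sum>n<q x * prod q Y. T x n * (\<Prod>i\<in>Y. T i n)) = (\<Sum>n<q x. T x n) * (\<Sum>n<prod q Y. \<Prod>i\<in>Y. T i n)"
    proof (rule sum_coprime_periods)
      show "coprime (q x) (prod q Y)"
        using insert assms(2) by (intro prod_coprime_right) auto
      show "prod q Y > 0" using insert assms(3) by (intro prod_pos) auto
      show "(\<Prod>i\<in>Y. T i (n + prod q Y)) = (\<Prod>i\<in>Y. T i n)" for n using insert by (intro *) auto
    qed (use insert assms in auto)
    then show ?case using insert by simp
  qed simp
  then show "(\<Sum>n<prod q X. \<Prod>i\<in>X. T i n) = (\<Prod>i\<in>X. \<Sum>n<q i. T i n)" by blast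
qed

lemma tendsto_norm_bounded_div:
  fixes z :: "nat \<Rightarrow> complex"
  assumes "\<And>n. norm (z n) \<le> B"
  shows "(\<lambda>n. z n / of_nat n) \<longlonglongrightarrow> 0"
proof (rule Lim_null_comparison)
  show "\<forall>\<^sub>F n in sequentially. norm (z n / of_nat n) \<le> B * inverse (real n)"
    using assms by (intro always_eventually allI) (auto simp: norm_mult norm_inverse divide_inverse intro: mult_right_mono)
  show "(\<lambda>n. B * inverse (real n)) \<longlonglongrightarrow> 0"
    using tendsto_mult_right_zero[OF lim_inverse_n] by blast
qed

text \<open>
  The partial sums of the centred function \<open>T - m\<close> are periodic, hence bounded. Summation by
  parts therefore bounds the average by the average of \<open>|V (n + 1) - V n|\<close>.
\<close>

lemma periodic_times_slow:
  fixes V T :: "nat \<Rightarrow> complex"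
  assumes per: "\<And>n. T (n + q) = T n" and q: "q > 0" and m: "m = (\<Sum>n<q. T n) / of_nat q"
    and V: "\<And>n. norm (V n) \<le> 1" and slow: "(\<lambda>n. V (Suc n) - V n) \<longlonglongrightarrow> 0"
  shows "(\<lambda>N. (\<Sum>n<N. V n * (T n - m)) / of_nat N) \<longlonglongrightarrow> 0"
proof -
  define D where "D N = (\<Sum>n<N. T n - m)" for N
  have D_per: "D (N + q) = D N" for N
  proof (induction N)
    case 0
    have "D q = (\<Sum>n<q. T n) - of_nat q * m" by (simp add: D_def sum_subtractf)
    then show ?case using q by (simp add: m D_def)
  next
    case (Suc N)
    then show ?case using per by (simp add: D_def)
  qed
  define B where "B = (\<Sum>k<q. norm (D k))"
  have DB: "norm (D N) \<le> B" for N
  proof -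
    have "norm (D N) = norm (D (N mod q))" using periodic_mod[of D q, OF D_per] by simp
    also have "\<dots> \<le> B" unfolding B_def using q by (intro member_le_sum) auto
    finally show ?thesis .
  qed
  have parts: "(\<Sum>n<N. V n * (T n - m)) = V N * D N - (\<Sum>n<N. (V (Suc n) - V n) * D (Suc n))" for N
    by (induction N) (simp_all add: D_def algebra_simps)
  have 1: "(\<lambda>N. V N * D N / of_nat N) \<longlonglongrightarrow> 0"
  proof (rule tendsto_norm_bounded_div)
    show "norm (V n * D n) \<le> 1 * B" for n
      unfolding norm_mult using V DB by (intro mult_mono) auto
  qed
  have "(\<lambda>n. (V (Suc n) - V n) * D (Suc n)) \<longlonglongrightarrow> 0"
  proof (rule Lim_null_comparison)
    show "\<forall>\<^sub>F n in sequentially. norm ((V (Suc n) - V n) * D (Suc n)) \<le> norm (V (Suc n) - V n) * B"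
      using DB by (intro always_eventually allI) (auto simp: norm_mult intro: mult_left_mono)
    show "(\<lambda>n. norm (V (Suc n) - V n) * B) \<longlonglongrightarrow> 0"
      using tendsto_mult_left_zero[OF tendsto_norm_zero[OF slow]] by blast
  qed
  from cesaro_null[OF this]
  have "(\<lambda>N. V N * D N / of_nat N - (\<Sum>n<N. (V (Suc n) - V n) * D (Suc n)) / of_nat N) \<longlonglongrightarrow> 0 - 0"
    by (intro tendsto_diff 1)
  then show ?thesis by (simp add: parts diff_divide_distrib)
qed

section \<open>Truncated Euler factors\<close>

text \<open>
  The value at \<open>m\<close> of \<open>\<Sum> \<theta>(i)\<close> over the \<open>i\<close> with \<open>p\<^sup>i | m\<close>, truncated at \<open>i \<le> K\<close>. For
  \<open>m > 0\<close> and \<open>h(p\<^sup>j) = \<Sum>\<^sub>i\<^sub>\<le>\<^sub>j \<theta>(i)\<close>, this is \<open>h(p\<^sup>j)\<close> with \<open>j\<close> the smaller of \<open>K\<close> and the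
  exponent of \<open>p\<close> in \<open>m\<close>. Defined through divisibility, it makes sense for every integer \<open>m\<close>
  and is visibly periodic modulo \<open>p\<^sup>K\<close>.
\<close>

definition cut :: "nat \<Rightarrow> (nat \<Rightarrow> complex) \<Rightarrow> nat \<Rightarrow> int \<Rightarrow> complex" where
  "cut p \<theta> K m = (\<Sum>i | i \<le> K \<and> int p ^ i dvd m. \<theta> i)"

lemma cut_eq:
  assumes "prime p" "m > 0"
  shows "cut p \<theta> K m = (\<Sum>i\<le>min K (multiplicity p (nat m)). \<theta> i)"
proof -
  have m0: "nat m \<noteq> 0" using assms(2) by simp
  have unit: "\<not> is_unit p" using assms(1) not_prime_unit by blast
  have dvd_iff: "int p ^ i dvd m \<longleftrightarrow> i \<le> multiplicity p (nat m)" for i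
  proof -
    have "int p ^ i dvd m \<longleftrightarrow> int (p ^ i) dvd int (nat m)" using assms(2) by simp
    also have "\<dots> \<longleftrightarrow> p ^ i dvd nat m" by (rule int_dvd_int_iff)
    also have "\<dots> \<longleftrightarrow> i \<le> multiplicity p (nat m)"
      by (rule power_dvd_iff_le_multiplicity[OF m0 unit])
    finally show ?thesis .
  qed
  have "{i. i \<le> K \<and> int p ^ i dvd m} = {..min K (multiplicity p (nat m))}"
    unfolding dvd_iff by auto
  then show ?thesis by (simp add: cut_def)
qed

lemma norm_cut_le:
  assumes "\<And>j. norm (\<Sum>i\<le>j. \<theta> i) \<le> 1"
  shows "norm (cut p \<theta> K m) \<le> 1"
proof -
  define I where "I = {i. i \<le> K \<and> int p ^ i dvd m}"
  have fin: "finite I" and "0 \<in> I" by (auto simp: I_def)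
  \<comment> \<open>The set of admissible exponents is an initial segment also for \<open>m = 0\<close>, where it is all of \<open>{..K}\<close>.\<close>
  have "I = {..Max I}"
  proof
    show "I \<subseteq> {..Max I}" using fin by auto
    have "Max I \<in> I" using fin \<open>0 \<in> I\<close> by (intro Max_in) auto
    then show "{..Max I} \<subseteq> I"
      by (auto simp: I_def intro: le_trans dvd_trans[OF le_imp_power_dvd])
  qed
  then have "cut p \<theta> K m = (\<Sum>i\<le>Max I. \<theta> i)" by (simp add: cut_def I_def)
  then show ?thesis using assms by simp
qed

lemma cut_periodic: "cut p \<theta> K (a * int (n + p ^ K) + c) = cut p \<theta> K (a * int n + c)"
proof -
  have "int p ^ i dvd a * int (n + p ^ K) + c \<longleftrightarrow> int p ^ i dvd a * int n + c" if "i \<le> K" for i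
  proof -
    have "int p ^ i dvd a * int (p ^ K)"
      using le_imp_power_dvd[OF that, of "int p"] by simp
    moreover have "a * int (n + p ^ K) + c = (a * int n + c) + a * int (p ^ K)"
      by (simp add: algebra_simps)
    ultimately show ?thesis by (simp only: dvd_add_left_iff)
  qed
  then have "{i. i \<le> K \<and> int p ^ i dvd a * int (n + p ^ K) + c} = {i. i \<le> K \<and> int p ^ i dvd a * int n + c}"
    by auto
  then show ?thesis by (simp only: cut_def)
qed

text \<open>
  The mean over one period of the truncated local functions along the two linear forms; its
  limit for \<open>K \<longlonglongrightarrow> \<infinity>\<close> is the local factor at \<open>p\<close>.
\<close>

definition cut_mean ::
  "nat \<Rightarrow> (nat \<Rightarrow> complex) \<Rightarrow> (nat \<Rightarrow> complex) \<Rightarrow> int \<Rightarrow> int \<Rightarrow> int \<Rightarrow> int \<Rightarrow> nat \<Rightarrow> complex" where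
  "cut_mean p \<theta> \<gamma> a c b d K =
     (\<Sum>n<p ^ K. cut p \<theta> K (a * int n + c) * cut p \<gamma> K (b * int n + d)) / of_nat (p ^ K)"

text \<open>
  Suppose \<open>i \<le> j\<close> and \<open>p\<^sup>j\<close> divides \<open>b n + d\<close>. As \<open>b\<close> is invertible modulo \<open>p\<close> and
  \<open>a (b n + d) - b (a n + c) = ad - bc\<close>, the condition \<open>p\<^sup>i | a n + c\<close> then holds for all such
  \<open>n\<close> or for none.
\<close>

lemma joint_density_le:
  assumes "gcd a c = 1" "gcd b d = 1" "prime p" "i \<le> j" "j \<le> K" "\<not> int p dvd b"
  shows "real (card {n. n < p ^ K \<and> int p ^ i dvd a * int n + c \<and> int p ^ j dvd b * int n + d}) / real (p ^ K)
         = (if int p ^ i dvd a * d - b * c then 1 / real p ^ j else 0)"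
proof -
  have iff: "int p ^ i dvd a * int n + c \<longleftrightarrow> int p ^ i dvd a * d - b * c" if "int p ^ j dvd b * int n + d" for n
  proof -
    have "coprime (int p) b" using assms(3,6) by (auto intro!: prime_imp_coprime)
    then have "int p ^ i dvd a * int n + c \<longleftrightarrow> int p ^ i dvd b * (a * int n + c)"
      by (simp add: coprime_dvd_mult_right_iff)
    also have "\<dots> \<longleftrightarrow> int p ^ i dvd a * (b * int n + d) - (a * d - b * c)"
      by (simp add: algebra_simps)
    also have "\<dots> \<longleftrightarrow> int p ^ i dvd a * d - b * c"
    proof (rule dvd_diff_right_iff)
      show "int p ^ i dvd a * (b * int n + d)"
        using that assms(4) by (meson dvd_mult dvd_trans le_imp_power_dvd)
    qed
    finally show ?thesis .
  qed
  have "{n. n < p ^ K \<and> int p ^ i dvd a * int n + c \<and> int p ^ j dvd b * int n + d}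
      = (if int p ^ i dvd a * d - b * c then {n. n < p ^ K \<and> int (p ^ j) dvd b * int n + d} else {})"
    using iff by auto
  moreover have "real (hits b d (p ^ j) (p ^ K)) = real (p ^ K) / real (p ^ j)"
    using assms by (intro hits_exact) (auto intro!: prime_imp_coprime le_imp_power_dvd simp: prime_gt_0_nat)
  ultimately show ?thesis using assms(3) by (auto simp: hits_def prime_gt_0_nat)
qed

lemma joint_density:
  assumes "gcd a c = 1" "gcd b d = 1" "prime p" "i \<le> K" "j \<le> K"
  shows "real (card {n. n < p ^ K \<and> int p ^ i dvd a * int n + c \<and> int p ^ j dvd b * int n + d}) / real (p ^ K)
         = (if int p ^ min i j dvd a * d - b * c \<and> (i > 0 \<longrightarrow> \<not> int p dvd a) \<and> (j > 0 \<longrightarrow> \<not> int p dvd b)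
            then 1 / real p ^ max i j else 0)"
proof -
  have p0: "p > 0" using assms(3) prime_gt_0_nat by blast
  have powd: "int p dvd x" if "int p ^ l dvd x" "l > 0" for x l
    using that by (meson dvd_power dvd_trans)
  \<comment> \<open>The case \<open>j \<le> i\<close> follows from \<open>i \<le> j\<close> by exchanging the two forms.\<close>
  have swap: "(n < p ^ K \<and> int p ^ i dvd a * int n + c \<and> int p ^ j dvd b * int n + d)
      \<longleftrightarrow> (n < p ^ K \<and> int p ^ j dvd b * int n + d \<and> int p ^ i dvd a * int n + c)" for n by auto
  have neg: "int p ^ j dvd a * d - b * c \<longleftrightarrow> int p ^ j dvd b * c - a * d"
    by (metis dvd_minus_iff minus_diff_eq)
  consider "i > 0 \<and> int p dvd a" | "j > 0 \<and> int p dvd b" | "i = 0" "j = 0"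
    | "i > 0 \<longrightarrow> \<not> int p dvd a" "j > 0" "\<not> int p dvd b" "i \<le> j"
    | "j > 0 \<longrightarrow> \<not> int p dvd b" "i > 0" "\<not> int p dvd a" "j \<le> i" by linarith
  then show ?thesis
  proof cases
    case 1
    then have "\<not> int p ^ i dvd a * int n + c" for n
      using not_dvd_linear_form[OF assms(1,3)] powd by blast
    then show ?thesis using 1 by simp
  next
    case 2
    then have "\<not> int p ^ j dvd b * int n + d" for n
      using not_dvd_linear_form[OF assms(2,3)] powd by blast
    then show ?thesis using 2 by simp
  next
    case 3
    then show ?thesis using p0 by simp
  next
    case 4
    then show ?thesis using joint_density_le[OF assms(1,2,3), of i j K] assms by simp
  next
    case 5
    then show ?thesis unfolding swap
      using joint_density_le[OF assms(2,1,3), of j i K] assms neg by (simp add: max_def min_def)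
  qed
qed

lemma cut_mean_eq_sum:
  assumes "gcd a c = 1" "gcd b d = 1" "prime p"
  shows "cut_mean p \<theta> \<gamma> a c b d K = (\<Sum>i\<le>K. \<Sum>j\<le>K. \<theta> i * \<gamma> j *
           (if int p ^ min i j dvd a * d - b * c \<and> (i > 0 \<longrightarrow> \<not> int p dvd a) \<and> (j > 0 \<longrightarrow> \<not> int p dvd b)
            then 1 / of_nat p ^ max i j else 0))"
proof -
  have cutE: "cut p \<theta> K m = (\<Sum>i\<le>K. \<theta> i * of_bool (int p ^ i dvd m))" for \<theta> m
    unfolding cut_def by (intro sum.mono_neutral_cong_left) auto
  define R where "R i j = real (card {n. n < p ^ K \<and> int p ^ i dvd a * int n + c \<and> int p ^ j dvd b * int n + d})" for i j
  have "(\<Sum>n<p ^ K. cut p \<theta> K (a * int n + c) * cut p \<gamma> K (b * int n + d))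
      = (\<Sum>n<p ^ K. \<Sum>i\<le>K. \<Sum>j\<le>K. \<theta> i * \<gamma> j *
           of_bool (int p ^ i dvd a * int n + c \<and> int p ^ j dvd b * int n + d))"
    unfolding cutE sum_product by (intro sum.cong refl) auto
  also have "\<dots> = (\<Sum>i\<le>K. \<Sum>n<p ^ K. \<Sum>j\<le>K. \<theta> i * \<gamma> j *
           of_bool (int p ^ i dvd a * int n + c \<and> int p ^ j dvd b * int n + d))"
    by (rule sum.swap)
  also have "\<dots> = (\<Sum>i\<le>K. \<Sum>j\<le>K. \<Sum>n<p ^ K. \<theta> i * \<gamma> j *
           of_bool (int p ^ i dvd a * int n + c \<and> int p ^ j dvd b * int n + d))"
    by (rule sum.cong[OF refl], rule sum.swap)
  also have "\<dots> = (\<Sum>i\<le>K. \<Sum>j\<le>K. \<theta> i * \<gamma> j * of_real (R i j))"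
  proof (intro sum.cong refl)
    fix i j
    have "{..<p ^ K} \<inter> {n. int p ^ i dvd a * int n + c \<and> int p ^ j dvd b * int n + d}
        = {n. n < p ^ K \<and> int p ^ i dvd a * int n + c \<and> int p ^ j dvd b * int n + d}" by auto
    then have "(\<Sum>n<p ^ K. of_bool (int p ^ i dvd a * int n + c \<and> int p ^ j dvd b * int n + d))
        = complex_of_real (R i j)"
      by (simp add: R_def sum_of_bool_eq)
    then show "(\<Sum>n<p ^ K. \<theta> i * \<gamma> j * of_bool (int p ^ i dvd a * int n + c \<and> int p ^ j dvd b * int n + d))
        = \<theta> i * \<gamma> j * of_real (R i j)"
      by (simp only: sum_distrib_left[symmetric])
  qed
  finally have "cut_mean p \<theta> \<gamma> a c b d K
      = (\<Sum>i\<le>K. \<Sum>j\<le>K. \<theta> i * \<gamma> j * of_real (R i j / real (p ^ K)))"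
    by (simp add: cut_mean_def sum_divide_distrib)
  also have "\<dots> = (\<Sum>i\<le>K. \<Sum>j\<le>K. \<theta> i * \<gamma> j *
           (if int p ^ min i j dvd a * d - b * c \<and> (i > 0 \<longrightarrow> \<not> int p dvd a) \<and> (j > 0 \<longrightarrow> \<not> int p dvd b)
            then 1 / of_nat p ^ max i j else 0))"
  proof (intro sum.cong refl)
    fix i j assume "i \<in> {..K}" "j \<in> {..K}"
    then show "\<theta> i * \<gamma> j * complex_of_real (R i j / real (p ^ K)) = \<theta> i * \<gamma> j *
           (if int p ^ min i j dvd a * d - b * c \<and> (i > 0 \<longrightarrow> \<not> int p dvd a) \<and> (j > 0 \<longrightarrow> \<not> int p dvd b)
            then 1 / of_nat p ^ max i j else 0)"
      unfolding R_def using joint_density[OF assms, of i K j]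
      by (simp only: atMost_iff if_distrib[of complex_of_real] of_real_0 of_real_divide of_real_1
          of_real_power of_real_of_nat_eq simp_thms)
  qed
  finally show ?thesis .
qed

text \<open>
  The local factors are given by unordered sums, whereas truncation at \<open>p\<^sup>K\<close> yields partial
  sums.
\<close>

lemma tendsto_infsum_greaterThan:
  fixes f :: "nat \<Rightarrow> complex"
  assumes "f summable_on {i<..}"
  shows "(\<lambda>K. \<Sum>j\<in>{i<..K}. f j) \<longlonglongrightarrow> (\<Sum>\<^sub>\<infinity>j\<in>{i<..}. f j)"
proof -
  have "filterlim (\<lambda>K. {i<..K}) (finite_subsets_at_top {i<..}) sequentially"
    unfolding filterlim_finite_subsets_at_top eventually_sequentially
  proof (intro allI impI)
    fix X assume X: "finite X \<and> X \<subseteq> {i<..}"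
    show "\<exists>N. \<forall>n\<ge>N. finite {i<..n} \<and> X \<subseteq> {i<..n} \<and> {i<..n} \<subseteq> {i<..}"
    proof (intro exI[of _ "Max (insert 0 X)"] allI impI conjI subsetI)
      fix n x assume n: "Max (insert 0 X) \<le> n" and x: "x \<in> X"
      have "x \<le> Max (insert 0 X)" using X x by simp
      then show "x \<in> {i<..n}" using n x X by auto
    qed auto
  qed
  moreover have "(sum f \<longlongrightarrow> infsum f {i<..}) (finite_subsets_at_top {i<..})"
    using has_sum_infsum[OF assms] by (simp add: has_sum_def)
  ultimately show ?thesis by (rule filterlim_compose[rotated])
qed

lemma norm_increment_le:
  fixes \<theta> :: "nat \<Rightarrow> complex"
  assumes "\<And>j. norm (\<Sum>i\<le>j. \<theta> i) \<le> 1"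
  shows "norm (\<theta> j) \<le> 2"
proof (cases j)
  case 0
  then show ?thesis using assms[of 0] by simp
next
  case (Suc k)
  have "\<theta> j = (\<Sum>i\<le>j. \<theta> i) - (\<Sum>i\<le>k. \<theta> i)" by (simp add: Suc)
  also have "norm \<dots> \<le> 1 + 1" by (intro order_trans[OF norm_triangle_ineq4] add_mono assms)
  finally show ?thesis by simp
qed

lemma summable_on_bounded_div_power:
  fixes h :: "nat \<Rightarrow> complex"
  assumes "p \<ge> 2" "\<And>j. norm (h j) \<le> B"
  shows "(\<lambda>j. h j / of_nat p ^ j) summable_on A"
proof -
  have "summable (\<lambda>j. norm (h j / of_nat p ^ j))"
  proof (rule summable_comparison_test)
    show "\<exists>N. \<forall>n\<ge>N. norm (norm (h n / of_nat p ^ n)) \<le> B * (1 / real p) ^ n"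
    proof (intro exI allI impI)
      fix n
      have "norm (h n) / real p ^ n \<le> B / real p ^ n"
        using assms by (intro divide_right_mono) auto
      then show "norm (norm (h n / of_nat p ^ n)) \<le> B * (1 / real p) ^ n"
        by (simp add: norm_divide norm_power power_one_over)
    qed
    show "summable (\<lambda>n. B * (1 / real p) ^ n)"
      using assms by (intro summable_mult summable_geometric) auto
  qed
  then show ?thesis
    by (intro summable_on_subset_banach[OF norm_summable_imp_summable_on]) auto
qed

lemma sum_square_split:
  fixes F :: "nat \<Rightarrow> nat \<Rightarrow> complex"
  shows "(\<Sum>i\<le>K. \<Sum>j\<le>K. F i j)
       = (\<Sum>i\<le>K. F i i + (\<Sum>j\<in>{i<..K}. F i j) + (\<Sum>j\<in>{i<..K}. F j i))"
proof (induction K)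
  case (Suc K)
  have *: "{i<..Suc K} = insert (Suc K) {i<..K}" if "i \<le> K" for i using that by auto
  have "(\<Sum>i\<le>Suc K. F i i + (\<Sum>j\<in>{i<..Suc K}. F i j) + (\<Sum>j\<in>{i<..Suc K}. F j i))
      = (\<Sum>i\<le>K. F i i + (\<Sum>j\<in>{i<..Suc K}. F i j) + (\<Sum>j\<in>{i<..Suc K}. F j i)) + F (Suc K) (Suc K)"
    by simp
  also have "(\<Sum>i\<le>K. F i i + (\<Sum>j\<in>{i<..Suc K}. F i j) + (\<Sum>j\<in>{i<..Suc K}. F j i))
      = (\<Sum>i\<le>K. (F i i + (\<Sum>j\<in>{i<..K}. F i j) + (\<Sum>j\<in>{i<..K}. F j i)) + (F i (Suc K) + F (Suc K) i))"
    by (intro sum.cong refl) (simp add: *)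
  also have "\<dots> = (\<Sum>i\<le>K. \<Sum>j\<le>K. F i j) + ((\<Sum>i\<le>K. F i (Suc K)) + (\<Sum>i\<le>K. F (Suc K) i))"
    by (simp add: sum.distrib Suc)
  finally show ?case by (simp add: sum.distrib)
qed simp

lemma cut_mean_common:
  assumes "gcd a c = 1" "gcd b d = 1" "prime p" "int p dvd a" "int p dvd b" "\<theta> 0 = 1" "\<gamma> 0 = 1"
  shows "cut_mean p \<theta> \<gamma> a c b d K = 1"
proof -
  have "cut_mean p \<theta> \<gamma> a c b d K = (\<Sum>i\<le>K. \<Sum>j\<le>K. if j = 0 then if i = 0 then 1 else 0 else 0)"
    unfolding cut_mean_eq_sum[OF assms(1-3)]
    by (intro sum.cong refl) (use assms in auto)
  also have "\<dots> = 1" by simp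
  finally show ?thesis .
qed

text \<open>
  The expression of the general formula for the local factor. With \<open>b = 0\<close> and \<open>\<gamma>\<close> supported
  at 0 it also describes the mean along a single linear form.
\<close>

definition euler_factor ::
  "nat \<Rightarrow> nat \<Rightarrow> (nat \<Rightarrow> complex) \<Rightarrow> (nat \<Rightarrow> complex) \<Rightarrow> int \<Rightarrow> int \<Rightarrow> complex" where
  "euler_factor p k \<theta> \<gamma> a b =
     (\<Sum>i = 0..k. \<theta> i * \<gamma> i / of_nat p ^ i
        + (if int p dvd b then 0 else 1) * (\<Sum>\<^sub>\<infinity>j\<in>{i<..}. \<theta> i * \<gamma> j / of_nat p ^ j)
        + (if int p dvd a then 0 else 1) * (\<Sum>\<^sub>\<infinity>j\<in>{i<..}. \<gamma> i * \<theta> j / of_nat p ^ j))"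

text \<open>
  Split the double sum over \<open>i, j \<le> K\<close> according to whether \<open>i = j\<close>, \<open>i < j\<close> or \<open>i > j\<close>. A
  term survives only if its smaller index is at most \<open>k\<close>; if that index is positive, then
  \<open>p | ad - bc\<close>, and then the coprimality conditions and the fact that \<open>p\<close> does not divide
  both \<open>a\<close> and \<open>b\<close> exclude that \<open>p\<close> divides \<open>a\<close> or \<open>b\<close>.
\<close>

lemma cut_mean_tendsto:
  assumes ac: "gcd a c = 1" and bd: "gcd b d = 1" and p: "prime p"
    and ab: "\<not> int p dvd gcd a b"
    and k: "int p ^ k dvd a * d - b * c" "\<not> int p ^ Suc k dvd a * d - b * c"
    and \<theta>: "\<And>j. norm (\<Sum>i\<le>j. \<theta> i) \<le> 1" and \<gamma>: "\<And>j. norm (\<Sum>i\<le>j. \<gamma> i) \<le> 1"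
  shows "cut_mean p \<theta> \<gamma> a c b d \<longlonglongrightarrow> euler_factor p k \<theta> \<gamma> a b"
proof -
  define da where "da = (if int p dvd a then 0 else 1 :: complex)"
  define db where "db = (if int p dvd b then 0 else 1 :: complex)"
  define D where "D = a * d - b * c"
  have p2: "p \<ge> 2" using p prime_ge_2_nat by blast
  have iD: "int p ^ i dvd D \<longleftrightarrow> i \<le> k" for i
    using k unfolding D_def by (meson dvd_trans le_imp_power_dvd not_less_eq_eq)
  have nd: "\<not> int p dvd a" "\<not> int p dvd b" if "i > 0" "int p ^ i dvd D" for i
  proof -
    have pD: "int p dvd a * d - b * c" using that unfolding D_def by (meson dvd_power dvd_trans)
    have "\<not> (int p dvd a \<and> int p dvd b)" using ab by simp
    moreover have pp: "prime (int p)" using p by simp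
    moreover have "\<not> (int p dvd a \<and> int p dvd c)"
      using not_dvd_linear_form[OF ac p, of 0] by auto
    moreover have "\<not> (int p dvd b \<and> int p dvd d)"
      using not_dvd_linear_form[OF bd p, of 0] by auto
    moreover have "int p dvd a * d \<longleftrightarrow> int p dvd b * c"
      using pD by (metis dvd_diff_commute diff_add_cancel dvd_add_right_iff)
    ultimately show "\<not> int p dvd a" "\<not> int p dvd b"
      using prime_dvd_mult_iff[OF pp] by (metis)+
  qed
  define F where "F i j = \<theta> i * \<gamma> j *
      (if int p ^ min i j dvd D \<and> (i > 0 \<longrightarrow> \<not> int p dvd a) \<and> (j > 0 \<longrightarrow> \<not> int p dvd b)
       then 1 / of_nat p ^ max i j else 0)" for i j
  define G where "G K i = \<theta> i * \<gamma> i / of_nat p ^ i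
        + db * (\<Sum>j\<in>{i<..K}. \<theta> i * \<gamma> j / of_nat p ^ j)
        + da * (\<Sum>j\<in>{i<..K}. \<gamma> i * \<theta> j / of_nat p ^ j)" for K i
  have Fii: "F i i = (if i \<le> k then \<theta> i * \<gamma> i / of_nat p ^ i else 0)" for i
    using nd[of i] by (auto simp: F_def iD)
  have Fij: "F i j = (if i \<le> k then db * (\<theta> i * \<gamma> j / of_nat p ^ j) else 0)" if "i < j" for i j
    using nd[of i] that by (auto simp: F_def iD db_def)
  have Fji: "F j i = (if i \<le> k then da * (\<gamma> i * \<theta> j / of_nat p ^ j) else 0)" if "i < j" for i j
    using nd[of i] that by (auto simp: F_def iD da_def)
  have eq: "cut_mean p \<theta> \<gamma> a c b d K = (\<Sum>i = 0..k. G K i)" if "k \<le> K" for K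
  proof -
    have "cut_mean p \<theta> \<gamma> a c b d K = (\<Sum>i\<le>K. \<Sum>j\<le>K. F i j)"
      unfolding cut_mean_eq_sum[OF ac bd p] F_def D_def ..
    also have "\<dots> = (\<Sum>i\<le>K. F i i + (\<Sum>j\<in>{i<..K}. F i j) + (\<Sum>j\<in>{i<..K}. F j i))"
      by (rule sum_square_split)
    also have "\<dots> = (\<Sum>i\<le>K. if i \<le> k then G K i else 0)"
      by (intro sum.cong refl) (auto simp: Fii Fij Fji G_def sum_distrib_left)
    also have "\<dots> = (\<Sum>i = 0..k. G K i)"
      using that by (intro sum.mono_neutral_cong_right) auto
    finally show ?thesis .
  qed
  have bound: "norm (\<alpha> i * \<beta> j) \<le> 2 * 2"
    if "\<And>j. norm (\<Sum>i\<le>j. \<alpha> i) \<le> 1" "\<And>j. norm (\<Sum>i\<le>j. \<beta> i) \<le> 1" for \<alpha> \<beta> :: "nat \<Rightarrow> complex" and i j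
    unfolding norm_mult using norm_increment_le[of \<alpha> i, OF that(1)] norm_increment_le[of \<beta> j, OF that(2)]
    by (intro mult_mono) auto
  have "(\<lambda>K. \<Sum>i = 0..k. G K i) \<longlonglongrightarrow> euler_factor p k \<theta> \<gamma> a b"
    unfolding euler_factor_def G_def da_def[symmetric] db_def[symmetric]
  proof (intro tendsto_intros tendsto_infsum_greaterThan)
    fix i
    show "(\<lambda>j. \<theta> i * \<gamma> j / of_nat p ^ j) summable_on {i<..}"
      by (intro summable_on_bounded_div_power[OF p2, where B = "2 * 2"] bound \<theta> \<gamma>)
    show "(\<lambda>j. \<gamma> i * \<theta> j / of_nat p ^ j) summable_on {i<..}"
      by (intro summable_on_bounded_div_power[OF p2, where B = "2 * 2"] bound \<theta> \<gamma>)
  qed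
  moreover have "\<forall>\<^sub>F K in sequentially. (\<Sum>i = 0..k. G K i) = cut_mean p \<theta> \<gamma> a c b d K"
    using eq by (intro eventually_sequentiallyI[of k]) auto
  ultimately show ?thesis by (rule Lim_transform_eventually)
qed

section \<open>Mean values of the smooth part\<close>

text \<open>
  The product \<open>S\<close> over the primes in \<open>X\<close> is approximated by the product of the functions
  truncated at \<open>p\<^sup>K\<close>. The two differ only if some \<open>p\<^sup>K\<^sup>+\<^sup>1\<close> divides one of the forms, which
  happens on a set of density at most \<open>2 |X| 2\<^sup>-\<^sup>K\<^sup>-\<^sup>1\<close>. The truncated product is periodic, its
  mean is a product by the Chinese remainder theorem, and the slowly varying weight \<open>V\<close>
  decouples from it.
\<close>

lemma smooth_part_mean:
  fixes X :: "nat set" and \<theta> \<gamma> :: "nat \<Rightarrow> nat \<Rightarrow> complex" and V L :: "nat \<Rightarrow> complex" and a c b d :: int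
  defines "S \<equiv> \<lambda>n. \<Prod>p\<in>X. (\<Sum>i\<le>multiplicity p (nat (a * int n + c)). \<theta> p i)
                      * (\<Sum>i\<le>multiplicity p (nat (b * int n + d)). \<gamma> p i)"
  assumes X: "finite X" "\<And>p. p \<in> X \<Longrightarrow> prime p"
    and ac: "gcd a c = 1" and bd: "gcd b d = 1"
    and \<theta>: "\<And>p j. p \<in> X \<Longrightarrow> norm (\<Sum>i\<le>j. \<theta> p i) \<le> 1"
    and \<gamma>: "\<And>p j. p \<in> X \<Longrightarrow> norm (\<Sum>i\<le>j. \<gamma> p i) \<le> 1"
    and L: "\<And>p. p \<in> X \<Longrightarrow> cut_mean p (\<theta> p) (\<gamma> p) a c b d \<longlonglongrightarrow> L p"
    and V: "\<And>n. norm (V n) \<le> 1" and slow: "(\<lambda>n. V (Suc n) - V n) \<longlonglongrightarrow> 0"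
    and pos: "\<And>n. V n \<noteq> 0 \<Longrightarrow> a * int n + c > 0 \<and> b * int n + d > 0"
  shows "(\<lambda>N. (\<Sum>n<N. V n * S n) / of_nat N - (\<Sum>n<N. V n) / of_nat N * (\<Prod>p\<in>X. L p)) \<longlonglongrightarrow> 0"
proof (rule LIMSEQ_I)
  fix e :: real assume e: "e > 0"
  define T where "T K p n = cut p (\<theta> p) K (a * int n + c) * cut p (\<gamma> p) K (b * int n + d)" for K p n
  define m where "m K = (\<Prod>p\<in>X. cut_mean p (\<theta> p) (\<gamma> p) a c b d K)" for K
  have "m \<longlonglongrightarrow> prod L X" unfolding m_def by (intro tendsto_prod L)
  from tendstoD[OF this, of "e / 4"]
  have Ep: "\<forall>\<^sub>F K in sequentially. norm (m K - prod L X) < e / 4"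
    using e by (simp add: dist_norm)
  have "(\<lambda>K. real (card X) * 4 * (1 / 2) ^ Suc K) \<longlonglongrightarrow> 0"
    by (intro tendsto_mult_right_zero LIMSEQ_Suc LIMSEQ_power_zero) auto
  then have "\<forall>\<^sub>F K in sequentially. real (card X) * 4 * (1 / 2) ^ Suc K < e / 4"
    using e by (elim order_tendstoD) simp
  from eventually_happens'[OF _ eventually_conj[OF Ep this]]
  obtain K where K1: "norm (m K - prod L X) < e / 4" and K2: "real (card X) * 4 * (1 / 2) ^ Suc K < e / 4"
    by auto
  define q where "q = (\<Prod>p\<in>X. p ^ K)"
  have q0: "q > 0" unfolding q_def using X(2) by (intro prod_pos) (auto simp: prime_gt_0_nat)
  have per: "T K p (n + p ^ K) = T K p n" for p n
    unfolding T_def cut_periodic ..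
  note crt = sum_prod_coprime_periods[of X "\<lambda>p. p ^ K" "T K", OF X(1) _ _ per, folded q_def]
  have cop: "coprime (p ^ K) (r ^ K)" if "p \<in> X" "r \<in> X" "p \<noteq> r" for p r
    using primes_coprime[OF X(2)[OF that(1)] X(2)[OF that(2)] that(3)] by simp
  have pos_pow: "p ^ K > 0" if "p \<in> X" for p using X(2)[OF that] prime_gt_0_nat by simp
  have mK: "m K = (\<Sum>n<q. \<Prod>p\<in>X. T K p n) / of_nat q"
    using crt(2)[OF cop pos_pow] unfolding m_def cut_mean_def T_def[symmetric] prod_dividef q_def
    by simp
  have lim: "(\<lambda>N. (\<Sum>n<N. V n * ((\<Prod>p\<in>X. T K p n) - m K)) / of_nat N) \<longlonglongrightarrow> 0"
    by (rule periodic_times_slow[OF crt(1)[OF cop pos_pow] q0 mK V slow])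
  obtain N1 where N1: "\<And>N. N \<ge> N1 \<Longrightarrow> norm ((\<Sum>n<N. V n * ((\<Prod>p\<in>X. T K p n) - m K)) / of_nat N) < e / 4"
    using LIMSEQ_D[OF lim, of "e / 4"] e by auto
  obtain N2 :: nat where N2: "real N2 > 16 * real (card X) / e" using reals_Archimedean2 by blast
  show "\<exists>no. \<forall>N\<ge>no. norm ((\<Sum>n<N. V n * S n) / of_nat N
      - (\<Sum>n<N. V n) / of_nat N * (\<Prod>p\<in>X. L p) - 0) < e"
  proof (intro exI[of _ "max 1 (max N1 N2)"] allI impI)
    fix N assume N: "N \<ge> max 1 (max N1 N2)"
    have N0: "real N > 0" using N by simp
    have close: "norm (V n * (S n - (\<Prod>p\<in>X. T K p n)))
        \<le> (\<Sum>p\<in>X. 2 * of_bool (int (p ^ Suc K) dvd a * int n + c) + 2 * of_bool (int (p ^ Suc K) dvd b * int n + d))" for n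
    proof (cases "V n = 0")
      case False
      then have P: "a * int n + c > 0" "b * int n + d > 0" using pos by auto
      have A: "norm (\<alpha> - \<beta>) \<le> 2" if "norm \<alpha> \<le> 1" "norm \<beta> \<le> 1" for \<alpha> \<beta> :: complex
        using order_trans[OF norm_triangle_ineq4[of \<alpha> \<beta>], of 2] that by simp
      have one: "norm ((\<Sum>i\<le>multiplicity p (nat x). \<eta> i) - cut p \<eta> K x) \<le> 2 * of_bool (int (p ^ Suc K) dvd x)"
        if "x > 0" "p \<in> X" "\<And>j. norm (\<Sum>i\<le>j. \<eta> i) \<le> 1" for x p and \<eta> :: "nat \<Rightarrow> complex"
      proof (cases "int (p ^ Suc K) dvd x")
        case True
        then show ?thesis using A[OF that(3) norm_cut_le[of \<eta> p K x, OF that(3)]] by simp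
      next
        case False
        have "\<not> p ^ Suc K dvd nat x"
        proof
          assume "p ^ Suc K dvd nat x"
          then have "int (p ^ Suc K) dvd int (nat x)" by (simp only: int_dvd_int_iff)
          then show False using False that(1) by simp
        qed
        then have "multiplicity p (nat x) < Suc K" using multiplicity_dvd' by (metis not_less)
        then have "min K (multiplicity p (nat x)) = multiplicity p (nat x)" by simp
        then show ?thesis by (simp add: cut_eq[OF X(2)[OF that(2)] that(1)])
      qed
      have "norm (V n * (S n - (\<Prod>p\<in>X. T K p n))) \<le> 1 * norm (S n - (\<Prod>p\<in>X. T K p n))"
        unfolding norm_mult using V by (intro mult_right_mono) auto
      also have "\<dots> \<le> (\<Sum>p\<in>X. norm ((\<Sum>i\<le>multiplicity p (nat (a * int n + c)). \<theta> p i)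
                      * (\<Sum>i\<le>multiplicity p (nat (b * int n + d)). \<gamma> p i) - T K p n))"
        unfolding S_def mult_1
        by (rule norm_prod_diff) (auto simp: T_def norm_mult intro!: mult_le_one \<theta> \<gamma> norm_cut_le)
      also have "\<dots> \<le> (\<Sum>p\<in>X. 2 * of_bool (int (p ^ Suc K) dvd a * int n + c) + 2 * of_bool (int (p ^ Suc K) dvd b * int n + d))"
      proof (intro sum_mono)
        fix p assume p: "p \<in> X"
        define \<alpha> where "\<alpha> = (\<Sum>i\<le>multiplicity p (nat (a * int n + c)). \<theta> p i)"
        define \<beta> where "\<beta> = (\<Sum>i\<le>multiplicity p (nat (b * int n + d)). \<gamma> p i)"
        define \<alpha>' where "\<alpha>' = cut p (\<theta> p) K (a * int n + c)"
        define \<beta>' where "\<beta>' = cut p (\<gamma> p) K (b * int n + d)"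
        have bd': "norm \<beta> \<le> 1" "norm \<alpha>' \<le> 1"
          using \<gamma>[OF p] norm_cut_le[of "\<theta> p" p K "a * int n + c", OF \<theta>[OF p]] by (auto simp: \<alpha>'_def \<beta>_def)
        have "norm (\<alpha> * \<beta> - \<alpha>' * \<beta>') = norm ((\<alpha> - \<alpha>') * \<beta> + \<alpha>' * (\<beta> - \<beta>'))"
          by (simp add: algebra_simps)
        also have "\<dots> \<le> norm (\<alpha> - \<alpha>') * norm \<beta> + norm \<alpha>' * norm (\<beta> - \<beta>')"
          by (intro order_trans[OF norm_triangle_ineq]) (simp add: norm_mult)
        also have "\<dots> \<le> norm (\<alpha> - \<alpha>') * 1 + 1 * norm (\<beta> - \<beta>')"
          using bd' by (intro add_mono mult_left_mono mult_right_mono) auto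
        also have "\<dots> \<le> 2 * of_bool (int (p ^ Suc K) dvd a * int n + c) + 2 * of_bool (int (p ^ Suc K) dvd b * int n + d)"
          using one[OF P(1) p, of "\<theta> p", OF \<theta>[OF p]] one[OF P(2) p, of "\<gamma> p", OF \<gamma>[OF p]]
          unfolding \<alpha>_def \<alpha>'_def \<beta>_def \<beta>'_def by linarith
        finally show "norm ((\<Sum>i\<le>multiplicity p (nat (a * int n + c)). \<theta> p i)
                      * (\<Sum>i\<le>multiplicity p (nat (b * int n + d)). \<gamma> p i) - T K p n)
            \<le> 2 * of_bool (int (p ^ Suc K) dvd a * int n + c) + 2 * of_bool (int (p ^ Suc K) dvd b * int n + d)"
          unfolding T_def \<alpha>_def \<alpha>'_def \<beta>_def \<beta>'_def .
      qed
      finally show ?thesis .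
    qed (auto intro!: sum_nonneg)
    have hitsum: "(\<Sum>n<N. of_bool (int l dvd a' * int n + c')) = real (hits a' c' l N)" for l a' c'
    proof -
      have "{..<N} \<inter> {n. int l dvd a' * int n + c'} = {n. n < N \<and> int l dvd a' * int n + c'}" by auto
      then show ?thesis by (simp add: hits_def sum_of_bool_eq)
    qed
    have hb: "real (hits a' c' (p ^ Suc K) N) \<le> real N * (1 / 2) ^ Suc K + 1"
      if "gcd a' c' = 1" "p \<in> X" for a' c' p
    proof -
      have "real N / real p ^ Suc K \<le> real N / 2 ^ Suc K"
        using prime_ge_2_nat[OF X(2)[OF that(2)]] by (intro divide_left_mono power_mono mult_pos_pos) auto
      then show ?thesis
        using hits_prime_power_le[OF that(1) X(2)[OF that(2)], of "Suc K" N] by (simp add: power_one_over)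
    qed
    have "norm (\<Sum>n<N. V n * (S n - (\<Prod>p\<in>X. T K p n)))
        \<le> (\<Sum>n<N. \<Sum>p\<in>X. 2 * of_bool (int (p ^ Suc K) dvd a * int n + c) + 2 * of_bool (int (p ^ Suc K) dvd b * int n + d))"
      by (intro order_trans[OF norm_sum] sum_mono close)
    also have "\<dots> = (\<Sum>p\<in>X. 2 * real (hits a c (p ^ Suc K) N) + 2 * real (hits b d (p ^ Suc K) N))"
      by (subst sum.swap) (simp only: sum.distrib sum_distrib_left[symmetric] hitsum)
    also have "\<dots> \<le> (\<Sum>p\<in>X. 2 * (real N * (1 / 2) ^ Suc K + 1) + 2 * (real N * (1 / 2) ^ Suc K + 1))"
      using hb[OF ac] hb[OF bd] by (intro sum_mono add_mono mult_left_mono) auto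
    also have "\<dots> = real N * (real (card X) * 4 * (1 / 2) ^ Suc K) + 4 * real (card X)"
      by (simp add: algebra_simps)
    also have "\<dots> \<le> real N * (e / 4) + real N * (e / 4)"
    proof (intro add_mono mult_left_mono)
      have "16 * real (card X) / e \<le> real N" using N N2 by linarith
      then show "4 * real (card X) \<le> real N * (e / 4)" using e by (simp add: field_simps)
    qed (use K2 in auto)
    finally have 1: "norm ((\<Sum>n<N. V n * (S n - (\<Prod>p\<in>X. T K p n))) / of_nat N) \<le> e / 2"
      using N0 by (simp add: norm_divide field_simps)
    have 2: "norm ((\<Sum>n<N. V n * ((\<Prod>p\<in>X. T K p n) - m K)) / of_nat N) < e / 4"
      using N by (intro N1) auto
    have "norm (\<Sum>n<N. V n) \<le> real N"
      using sum_norm_le[of "{..<N}" V "\<lambda>_. 1"] V by simp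
    then have "norm ((\<Sum>n<N. V n) / of_nat N) \<le> 1" using N0 by (simp add: norm_divide)
    then have 3: "norm ((\<Sum>n<N. V n) / of_nat N * (m K - prod L X)) \<le> 1 * (e / 4)"
      unfolding norm_mult using K1 by (intro mult_mono) auto
    have split: "(\<Sum>n<N. V n * S n) / of_nat N - (\<Sum>n<N. V n) / of_nat N * prod L X
        = (\<Sum>n<N. V n * (S n - (\<Prod>p\<in>X. T K p n))) / of_nat N
          + ((\<Sum>n<N. V n * ((\<Prod>p\<in>X. T K p n) - m K)) / of_nat N
          + (\<Sum>n<N. V n) / of_nat N * (m K - prod L X))"
      by (simp add: sum_subtractf right_diff_distrib diff_divide_distrib sum_distrib_right)
    have tri: "norm (\<alpha> + (\<beta> + \<eta>)) < e"
      if "norm \<alpha> \<le> e / 2" "norm \<beta> < e / 4" "norm \<eta> \<le> 1 * (e / 4)" for \<alpha> \<beta> \<eta> :: complex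
      using that norm_triangle_ineq[of \<alpha> "\<beta> + \<eta>"] norm_triangle_ineq[of \<beta> \<eta>] by linarith
    show "norm ((\<Sum>n<N. V n * S n) / of_nat N
      - (\<Sum>n<N. V n) / of_nat N * (\<Prod>p\<in>X. L p) - 0) < e"
      unfolding diff_zero split using 1 2 3 by (rule tri)
  qed
qed

section \<open>The twist \<open>n\<^sup>i\<^sup>t\<close> along linear forms\<close>

lemma n_it_eq_cis:
  assumes "n > 0"
  shows "n_it t n = cis (t * ln (real n))"
  using assms by (simp add: n_it_def powr_def cis_conv_exp Ln_of_nat mult_ac)

lemma norm_n_it: "n > 0 \<Longrightarrow> norm (n_it t n) = 1"
  by (simp add: n_it_eq_cis)

lemma of_real_powr_imaginary:
  assumes "x > 0"
  shows "complex_of_real x powr (\<i> * of_real s) = cis (s * ln x)"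
  using assms by (simp add: powr_def cis_conv_exp Ln_of_real mult_ac)

lemma norm_cis_diff_le: "norm (cis x - cis y) \<le> \<bar>x - y\<bar>"
proof -
  have "norm (exp (\<i> * of_real x) - exp (\<i> * of_real y)) \<le> norm (\<i> * of_real x - \<i> * of_real y)"
    by (rule norm_exp_diff_le) auto
  also have "\<dots> = norm (\<i> * of_real (x - y))" by (simp add: right_diff_distrib)
  also have "\<dots> = \<bar>x - y\<bar>" by (simp only: norm_mult norm_ii norm_of_real mult_1)
  finally show ?thesis by (simp add: cis_conv_exp)
qed

lemma tendsto_cis_diff:
  assumes "((\<lambda>n. x n - y n) \<longlongrightarrow> 0) F"
  shows "((\<lambda>n. cis (x n) - cis (y n)) \<longlongrightarrow> 0) F"
proof (rule Lim_null_comparison)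
  show "\<forall>\<^sub>F n in F. norm (cis (x n) - cis (y n)) \<le> \<bar>x n - y n\<bar>"
    using norm_cis_diff_le by (intro always_eventually allI)
  show "((\<lambda>n. \<bar>x n - y n\<bar>) \<longlongrightarrow> 0) F" using tendsto_rabs_zero[OF assms] .
qed

text \<open>
  The values \<open>P(n)\<^sup>i\<^sup>t Q(n)\<^sup>i\<^sup>u\<close>, set to 0 where a form is not positive, so that the excluded \<open>n\<close>
  disappear from all averages.
\<close>

definition twist :: "real \<Rightarrow> real \<Rightarrow> int \<Rightarrow> int \<Rightarrow> int \<Rightarrow> int \<Rightarrow> nat \<Rightarrow> complex" where
  "twist t u a c b d n =
     (if a * int n + c > 0 \<and> b * int n + d > 0
      then n_it t (nat (a * int n + c)) * n_it u (nat (b * int n + d)) else 0)"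

lemma norm_twist_le: "norm (twist t u a c b d n) \<le> 1"
  by (auto simp: twist_def norm_mult norm_n_it)

lemma eventually_linear_form_pos:
  assumes "a \<ge> 1"
  shows "\<forall>\<^sub>F n in sequentially. a * int n + c > 0"
proof (rule eventually_sequentiallyI)
  fix n assume "n \<ge> nat (\<bar>c\<bar> + 1)"
  then have "\<bar>c\<bar> + 1 \<le> int n" by linarith
  also have "int n \<le> a * int n" using mult_right_mono[OF assms, of "int n"] by simp
  finally show "a * int n + c > 0" by linarith
qed

definition twist_phase :: "real \<Rightarrow> real \<Rightarrow> int \<Rightarrow> int \<Rightarrow> int \<Rightarrow> int \<Rightarrow> nat \<Rightarrow> real" where
  "twist_phase t u a c b d n =
     t * ln (of_int a * real n + of_int c) + u * ln (of_int b * real n + of_int d)"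

lemma twist_eq_cis:
  assumes "a \<ge> 1" "b \<ge> 1"
  shows "\<forall>\<^sub>F n in sequentially. twist t u a c b d n = cis (twist_phase t u a c b d n)"
  using eventually_linear_form_pos[OF assms(1), of c] eventually_linear_form_pos[OF assms(2), of d]
  by eventually_elim (simp add: twist_def twist_phase_def n_it_eq_cis cis_mult)

lemma twist_slow:
  assumes "a \<ge> 1" "b \<ge> 1"
  shows "(\<lambda>n. twist t u a c b d (Suc n) - twist t u a c b d n) \<longlonglongrightarrow> 0"
proof (rule Lim_transform_eventually)
  have *: "(\<lambda>n. ln (\<alpha> * real (Suc n) + \<beta>) - ln (\<alpha> * real n + \<beta>)) \<longlonglongrightarrow> 0" if "\<alpha> > 0" for \<alpha> \<beta> :: real
    using that by real_asymp
  have "(\<lambda>n. t * (ln (of_int a * real (Suc n) + of_int c) - ln (of_int a * real n + of_int c))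
      + u * (ln (of_int b * real (Suc n) + of_int d) - ln (of_int b * real n + of_int d))) \<longlonglongrightarrow> t * 0 + u * 0"
    using assms by (intro tendsto_intros *) auto
  then have "(\<lambda>n. twist_phase t u a c b d (Suc n) - twist_phase t u a c b d n) \<longlonglongrightarrow> 0"
    by (simp add: twist_phase_def algebra_simps)
  then show "(\<lambda>n. cis (twist_phase t u a c b d (Suc n)) - cis (twist_phase t u a c b d n)) \<longlonglongrightarrow> 0"
    by (rule tendsto_cis_diff)
  have ev: "\<forall>\<^sub>F n in sequentially. twist t u a c b d n = cis (twist_phase t u a c b d n)"
    by (rule twist_eq_cis[OF assms])
  then have "\<forall>\<^sub>F n in sequentially. twist t u a c b d (Suc n) = cis (twist_phase t u a c b d (Suc n))"
    by (rule eventually_compose_filterlim[OF _ filterlim_Suc])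
  with ev show "\<forall>\<^sub>F n in sequentially. cis (twist_phase t u a c b d (Suc n)) - cis (twist_phase t u a c b d n)
      = twist t u a c b d (Suc n) - twist t u a c b d n"
    by eventually_elim simp
qed

text \<open>
  The discrete counterpart of integrating \<open>x\<^sup>i\<^sup>s\<close>: the sequence \<open>G(n) = n\<^sup>1\<^sup>+\<^sup>i\<^sup>s/(1 + i s)\<close> has
  increments \<open>(n + 1)\<^sup>i\<^sup>s + o(1)\<close>, and Cesaro's theorem sums the errors.
\<close>

lemma mean_n_it:
  "(\<lambda>N. (\<Sum>n<N. cis (s * ln (real (Suc n)))) / of_nat N - cis (s * ln (real N)) / (1 + \<i> * of_real s))
     \<longlonglongrightarrow> 0"
proof -
  have ne: "1 + \<i> * complex_of_real s \<noteq> 0" by (auto simp: complex_eq_iff)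
  define G where "G n = of_nat n * cis (s * ln (real n)) / (1 + \<i> * of_real s)" for n
  define \<delta> where "\<delta> n = s * (ln (real (Suc n)) - ln (real n))" for n
  have lim1: "(\<lambda>n. of_nat n * (1 - cis (- \<delta> n)) - \<i> * complex_of_real s) \<longlonglongrightarrow> 0"
  proof (rule Lim_null_comparison)
    show "\<forall>\<^sub>F n in sequentially. norm (of_nat n * (1 - cis (- \<delta> n)) - \<i> * complex_of_real s)
        \<le> real n * (\<delta> n)\<^sup>2 + \<bar>real n * \<delta> n - s\<bar>"
    proof (intro always_eventually allI)
      fix n
      have "norm (of_nat n * (1 - cis (- \<delta> n)) - \<i> * complex_of_real s)
          = norm (- (of_nat n * (exp (- \<i> * of_real (\<delta> n)) - (1 + - \<i> * of_real (\<delta> n))))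
                  + \<i> * of_real (real n * \<delta> n - s))"
        by (simp add: cis_conv_exp algebra_simps)
      also have "\<dots> \<le> real n * norm (exp (- \<i> * of_real (\<delta> n)) - (1 + - \<i> * of_real (\<delta> n)))
          + \<bar>real n * \<delta> n - s\<bar>"
        by (intro order_trans[OF norm_triangle_ineq] add_mono)
           (simp_all only: norm_minus_cancel norm_mult norm_of_nat norm_ii norm_of_real mult_1 order_refl)
      also have "norm (exp (- \<i> * of_real (\<delta> n)) - (1 + - \<i> * of_real (\<delta> n)))
          \<le> (norm (- \<i> * complex_of_real (\<delta> n)))\<^sup>2"
        by (rule norm_exp_minus_linear_le) simp
      also have "\<dots> = (\<delta> n)\<^sup>2" by (simp add: norm_mult)
      finally show "norm (of_nat n * (1 - cis (- \<delta> n)) - \<i> * complex_of_real s)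
          \<le> real n * (\<delta> n)\<^sup>2 + \<bar>real n * \<delta> n - s\<bar>" by (simp add: mult_left_mono)
    qed
    have "(\<lambda>n. real n * (ln (real (Suc n)) - ln (real n))\<^sup>2) \<longlonglongrightarrow> 0" by real_asymp
    then have "(\<lambda>n. s\<^sup>2 * (real n * (ln (real (Suc n)) - ln (real n))\<^sup>2)) \<longlonglongrightarrow> 0"
      by (rule tendsto_mult_right_zero)
    then have 1: "(\<lambda>n. real n * (\<delta> n)\<^sup>2) \<longlonglongrightarrow> 0"
      by (simp add: \<delta>_def power_mult_distrib mult_ac)
    have "(\<lambda>n. real n * (ln (real (Suc n)) - ln (real n)) - 1) \<longlonglongrightarrow> 0" by real_asymp
    then have "(\<lambda>n. s * (real n * (ln (real (Suc n)) - ln (real n)) - 1)) \<longlonglongrightarrow> 0"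
      by (rule tendsto_mult_right_zero)
    then have 2: "(\<lambda>n. real n * \<delta> n - s) \<longlonglongrightarrow> 0"
      by (simp add: \<delta>_def algebra_simps)
    show "(\<lambda>n. real n * (\<delta> n)\<^sup>2 + \<bar>real n * \<delta> n - s\<bar>) \<longlonglongrightarrow> 0"
      using tendsto_add[OF 1 tendsto_rabs_zero[OF 2]] by simp
  qed
  have step: "cis (s * ln (real (Suc n))) - (G (Suc n) - G n)
      = - (cis (s * ln (real (Suc n))) / (1 + \<i> * of_real s)
           * (of_nat n * (1 - cis (- \<delta> n)) - \<i> * complex_of_real s))" for n
  proof -
    define w where "w = cis (s * ln (real (Suc n)))"
    have *: "cis (s * ln (real n)) = w * cis (- \<delta> n)"
      by (simp add: w_def cis_mult \<delta>_def algebra_simps)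
    have "(G (Suc n) - G n) * (1 + \<i> * of_real s) = of_nat (Suc n) * w - of_nat n * (w * cis (- \<delta> n))"
      unfolding G_def * w_def using ne by (simp add: diff_divide_distrib[symmetric])
    then have GG: "G (Suc n) - G n = (of_nat (Suc n) * w - of_nat n * (w * cis (- \<delta> n))) / (1 + \<i> * of_real s)"
      using ne by (simp add: eq_divide_eq)
    show ?thesis unfolding GG w_def[symmetric] using ne by (simp add: divide_simps) (simp add: algebra_simps)
  qed
  have lim2: "(\<lambda>n. cis (s * ln (real (Suc n))) - (G (Suc n) - G n)) \<longlonglongrightarrow> 0"
  proof (rule Lim_null_comparison)
    show "(\<lambda>n. norm (1 / (1 + \<i> * complex_of_real s)) * norm (of_nat n * (1 - cis (- \<delta> n)) - \<i> * complex_of_real s)) \<longlonglongrightarrow> 0"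
      by (intro tendsto_mult_right_zero tendsto_norm_zero lim1)
    show "\<forall>\<^sub>F n in sequentially. norm (cis (s * ln (real (Suc n))) - (G (Suc n) - G n))
        \<le> norm (1 / (1 + \<i> * complex_of_real s)) * norm (of_nat n * (1 - cis (- \<delta> n)) - \<i> * complex_of_real s)"
      unfolding step by (intro always_eventually allI) (simp add: norm_mult norm_divide)
  qed
  have "(\<Sum>n<N. cis (s * ln (real (Suc n))) - (G (Suc n) - G n)) = (\<Sum>n<N. cis (s * ln (real (Suc n)))) - G N" for N
    unfolding sum_subtractf[of _ "\<lambda>n. G (Suc n) - G n"] sum_lessThan_telescope by (simp add: G_def)
  with cesaro_null[OF lim2]
  have "(\<lambda>N. ((\<Sum>n<N. cis (s * ln (real (Suc n)))) - G N) / of_nat N) \<longlonglongrightarrow> 0" by simp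
  moreover have "\<forall>\<^sub>F N in sequentially. ((\<Sum>n<N. cis (s * ln (real (Suc n)))) - G N) / of_nat N
      = (\<Sum>n<N. cis (s * ln (real (Suc n)))) / of_nat N - cis (s * ln (real N)) / (1 + \<i> * of_real s)"
    by (intro eventually_sequentiallyI[of 1]) (simp add: G_def diff_divide_distrib)
  ultimately show ?thesis by (rule Lim_transform_eventually)
qed

text \<open>
  Since \<open>ln (a n + c) = ln a + ln n + o(1)\<close>, the twist is \<open>a\<^sup>i\<^sup>t b\<^sup>i\<^sup>u n\<^sup>i\<^sup>(\<^sup>t\<^sup>+\<^sup>u\<^sup>)\<close> up to a null
  sequence.
\<close>

lemma mean_twist:
  assumes "a \<ge> 1" "b \<ge> 1"
  shows "(\<lambda>N. (\<Sum>n<N. twist t u a c b d n) / of_nat N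
            - cis (t * ln (of_int a) + u * ln (of_int b)) * cis ((t + u) * ln (real N))
              / (1 + \<i> * of_real (t + u))) \<longlonglongrightarrow> 0"
proof -
  define C where "C = cis (t * ln (of_int a) + u * ln (of_int b))"
  have ab: "real_of_int a > 0" "real_of_int b > 0" using assms by auto
  have *: "(\<lambda>n. ln (\<alpha> * real n + \<beta>) - ln \<alpha> - ln (real (Suc n))) \<longlonglongrightarrow> 0" if "\<alpha> > 0" for \<alpha> \<beta> :: real
    using that by real_asymp
  have "(\<lambda>n. t * (ln (of_int a * real n + of_int c) - ln (of_int a) - ln (real (Suc n)))
      + u * (ln (of_int b * real n + of_int d) - ln (of_int b) - ln (real (Suc n)))) \<longlonglongrightarrow> t * 0 + u * 0"
    using ab by (intro tendsto_intros *)
  then have "(\<lambda>n. twist_phase t u a c b d n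
      - (t * ln (of_int a) + u * ln (of_int b) + (t + u) * ln (real (Suc n)))) \<longlonglongrightarrow> 0"
    by (simp add: twist_phase_def algebra_simps)
  then have "(\<lambda>n. cis (twist_phase t u a c b d n)
      - cis (t * ln (of_int a) + u * ln (of_int b) + (t + u) * ln (real (Suc n)))) \<longlonglongrightarrow> 0"
    by (rule tendsto_cis_diff)
  then have "(\<lambda>n. cis (twist_phase t u a c b d n) - C * cis ((t + u) * ln (real (Suc n)))) \<longlonglongrightarrow> 0"
    by (simp add: C_def cis_mult add.assoc)
  moreover have "\<forall>\<^sub>F n in sequentially. cis (twist_phase t u a c b d n) - C * cis ((t + u) * ln (real (Suc n)))
      = twist t u a c b d n - C * cis ((t + u) * ln (real (Suc n)))"
    using twist_eq_cis[OF assms, of t u c d] by eventually_elim simp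
  ultimately have "(\<lambda>n. twist t u a c b d n - C * cis ((t + u) * ln (real (Suc n)))) \<longlonglongrightarrow> 0"
    by (rule Lim_transform_eventually)
  from cesaro_null[OF this]
  have "(\<lambda>N. (\<Sum>n<N. twist t u a c b d n) / of_nat N
      - C * ((\<Sum>n<N. cis ((t + u) * ln (real (Suc n)))) / of_nat N)) \<longlonglongrightarrow> 0"
    by (simp add: sum_subtractf diff_divide_distrib sum_distrib_left)
  from tendsto_add[OF this tendsto_mult_right_zero[OF mean_n_it[of "t + u"], of C]]
  show ?thesis unfolding C_def[symmetric] by (simp add: algebra_simps)
qed

section \<open>From integer to real cut-off\<close>

lemma filterlim_nat_floor: "filterlim (\<lambda>x :: real. nat \<lfloor>x\<rfloor>) sequentially at_top"
  by (intro filterlim_compose[OF filterlim_nat_sequentially filterlim_floor_sequentially])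

lemma tendsto_nat_floor_div: "((\<lambda>x :: real. real (nat \<lfloor>x\<rfloor>) / x) \<longlongrightarrow> 1) at_top"
proof (rule Lim_transform_eventually)
  show "((\<lambda>x :: real. real_of_int \<lfloor>x\<rfloor> / x) \<longlongrightarrow> 1) at_top" by real_asymp
  show "\<forall>\<^sub>F x :: real in at_top. real_of_int \<lfloor>x\<rfloor> / x = real (nat \<lfloor>x\<rfloor>) / x"
    using eventually_ge_at_top[of 0] by eventually_elim simp
qed

text \<open>
  Substituting \<open>n + 1\<close> for \<open>n\<close> moves the range \<open>1 \<le> n \<le> x\<close> to \<open>n < \<lfloor>x\<rfloor>\<close> and the forms to
  \<open>a n + (a + c)\<close> and \<open>b n + (b + d)\<close>. This preserves \<open>gcd (a, c)\<close>, \<open>gcd (b, d)\<close> and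
  \<open>ad - bc\<close>.
\<close>

lemma corr_along_eq:
  fixes a b c d :: int
  assumes "x > 0"
  shows "corr_along h (\<lambda>n. a * int n + c) h' (\<lambda>n. b * int n + d) x
       = of_real (real (nat \<lfloor>x\<rfloor>) / x) * ((\<Sum>n<nat \<lfloor>x\<rfloor>.
           if a * int n + (a + c) > 0 \<and> b * int n + (b + d) > 0
           then h (nat (a * int n + (a + c))) * h' (nat (b * int n + (b + d))) else 0) / of_nat (nat \<lfloor>x\<rfloor>))"
proof -
  define N where "N = nat \<lfloor>x\<rfloor>"
  define F where "F n = (if a * int n + c > 0 \<and> b * int n + d > 0
           then h (nat (a * int n + c)) * h' (nat (b * int n + d)) else 0)" for n
  have set: "{n. 1 \<le> n \<and> real n \<le> x \<and> a * int n + c > 0 \<and> b * int n + d > 0}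
      = {n\<in>{1..N}. a * int n + c > 0 \<and> b * int n + d > 0}"
    using assms by (auto simp: N_def le_nat_iff le_floor_iff)
  have "(\<Sum>n | 1 \<le> n \<and> real n \<le> x \<and> a * int n + c > 0 \<and> b * int n + d > 0.
           h (nat (a * int n + c)) * h' (nat (b * int n + d))) = (\<Sum>n\<in>{1..N}. F n)"
    unfolding set F_def by (intro sum.mono_neutral_cong_left) auto
  also have "{1..N} = Suc ` {..<N}" by (auto simp: image_Suc_lessThan)
  also have "sum F \<dots> = (\<Sum>n<N. F (Suc n))" by (simp add: sum.reindex)
  finally have eq: "corr_along h (\<lambda>n. a * int n + c) h' (\<lambda>n. b * int n + d) x
      = 1 / of_real x * (\<Sum>n<N. F (Suc n))" by (simp add: corr_along_def)
  have shift: "a * int (Suc n) + c = a * int n + (a + c)" for a c :: int and n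
    by (simp add: algebra_simps)
  show ?thesis
  proof (cases "N = 0")
    case True
    then show ?thesis unfolding eq by (simp add: N_def)
  next
    case False
    then show ?thesis unfolding eq F_def shift N_def[symmetric] by simp
  qed
qed

section \<open>Local factors\<close>

text \<open>For multiplicative \<open>h = 1 * \<theta>\<close> this is \<open>\<theta>(p\<^sup>i)\<close>; see \<open>increment_eq_conv\<close>.\<close>

definition increment :: "(nat \<Rightarrow> complex) \<Rightarrow> nat \<Rightarrow> nat \<Rightarrow> complex" where
  "increment h p i = (if i = 0 then 1 else h (p ^ i) - h (p ^ (i - 1)))"

lemma sum_increment:
  assumes "h 1 = 1"
  shows "(\<Sum>i\<le>j. increment h p i) = h (p ^ j)"
  using assms by (induction j) (simp_all add: increment_def)

lemma norm_sum_increment_le: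
  assumes "h 1 = 1" "\<And>n. n > 0 \<Longrightarrow> norm (h n) \<le> 1" "prime p"
  shows "norm (\<Sum>i\<le>j. increment h p i) \<le> 1"
  using assms by (simp add: sum_increment prime_gt_0_nat)

lemma one_conv_prime_power:
  fixes \<theta> :: "nat \<Rightarrow> complex"
  assumes "prime p"
  shows "dirichlet_conv (\<lambda>_. 1) \<theta> (p ^ j) = (\<Sum>i\<le>j. \<theta> (p ^ i))"
proof -
  have p: "p > 1" using assms prime_gt_1_nat by blast
  have "{d. d dvd p ^ j} = (\<lambda>i. p ^ (j - i)) ` {..j}"
  proof (intro set_eqI iffI)
    fix d assume "d \<in> {d. d dvd p ^ j}"
    then obtain i where "i \<le> j" "d = p ^ i" using divides_primepow_nat[OF assms] by auto
    then show "d \<in> (\<lambda>i. p ^ (j - i)) ` {..j}" by (intro image_eqI[of _ _ "j - i"]) auto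
  qed (auto intro: le_imp_power_dvd)
  moreover have "inj_on (\<lambda>i. p ^ (j - i)) {..j}"
    using p by (auto simp: inj_on_def)
  ultimately have "dirichlet_conv (\<lambda>_. 1) \<theta> (p ^ j) = (\<Sum>i\<le>j. \<theta> (p ^ j div p ^ (j - i)))"
    by (simp add: dirichlet_conv_def sum.reindex)
  also have "\<dots> = (\<Sum>i\<le>j. \<theta> (p ^ i))"
  proof (intro sum.cong refl)
    fix i assume "i \<in> {..j}"
    then have "p ^ j div p ^ (j - i) = p ^ (j - (j - i))" using p by (intro power_diff[symmetric]) auto
    then show "\<theta> (p ^ j div p ^ (j - i)) = \<theta> (p ^ i)" using \<open>i \<in> {..j}\<close> by simp
  qed
  finally show ?thesis .
qed

lemma increment_eq_conv:
  assumes "prime p" "h 1 = 1" "\<forall>n>0. h n = dirichlet_conv (\<lambda>_. 1) \<theta> n"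
  shows "increment h p = (\<lambda>i. \<theta> (p ^ i))"
proof
  fix i
  have hs: "h (p ^ j) = (\<Sum>i\<le>j. \<theta> (p ^ i))" for j
    using assms by (simp add: one_conv_prime_power prime_gt_0_nat)
  show "increment h p i = \<theta> (p ^ i)"
  proof (cases i)
    case 0
    then show ?thesis using hs[of 0] assms(2) by (simp add: increment_def)
  next
    case (Suc k)
    then show ?thesis using hs[of "Suc k"] hs[of k] by (simp add: increment_def del: power_Suc)
  qed
qed

text \<open>
  The instance of \<open>smooth_part_mean\<close> for a single prime, with the indicator of positivity,
  which is eventually 1, as weight.
\<close>

lemma corr_local_part_tendsto:
  fixes a b c d :: int
  assumes h: "h 1 = 1" "\<And>n. n > 0 \<Longrightarrow> norm (h n) \<le> 1"
    and h': "h' 1 = 1" "\<And>n. n > 0 \<Longrightarrow> norm (h' n) \<le> 1"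
    and p: "prime p" and ac: "gcd a c = 1" and bd: "gcd b d = 1"
    and pos: "\<forall>\<^sub>F n in sequentially. a * int n + (a + c) > 0"
      "\<forall>\<^sub>F n in sequentially. b * int n + (b + d) > 0"
    and L: "cut_mean p (increment h p) (increment h' p) a (a + c) b (b + d) \<longlonglongrightarrow> L"
  shows "(corr_along (local_part p h) (\<lambda>n. a * int n + c) (local_part p h') (\<lambda>n. b * int n + d) \<longlongrightarrow> L) at_top"
proof -
  define V where "V n = (of_bool (a * int n + (a + c) > 0 \<and> b * int n + (b + d) > 0) :: complex)" for n
  define S where "S n = local_part p h (nat (a * int n + (a + c))) * local_part p h' (nat (b * int n + (b + d)))" for n
  have V1: "\<forall>\<^sub>F n in sequentially. V n = 1"
    using pos by eventually_elim (simp add: V_def)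
  then have V2: "\<forall>\<^sub>F n in sequentially. V (Suc n) = 1"
    by (rule eventually_compose_filterlim[OF _ filterlim_Suc])
  have slow: "(\<lambda>n. V (Suc n) - V n) \<longlonglongrightarrow> 0"
    using V1 V2 by (intro tendsto_eventually) (auto elim: eventually_elim2)
  have "(\<lambda>n. V n - 1) \<longlonglongrightarrow> 0"
    using V1 by (intro tendsto_eventually) (auto elim: eventually_mono)
  then have "(\<lambda>N. (\<Sum>n<N. V n - 1) / of_nat N + 1) \<longlonglongrightarrow> 0 + 1"
    by (intro tendsto_add cesaro_null tendsto_const)
  moreover have "\<forall>\<^sub>F N in sequentially. (\<Sum>n<N. V n - 1) / of_nat N + 1 = (\<Sum>n<N. V n) / of_nat N"
    by (intro eventually_sequentiallyI[of 1]) (simp add: sum_subtractf diff_divide_distrib)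
  ultimately have meanV: "(\<lambda>N. (\<Sum>n<N. V n) / of_nat N) \<longlonglongrightarrow> 1"
    by (simp add: tendsto_cong)
  have "(\<lambda>N. (\<Sum>n<N. V n * (\<Prod>p\<in>{p}. (\<Sum>i\<le>multiplicity p (nat (a * int n + (a + c))). increment h p i)
          * (\<Sum>i\<le>multiplicity p (nat (b * int n + (b + d))). increment h' p i))) / of_nat N
      - (\<Sum>n<N. V n) / of_nat N * (\<Prod>p\<in>{p}. L)) \<longlonglongrightarrow> 0"
  proof (rule smooth_part_mean)
    show "norm (V n) \<le> 1" for n by (simp add: V_def)
    show "0 < a * int n + (a + c) \<and> 0 < b * int n + (b + d)" if "V n \<noteq> 0" for n
      using that by (simp add: V_def)
  qed (use slow L p ac bd norm_sum_increment_le[of h, OF h] norm_sum_increment_le[of h', OF h'] in auto)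
  then have "(\<lambda>N. (\<Sum>n<N. V n * S n) / of_nat N - (\<Sum>n<N. V n) / of_nat N * L) \<longlonglongrightarrow> 0"
    by (simp add: S_def local_part_def sum_increment[of h, OF h(1)] sum_increment[of h', OF h'(1)])
  from tendsto_add[OF this tendsto_mult_right[OF meanV, of L]]
  have "(\<lambda>N. (\<Sum>n<N. V n * S n) / of_nat N) \<longlonglongrightarrow> L" by (simp add: mult.commute)
  from filterlim_compose[OF this filterlim_nat_floor]
  have lim: "((\<lambda>x :: real. (\<Sum>n<nat \<lfloor>x\<rfloor>. V n * S n) / of_nat (nat \<lfloor>x\<rfloor>)) \<longlongrightarrow> L) at_top" .
  have "((\<lambda>x. complex_of_real (real (nat \<lfloor>x\<rfloor>) / x) * ((\<Sum>n<nat \<lfloor>x\<rfloor>. V n * S n) / of_nat (nat \<lfloor>x\<rfloor>)))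
      \<longlongrightarrow> of_real 1 * L) at_top"
    by (intro tendsto_mult lim tendsto_of_real tendsto_nat_floor_div)
  moreover have "\<forall>\<^sub>F x in at_top. complex_of_real (real (nat \<lfloor>x\<rfloor>) / x) * ((\<Sum>n<nat \<lfloor>x\<rfloor>. V n * S n) / of_nat (nat \<lfloor>x\<rfloor>))
      = corr_along (local_part p h) (\<lambda>n. a * int n + c) (local_part p h') (\<lambda>n. b * int n + d) x"
    using eventually_gt_at_top[of 0]
  proof eventually_elim
    case (elim x)
    show ?case unfolding corr_along_eq[OF elim]
      by (intro arg_cong2[of _ _ _ _ "(*)"] arg_cong2[of _ _ _ _ "(/)"] sum.cong refl) (simp add: V_def S_def)
  qed
  ultimately show ?thesis by (simp add: tendsto_cong)
qed

lemma obtain_exact_power: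
  fixes D :: int
  assumes "prime p" "D \<noteq> 0"
  obtains k where "int p ^ k dvd D" "\<not> int p ^ Suc k dvd D"
proof (rule that[of "multiplicity (int p) D"])
  show "int p ^ multiplicity (int p) D dvd D" by (rule multiplicity_dvd)
  show "\<not> int p ^ Suc (multiplicity (int p) D) dvd D"
  proof
    assume "int p ^ Suc (multiplicity (int p) D) dvd D"
    then have "Suc (multiplicity (int p) D) \<le> multiplicity (int p) D"
      using assms by (intro multiplicity_geI) auto
    then show False by simp
  qed
qed

text \<open>
  The subtracted term makes the induction go through: passing from \<open>K\<close> to \<open>K + 1\<close> adds \<open>x\<^sup>K\<^sup>+\<^sup>1\<close>
  on the left and at least as much on the right, as \<open>2 x \<le> 1\<close>.
\<close>

lemma sum_powers_tail_le:
  fixes x :: real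
  assumes "0 \<le> x" "x \<le> 1 / 2" "K \<ge> 1"
  shows "(\<Sum>j\<in>{1<..K}. x ^ j) \<le> 2 * x\<^sup>2 - 2 * x ^ Suc K"
  using assms(3)
proof (induction K rule: dec_induct)
  case (step K)
  have "{1<..Suc K} = insert (Suc K) {1<..K}" using step by auto
  then have "(\<Sum>j\<in>{1<..Suc K}. x ^ j) = x ^ Suc K + (\<Sum>j\<in>{1<..K}. x ^ j)" by simp
  also have "\<dots> \<le> 2 * x\<^sup>2 - x ^ Suc K" using step.IH by simp
  also have "x ^ Suc (Suc K) \<le> x ^ Suc K * (1 / 2)"
    using assms mult_left_mono[OF assms(2), of "x ^ Suc K"] by (simp add: mult.commute)
  then have "2 * x\<^sup>2 - x ^ Suc K \<le> 2 * x\<^sup>2 - 2 * x ^ Suc (Suc K)" by simp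
  finally show ?case .
qed (simp add: power2_eq_square)

text \<open>The increments are bounded by 2, and \<open>\<Sum>\<^sub>j\<^sub>\<ge>\<^sub>2 2 p\<^sup>-\<^sup>j \<le> 4 p\<^sup>-\<^sup>2\<close>.\<close>

lemma norm_infsum_minus_first_le:
  fixes \<theta> :: "nat \<Rightarrow> complex"
  assumes "p \<ge> 2" "\<And>j. norm (\<Sum>i\<le>j. \<theta> i) \<le> 1"
  shows "norm ((\<Sum>\<^sub>\<infinity>j\<in>{0<..}. \<theta> j / of_nat p ^ j) - \<theta> 1 / of_nat p) \<le> 4 / (real p)\<^sup>2"
proof -
  define f where "f j = \<theta> j / of_nat p ^ j" for j
  have t: "norm (\<theta> j) \<le> 2" for j by (rule norm_increment_le[OF assms(2)])
  have "(\<lambda>K. \<Sum>j\<in>{0<..K}. f j) \<longlonglongrightarrow> (\<Sum>\<^sub>\<infinity>j\<in>{0<..}. f j)"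
    unfolding f_def by (intro tendsto_infsum_greaterThan summable_on_bounded_div_power[OF assms(1) t])
  then have lim: "(\<lambda>K. (\<Sum>j\<in>{0<..K}. f j) - f 1) \<longlonglongrightarrow> (\<Sum>\<^sub>\<infinity>j\<in>{0<..}. f j) - f 1"
    by (intro tendsto_intros)
  have "\<forall>\<^sub>F K in sequentially. norm ((\<Sum>j\<in>{0<..K}. f j) - f 1) \<le> 4 / (real p)\<^sup>2"
  proof (rule eventually_sequentiallyI[of 1])
    fix K :: nat assume K: "K \<ge> 1"
    have "{0<..K} = insert 1 {1<..K}" using K by auto
    then have "norm ((\<Sum>j\<in>{0<..K}. f j) - f 1) = norm (\<Sum>j\<in>{1<..K}. f j)" by simp
    also have "\<dots> \<le> (\<Sum>j\<in>{1<..K}. 2 * (1 / real p) ^ j)"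
    proof (intro sum_norm_le)
      fix j
      have "norm (\<theta> j) / real p ^ j \<le> 2 / real p ^ j" using t by (intro divide_right_mono) auto
      then show "norm (f j) \<le> 2 * (1 / real p) ^ j"
        by (simp add: f_def norm_divide norm_power power_one_over)
    qed
    also have "\<dots> = 2 * (\<Sum>j\<in>{1<..K}. (1 / real p) ^ j)" by (simp only: sum_distrib_left)
    also have "\<dots> \<le> 2 * (2 * (1 / real p)\<^sup>2 - 2 * (1 / real p) ^ Suc K)"
      using assms(1) K by (intro mult_left_mono sum_powers_tail_le) auto
    also have "\<dots> \<le> 2 * (2 * (1 / real p)\<^sup>2)" by simp
    finally show "norm ((\<Sum>j\<in>{0<..K}. f j) - f 1) \<le> 4 / (real p)\<^sup>2" by (simp add: power_one_over)
  qed
  from Lim_norm_ubound[OF _ lim this] show ?thesis by (simp add: f_def)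
qed

lemma euler_factor_coprime:
  assumes "\<not> int p dvd a" "\<not> int p dvd b" "\<theta> 0 = 1" "\<gamma> 0 = 1"
  shows "euler_factor p 0 \<theta> \<gamma> a b
       = 1 + (\<Sum>\<^sub>\<infinity>j\<in>{0<..}. \<theta> j / of_nat p ^ j) + (\<Sum>\<^sub>\<infinity>j\<in>{0<..}. \<gamma> j / of_nat p ^ j)"
  using assms by (simp add: euler_factor_def)

text \<open>
  Up to \<open>O(p\<^sup>-\<^sup>2)\<close>, both sides equal \<open>1 + (\<theta>(1) + \<gamma>(1))/p\<close>. The estimate is summable over \<open>p\<close>,
  which is what allows the product of local factors to be exchanged for an exponential.
\<close>

lemma euler_factor_near_exp:
  assumes p: "p \<ge> 2" "\<not> int p dvd a" "\<not> int p dvd b" and "\<theta> 0 = 1" "\<gamma> 0 = 1"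
    and \<theta>: "\<And>j. norm (\<Sum>i\<le>j. \<theta> i) \<le> 1" and \<gamma>: "\<And>j. norm (\<Sum>i\<le>j. \<gamma> i) \<le> 1"
  shows "norm (euler_factor p 0 \<theta> \<gamma> a b - exp ((\<theta> 1 + \<gamma> 1) / of_nat p)) \<le> 24 / (real p)\<^sup>2"
proof -
  define w where "w = (\<theta> 1 + \<gamma> 1) / of_nat p"
  define r where "r = ((\<Sum>\<^sub>\<infinity>j\<in>{0<..}. \<theta> j / of_nat p ^ j) - \<theta> 1 / of_nat p)
      + ((\<Sum>\<^sub>\<infinity>j\<in>{0<..}. \<gamma> j / of_nat p ^ j) - \<gamma> 1 / of_nat p)"
  have Re: "Re (\<eta> 1) \<le> 0" if "\<eta> 0 = 1" "\<And>j. norm (\<Sum>i\<le>j. \<eta> i) \<le> 1" for \<eta> :: "nat \<Rightarrow> complex"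
    using Re_minus_1_le[OF that(2)[of 1]] that(1) by simp
  have "Re w \<le> 0"
    using Re[of \<theta>] Re[of \<gamma>] assms
    by (auto simp: w_def Re_divide_of_nat intro!: divide_nonpos_nonneg add_nonpos_nonpos)
  then have "norm (exp w - (1 + w)) \<le> (norm w)\<^sup>2" by (rule norm_exp_minus_linear_le)
  also have "\<dots> \<le> (4 / real p)\<^sup>2"
  proof (intro power_mono)
    have "norm (\<theta> 1 + \<gamma> 1) \<le> 2 + 2"
      by (intro order_trans[OF norm_triangle_ineq] add_mono norm_increment_le \<theta> \<gamma>)
    then show "norm w \<le> 4 / real p" by (simp add: w_def norm_divide divide_right_mono)
  qed auto
  finally have 1: "norm (exp w - (1 + w)) \<le> 16 / (real p)\<^sup>2" by (simp add: power_divide)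
  have "norm r \<le> 4 / (real p)\<^sup>2 + 4 / (real p)\<^sup>2"
    unfolding r_def
    by (intro order_trans[OF norm_triangle_ineq] add_mono norm_infsum_minus_first_le p \<theta> \<gamma>)
  then have 2: "norm r \<le> 8 / (real p)\<^sup>2" by simp
  have "euler_factor p 0 \<theta> \<gamma> a b - exp w = r - (exp w - (1 + w))"
    using euler_factor_coprime[of p a b \<theta> \<gamma>] assms by (simp add: r_def w_def add_divide_distrib)
  also have "norm \<dots> \<le> 8 / (real p)\<^sup>2 + 16 / (real p)\<^sup>2"
    using 1 2 norm_triangle_ineq4[of r "exp w - (1 + w)"] by linarith
  finally show ?thesis by (simp add: w_def)
qed

text \<open>
  Telescoping: the partial sums satisfy the corresponding identity up to \<open>h(p\<^sup>K)/p\<^sup>K\<^sup>+\<^sup>1\<close>, which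
  tends to 0.
\<close>

lemma infsum_increment:
  assumes "prime p" "h 1 = 1" "\<And>n. n > 0 \<Longrightarrow> norm (h n) \<le> 1"
  shows "(\<Sum>\<^sub>\<infinity>j\<in>{0<..}. increment h p j / of_nat p ^ j)
       = (1 - 1 / of_nat p) * (\<Sum>\<^sub>\<infinity>j\<in>{1..}. h (p ^ j) / of_nat p ^ j) - 1 / of_nat p"
proof -
  have p2: "p \<ge> 2" using assms(1) prime_ge_2_nat by blast
  have hp: "norm (h (p ^ j)) \<le> 1" for j using assms by (simp add: prime_gt_0_nat)
  define H where "H = (\<Sum>\<^sub>\<infinity>j\<in>{0<..}. h (p ^ j) / of_nat p ^ j)"
  have limH: "(\<lambda>K. \<Sum>j\<in>{0<..K}. h (p ^ j) / of_nat p ^ j) \<longlonglongrightarrow> H"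
    unfolding H_def by (intro tendsto_infsum_greaterThan summable_on_bounded_div_power[OF p2 hp])
  have part: "(\<Sum>j\<in>{0<..K}. increment h p j / of_nat p ^ j)
      = (1 - 1 / of_nat p) * (\<Sum>j\<in>{0<..K}. h (p ^ j) / of_nat p ^ j) - 1 / of_nat p
        + 1 / of_nat p * (h (p ^ K) / of_nat p ^ K)" for K
  proof (induction K)
    case 0
    show ?case using assms(2) by simp
  next
    case (Suc K)
    have *: "{0<..Suc K} = insert (Suc K) {0<..K}" by auto
    have "(\<Sum>j\<in>{0<..Suc K}. increment h p j / of_nat p ^ j)
        = (h (p ^ Suc K) - h (p ^ K)) / of_nat p ^ Suc K + (\<Sum>j\<in>{0<..K}. increment h p j / of_nat p ^ j)"
      unfolding * by (simp add: increment_def)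
    moreover have "(\<Sum>j\<in>{0<..Suc K}. h (p ^ j) / of_nat p ^ j)
        = h (p ^ Suc K) / of_nat p ^ Suc K + (\<Sum>j\<in>{0<..K}. h (p ^ j) / of_nat p ^ j)"
      unfolding * by simp
    ultimately show ?case unfolding Suc.IH
      by (simp add: algebra_simps diff_divide_distrib)
  qed
  have "(\<lambda>K. h (p ^ K) / of_nat p ^ K) \<longlonglongrightarrow> 0"
  proof (rule Lim_null_comparison)
    show "\<forall>\<^sub>F K in sequentially. norm (h (p ^ K) / of_nat p ^ K) \<le> (1 / real p) ^ K"
      using hp by (intro always_eventually allI)
        (simp add: norm_divide norm_power power_one_over divide_right_mono)
    show "(\<lambda>K. (1 / real p) ^ K) \<longlonglongrightarrow> 0" using p2 by (intro LIMSEQ_power_zero) auto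
  qed
  with limH have "(\<lambda>K. (1 - 1 / of_nat p) * (\<Sum>j\<in>{0<..K}. h (p ^ j) / of_nat p ^ j) - 1 / of_nat p
        + 1 / of_nat p * (h (p ^ K) / of_nat p ^ K)) \<longlonglongrightarrow> (1 - 1 / of_nat p) * H - 1 / of_nat p + 1 / of_nat p * 0"
    by (intro tendsto_intros)
  then have "(\<lambda>K. \<Sum>j\<in>{0<..K}. increment h p j / of_nat p ^ j) \<longlonglongrightarrow> (1 - 1 / of_nat p) * H - 1 / of_nat p"
    unfolding part by simp
  moreover have "(\<lambda>K. \<Sum>j\<in>{0<..K}. increment h p j / of_nat p ^ j)
      \<longlonglongrightarrow> (\<Sum>\<^sub>\<infinity>j\<in>{0<..}. increment h p j / of_nat p ^ j)"
    using norm_increment_le[OF norm_sum_increment_le[of h p, OF assms(2,3,1)]]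
    by (intro tendsto_infsum_greaterThan summable_on_bounded_div_power[OF p2])
  ultimately have "(\<Sum>\<^sub>\<infinity>j\<in>{0<..}. increment h p j / of_nat p ^ j) = (1 - 1 / of_nat p) * H - 1 / of_nat p"
    by (intro LIMSEQ_unique)
  also have "{0<..} = {1 :: nat..}" by auto
  then have "H = (\<Sum>\<^sub>\<infinity>j\<in>{1..}. h (p ^ j) / of_nat p ^ j)" by (simp add: H_def)
  finally show ?thesis .
qed

text \<open>
  The mean along one form is a correlation with the constant form 1, that is, with \<open>b = 0\<close> and
  \<open>d = 1\<close>. Then \<open>gcd (b, d) = 1\<close> and \<open>ad - bc = a \<noteq> 0\<close>, so the results on pairs of forms
  apply.
\<close>

lemma mean_along_eq_corr_along:
  "mean_along (local_part p h) P = corr_along (local_part p h) P (local_part p (\<lambda>_. 1)) (\<lambda>n. 0 * int n + 1)"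
  by (simp add: mean_along_def corr_along_def local_part_def fun_eq_iff)

lemma local_corr_eqI:
  "(corr_along (local_part p h) P (local_part p h') Q \<longlongrightarrow> L) at_top \<Longrightarrow> local_corr p h P h' Q = L"
  unfolding local_corr_def by (intro tendsto_Lim) auto

lemma cut_mean_limit_exists:
  assumes "h 1 = 1" "\<And>n. n > 0 \<Longrightarrow> norm (h n) \<le> 1" "h' 1 = 1" "\<And>n. n > 0 \<Longrightarrow> norm (h' n) \<le> 1"
    and "prime p" "gcd a c = 1" "gcd b d = 1" "a * d - b * c \<noteq> 0"
  shows "\<exists>L. cut_mean p (increment h p) (increment h' p) a c b d \<longlonglongrightarrow> L"
proof (cases "int p dvd a \<and> int p dvd b")
  case True
  then have "cut_mean p (increment h p) (increment h' p) a c b d K = 1" for K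
    using assms by (intro cut_mean_common) (auto simp: increment_def)
  then have "cut_mean p (increment h p) (increment h' p) a c b d = (\<lambda>_. 1)" by auto
  then show ?thesis by auto
next
  case False
  obtain k where k: "int p ^ k dvd a * d - b * c" "\<not> int p ^ Suc k dvd a * d - b * c"
    using obtain_exact_power[OF assms(5,8)] .
  show ?thesis
    using cut_mean_tendsto[OF assms(6,7,5) _ k, of "increment h p" "increment h' p"] False
      norm_sum_increment_le[of h p] norm_sum_increment_le[of h' p] assms by auto
qed

lemma shifted_determinant: "a * (b + d) - b * (a + c) = a * d - b * (c :: int)"
  by (simp add: algebra_simps)

lemma local_mean_tendsto:
  fixes a c :: int
  assumes h: "h 1 = 1" "\<And>n. n > 0 \<Longrightarrow> norm (h n) \<le> 1" and p: "prime p"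
    and a: "a \<ge> 1" and ac: "gcd a c = 1"
  shows "(mean_along (local_part p h) (\<lambda>n. a * int n + c) \<longlongrightarrow> local_mean p h (\<lambda>n. a * int n + c)) at_top"
    and "\<not> int p dvd a \<Longrightarrow> local_mean p h (\<lambda>n. a * int n + c)
           = 1 + (\<Sum>\<^sub>\<infinity>j\<in>{0<..}. increment h p j / of_nat p ^ j)"
proof -
  define one where "one = (\<lambda>_ :: nat. 1 :: complex)"
  have one: "one 1 = 1" "\<And>n. n > 0 \<Longrightarrow> norm (one n) \<le> 1" by (auto simp: one_def)
  have ac': "gcd a (a + c) = 1" using ac by (simp add: gcd_add2)
  have lim: "(mean_along (local_part p h) (\<lambda>n. a * int n + c) \<longlongrightarrow> L) at_top"
    if "cut_mean p (increment h p) (increment one p) a (a + c) 0 (0 + 1) \<longlonglongrightarrow> L" for L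
    unfolding mean_along_eq_corr_along one_def[symmetric]
    using eventually_linear_form_pos[OF a, of "a + c"] h one p ac that by (intro corr_local_part_tendsto) auto
  have unique: "local_mean p h (\<lambda>n. a * int n + c) = L"
    if "(mean_along (local_part p h) (\<lambda>n. a * int n + c) \<longlongrightarrow> L) at_top" for L
    unfolding local_mean_def using that by (intro tendsto_Lim) auto
  have "\<exists>L. cut_mean p (increment h p) (increment one p) a (a + c) 0 (0 + 1) \<longlonglongrightarrow> L"
    using h one p ac' a by (intro cut_mean_limit_exists) auto
  then show "(mean_along (local_part p h) (\<lambda>n. a * int n + c) \<longlongrightarrow> local_mean p h (\<lambda>n. a * int n + c)) at_top"
    using lim unique by metis
  assume pa: "\<not> int p dvd a"
  have "cut_mean p (increment h p) (increment one p) a (a + c) 0 (0 + 1)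
      \<longlonglongrightarrow> euler_factor p 0 (increment h p) (increment one p) a 0"
    using pa h one p ac' norm_sum_increment_le[of h p] norm_sum_increment_le[of one p]
    by (intro cut_mean_tendsto) auto
  then have "local_mean p h (\<lambda>n. a * int n + c) = euler_factor p 0 (increment h p) (increment one p) a 0"
    by (intro unique lim)
  then show "local_mean p h (\<lambda>n. a * int n + c) = 1 + (\<Sum>\<^sub>\<infinity>j\<in>{0<..}. increment h p j / of_nat p ^ j)"
    using pa by (simp add: euler_factor_def increment_def)
qed

section \<open>Assembling the correlation\<close>

text \<open>
  Finite distance is the summability of \<open>(1 - Re f\<^sub>0(p))/p\<close>, and \<open>|z - 1|\<^sup>2 \<le> 2 (1 - Re z)\<close> for
  \<open>|z| \<le> 1\<close>. The square is the form in which Cauchy--Schwarz and the variance estimate use it.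
\<close>

lemma untwisted_properties:
  fixes f f0 :: "nat \<Rightarrow> complex"
  assumes f: "multiplicative_fun f" "\<forall>n>0. norm (f n) \<le> 1" and dist: "pret_dist f (n_it t) < \<infinity>"
    and f0: "f0 = (\<lambda>n. f n / n_it t n)"
  shows "multiplicative_fun f0" "\<And>n. n > 0 \<Longrightarrow> norm (f0 n) \<le> 1"
    "(\<lambda>p. (norm (f0 p - 1))\<^sup>2 / real p) summable_on {p. prime p}"
    "\<And>n. n > 0 \<Longrightarrow> f n = n_it t n * f0 n"
proof -
  have "n_it t (m * n) = n_it t m * n_it t n" if "m > 0" "n > 0" for m n
    using that by (simp add: n_it_eq_cis ln_mult cis_mult algebra_simps)
  then show "multiplicative_fun f0"
    using f(1) by (simp add: multiplicative_fun_def f0 n_it_eq_cis)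
  show le: "norm (f0 n) \<le> 1" if "n > 0" for n
    using f(2)[rule_format, OF that] that by (simp add: f0 norm_divide norm_n_it)
  have cnj: "f n * cnj (n_it t n) = f0 n" if "n > 0" for n
    using norm_n_it[OF that, of t] complex_div_cnj[of "f n" "n_it t n"] by (simp add: f0)
  have "(\<lambda>p. (1 - Re (f p * cnj (n_it t p))) / real p) summable_on {p. prime p}"
    using dist by (auto simp: pret_dist_def split: if_splits)
  from summable_on_cmult_right[OF this, of 2]
  have "(\<lambda>p. 2 * ((1 - Re (f p * cnj (n_it t p))) / real p)) summable_on {p. prime p}" .
  then show "(\<lambda>p. (norm (f0 p - 1))\<^sup>2 / real p) summable_on {p. prime p}"
  proof (rule summable_on_comparison_test)
    fix p :: nat assume p: "p \<in> {p. prime p}"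
    then have p0: "p > 0" by (simp add: prime_gt_0_nat)
    have "(norm (f0 p - 1))\<^sup>2 = (norm (f0 p))\<^sup>2 + 1 - 2 * Re (f0 p)"
      unfolding cmod_power2 by (simp add: power2_eq_square algebra_simps)
    also have "(norm (f0 p))\<^sup>2 \<le> 1" using le[OF p0] by (simp add: power_le_one)
    finally have "(norm (f0 p - 1))\<^sup>2 \<le> 2 * (1 - Re (f0 p))" by simp
    then show "(norm (f0 p - 1))\<^sup>2 / real p \<le> 2 * ((1 - Re (f p * cnj (n_it t p))) / real p)"
      using divide_right_mono[of "(norm (f0 p - 1))\<^sup>2" "2 * (1 - Re (f0 p))" "real p"] by (simp add: cnj[OF p0])
  qed auto
  show "f n = n_it t n * f0 n" if "n > 0" for n
    using norm_n_it[OF that, of t] by (auto simp: f0)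
qed

text \<open>
  Choose \<open>y\<close> beyond all primes dividing \<open>ab(ad - bc)\<close> and so large that both rough parts are
  close to constants and the local factors beyond \<open>y\<close> multiply to the product of these
  constants. For this fixed \<open>y\<close>, the smooth part and the twist are then averaged with \<open>N\<close>
  tending to infinity. Each of the resulting errors is at most \<open>e/6\<close>.
\<close>

lemma correlation_asymptotics:
  fixes a b c d :: int and f g f0 g0 L :: "nat \<Rightarrow> complex" and t u :: real
  assumes f0: "multiplicative_fun f0" "\<And>n. n > 0 \<Longrightarrow> norm (f0 n) \<le> 1"
      "(\<lambda>p. (norm (f0 p - 1))\<^sup>2 / real p) summable_on {p. prime p}"
    and g0: "multiplicative_fun g0" "\<And>n. n > 0 \<Longrightarrow> norm (g0 n) \<le> 1"
      "(\<lambda>p. (norm (g0 p - 1))\<^sup>2 / real p) summable_on {p. prime p}"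
    and f: "\<And>n. n > 0 \<Longrightarrow> f n = n_it t n * f0 n" and g: "\<And>n. n > 0 \<Longrightarrow> g n = n_it u n * g0 n"
    and a: "a \<ge> 1" and b: "b \<ge> 1" and ac: "gcd a c = 1" and bd: "gcd b d = 1" and D: "a * d - b * c \<noteq> 0"
    and L: "\<And>p. prime p \<Longrightarrow> cut_mean p (increment f0 p) (increment g0 p) a c b d \<longlonglongrightarrow> L p"
  shows "(\<lambda>N. (\<Sum>n<N. if a * int n + c > 0 \<and> b * int n + d > 0
                then f (nat (a * int n + c)) * g (nat (b * int n + d)) else 0) / of_nat N
            - (\<Sum>n<N. twist t u a c b d n) / of_nat N * (\<Prod>p | prime p \<and> p \<le> N. L p)) \<longlonglongrightarrow> 0"
    (is "?lhs \<longlonglongrightarrow> 0")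
proof (rule LIMSEQ_I)
  fix e :: real assume e: "e > 0"
  define P where "P n = nat (a * int n + c)" for n
  define Q where "Q n = nat (b * int n + d)" for n
  define F where "F n = (if a * int n + c > 0 \<and> b * int n + d > 0 then f (P n) * g (Q n) else 0)" for n
  define V where "V = twist t u a c b d"
  define muf where "muf y N = (\<Sum>p | prime p \<and> y < p \<and> p \<le> N. (f0 p - 1) / of_nat p)" for y N
  define mug where "mug y N = (\<Sum>p | prime p \<and> y < p \<and> p \<le> N. (g0 p - 1) / of_nat p)" for y N
  have f1: "f0 1 = 1" and g1: "g0 1 = 1" using f0(1) g0(1) by (auto simp: multiplicative_fun_def)
  have incf: "norm (\<Sum>i\<le>j. increment f0 p i) \<le> 1"
    and incg: "norm (\<Sum>i\<le>j. increment g0 p i) \<le> 1" if "prime p" for p j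
    using norm_sum_increment_le[of f0 p j] norm_sum_increment_le[of g0 p j] f1 g1 f0(2) g0(2) that
    by blast+
  have Re0: "Re (\<Sum>p | prime p \<and> y < p \<and> p \<le> N. (h p - 1) / of_nat p) \<le> 0"
    if "\<And>n. n > 0 \<Longrightarrow> norm (h n) \<le> 1" for h :: "nat \<Rightarrow> complex" and y N :: nat
    unfolding Re_sum using Re_minus_1_le[OF that]
    by (intro sum_nonpos) (auto simp: Re_divide_of_nat prime_gt_0_nat intro!: divide_nonpos_nonneg)
  have emf: "norm (exp (muf y N)) \<le> 1" and emg: "norm (exp (mug y N)) \<le> 1" for y N
    using Re0[OF f0(2)] Re0[OF g0(2)] by (simp_all add: muf_def mug_def)
  have L1: "norm (L p) \<le> 1" if "prime p" for p
  proof (rule Lim_norm_ubound[OF _ L[OF that]])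
    have "norm (cut_mean p (increment f0 p) (increment g0 p) a c b d K) \<le> 1" for K
    proof -
      have "norm (\<Sum>n<p ^ K. cut p (increment f0 p) K (a * int n + c) * cut p (increment g0 p) K (b * int n + d))
          \<le> (\<Sum>n<p ^ K. 1)"
        using incf[OF that] incg[OF that]
        by (intro sum_norm_le) (auto simp: norm_mult intro!: mult_le_one norm_cut_le)
      then show ?thesis using that by (simp add: cut_mean_def norm_divide prime_gt_0_nat divide_le_eq flip: of_nat_power)
    qed
    then show "\<forall>\<^sub>F K in sequentially. norm (cut_mean p (increment f0 p) (increment g0 p) a c b d K) \<le> 1"
      by (intro always_eventually allI)
  qed simp

  have e6: "e / 6 > 0" using e by simp
  \<comment> \<open>The local factors beyond \<open>y\<close> cause an error of at most \<open>24/y\<close>, which has to be below \<open>e/6\<close>.\<close>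
  obtain y1 :: nat where y1: "real y1 > 144 / e" using reals_Archimedean2 by blast
  have "\<forall>\<^sub>F y in sequentially. y \<ge> max (max 1 y1) (nat \<bar>a * b * (a * d - b * c)\<bar>)"
    by (rule eventually_ge_at_top)
  moreover have "\<forall>\<^sub>F y in sequentially. \<forall>\<^sub>F N in sequentially.
      (\<Sum>n | n < N \<and> a * int n + c > 0. norm (rough_part y f0 (P n) - exp (muf y N))) \<le> e / 6 * real N"
    unfolding P_def muf_def by (rule rough_part_concentration) (use a ac f0 e6 in auto)
  moreover have "\<forall>\<^sub>F y in sequentially. \<forall>\<^sub>F N in sequentially.
      (\<Sum>n | n < N \<and> b * int n + d > 0. norm (rough_part y g0 (Q n) - exp (mug y N))) \<le> e / 6 * real N"
    unfolding Q_def mug_def by (rule rough_part_concentration) (use b bd g0 e6 in auto)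
  ultimately have "\<forall>\<^sub>F y in sequentially. y \<ge> max (max 1 y1) (nat \<bar>a * b * (a * d - b * c)\<bar>)
      \<and> (\<forall>\<^sub>F N in sequentially.
      (\<Sum>n | n < N \<and> a * int n + c > 0. norm (rough_part y f0 (P n) - exp (muf y N))) \<le> e / 6 * real N)
      \<and> (\<forall>\<^sub>F N in sequentially.
      (\<Sum>n | n < N \<and> b * int n + d > 0. norm (rough_part y g0 (Q n) - exp (mug y N))) \<le> e / 6 * real N)"
    by (intro eventually_conj)
  from eventually_happens'[OF sequentially_bot this]
  obtain y where y: "y \<ge> 1" "y \<ge> y1" "y \<ge> nat \<bar>a * b * (a * d - b * c)\<bar>"
    and cf: "\<forall>\<^sub>F N in sequentially. (\<Sum>n | n < N \<and> a * int n + c > 0.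
            norm (rough_part y f0 (P n) - exp (muf y N))) \<le> e / 6 * real N"
    and cg: "\<forall>\<^sub>F N in sequentially. (\<Sum>n | n < N \<and> b * int n + d > 0.
            norm (rough_part y g0 (Q n) - exp (mug y N))) \<le> e / 6 * real N"
    by auto

  have tail: "norm (exp (muf y N) * exp (mug y N) - (\<Prod>p | prime p \<and> y < p \<and> p \<le> N. L p)) \<le> e / 6" for N
  proof -
    define Y where "Y = {p. prime p \<and> y < p \<and> p \<le> N}"
    have finY: "finite Y" by (simp add: Y_def)
    define E where "E p = exp ((increment f0 p 1 + increment g0 p 1) / of_nat p)" for p
    have inc1: "increment h p 1 = h p - 1" if "h 1 = 1" for h p
      using that by (simp add: increment_def)
    have close: "norm (E p - L p) \<le> 24 * (1 / (real p)\<^sup>2)" if p: "p \<in> Y" for p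
    proof -
      have pr: "prime p" and py: "y < p" using p by (auto simp: Y_def)
      have ndv: "\<not> int p dvd a * b * (a * d - b * c)"
      proof
        assume dvd: "int p dvd a * b * (a * d - b * c)"
        have "a * b * (a * d - b * c) \<noteq> 0" using a b D by simp
        from dvd_imp_le_int[OF this dvd]
        have "p \<le> nat \<bar>a * b * (a * d - b * c)\<bar>" by (simp only: abs_of_nat le_nat_iff abs_ge_zero)
        then show False using py le_trans[OF _ y(3)] by (meson not_less)
      qed
      then have nd: "\<not> int p dvd a" "\<not> int p dvd b" "\<not> int p dvd a * d - b * c" by auto
      have "cut_mean p (increment f0 p) (increment g0 p) a c b d \<longlonglongrightarrow> euler_factor p 0 (increment f0 p) (increment g0 p) a b"
        using nd by (intro cut_mean_tendsto[OF ac bd pr] incf[OF pr] incg[OF pr]) auto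
      then have "L p = euler_factor p 0 (increment f0 p) (increment g0 p) a b"
        using L[OF pr] by (intro LIMSEQ_unique)
      then show ?thesis
        using euler_factor_near_exp[OF prime_ge_2_nat[OF pr] nd(1,2), of "increment f0 p" "increment g0 p",
            OF _ _ incf[OF pr] incg[OF pr]]
        by (simp add: E_def norm_minus_commute increment_def)
    qed
    have RE: "Re ((increment f0 p 1 + increment g0 p 1) / of_nat p) \<le> 0" if "p \<in> Y" for p
      using Re_minus_1_le[OF f0(2), of p] Re_minus_1_le[OF g0(2), of p] that
      unfolding inc1[of f0, OF f1] inc1[of g0, OF g1]
      by (auto simp: Y_def prime_gt_0_nat Re_divide_of_nat intro!: divide_nonpos_nonneg)
    have "exp (muf y N) * exp (mug y N) = exp (\<Sum>p\<in>Y. (increment f0 p 1 + increment g0 p 1) / of_nat p)"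
      unfolding inc1[of f0, OF f1] inc1[of g0, OF g1] add_divide_distrib sum.distrib exp_add muf_def mug_def Y_def ..
    also have "\<dots> = (\<Prod>p\<in>Y. E p)" using finY by (simp add: exp_sum E_def)
    finally have "norm (exp (muf y N) * exp (mug y N) - prod L Y) = norm ((\<Prod>p\<in>Y. E p) - prod L Y)" by simp
    also have "\<dots> \<le> (\<Sum>p\<in>Y. norm (E p - L p))"
      using L1 RE by (intro norm_prod_diff) (auto simp: Y_def E_def)
    also have "\<dots> \<le> (\<Sum>p\<in>Y. 24 * (1 / (real p)\<^sup>2))" by (intro sum_mono close)
    also have "\<dots> = 24 * (\<Sum>p\<in>Y. 1 / (real p)\<^sup>2)" by (simp only: sum_distrib_left)
    also have "\<dots> \<le> 24 * (1 / real y)"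
      using y(1) finY by (intro mult_left_mono sum_inverse_squares_tail_le) (auto simp: Y_def)
    also have "\<dots> \<le> e / 6"
    proof -
      have "144 / e < real y" using y1 y(2) by linarith
      then show ?thesis using e y(1) by (simp add: field_simps)
    qed
    finally show ?thesis by (simp add: Y_def)
  qed

  define X where "X = {p. prime p \<and> p \<le> y}"
  have finX: "finite X" by (simp add: X_def)
  define S where "S n = (\<Prod>p\<in>X. (\<Sum>i\<le>multiplicity p (P n). increment f0 p i)
                      * (\<Sum>i\<le>multiplicity p (Q n). increment g0 p i))" for n
  have Seq: "S n = (\<Prod>p\<in>X. f0 (p ^ multiplicity p (P n))) * (\<Prod>p\<in>X. g0 (p ^ multiplicity p (Q n)))" for n
    by (simp add: S_def sum_increment[of f0, OF f1] sum_increment[of g0, OF g1] prod.distrib)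
  have S1: "norm (S n) \<le> 1" for n
    unfolding S_def prod_norm[symmetric] norm_mult
    by (intro prod_le_1 conjI mult_nonneg_nonneg mult_le_one norm_ge_zero incf incg) (auto simp: X_def)
  have V1: "norm (V n) \<le> 1" for n by (simp add: V_def norm_twist_le)
  have "(\<lambda>N. (\<Sum>n<N. V n * S n) / of_nat N - (\<Sum>n<N. V n) / of_nat N * (\<Prod>p\<in>X. L p)) \<longlonglongrightarrow> 0"
    unfolding S_def P_def Q_def
  proof (rule smooth_part_mean[OF finX _ ac bd])
    show "(\<lambda>n. V (Suc n) - V n) \<longlonglongrightarrow> 0" unfolding V_def by (rule twist_slow[OF a b])
    show "0 < a * int n + c \<and> 0 < b * int n + d" if "V n \<noteq> 0" for n
      using that by (auto simp: V_def twist_def split: if_splits)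
  qed (use incf incg L V1 in \<open>auto simp: X_def\<close>)
  from LIMSEQ_D[OF this e6]
  have sm: "\<forall>\<^sub>F N in sequentially. norm ((\<Sum>n<N. V n * S n) / of_nat N - (\<Sum>n<N. V n) / of_nat N * prod L X) < e / 6"
    by (auto simp: eventually_sequentially)
  have ev: "\<forall>\<^sub>F N in sequentially. norm ((\<Sum>n<N. F n) / of_nat N
      - (\<Sum>n<N. V n) / of_nat N * (\<Prod>p | prime p \<and> p \<le> N. L p)) < e"
    using cf cg sm eventually_ge_at_top[of y]
  proof eventually_elim
    case (elim N)
    have N0: "real N > 0" using elim y(1) by simp
    define Ef where "Ef = exp (muf y N)"
    define Eg where "Eg = exp (mug y N)"
    define LY where "LY = (\<Prod>p | prime p \<and> y < p \<and> p \<le> N. L p)"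
    define G where "G = {n. n < N \<and> a * int n + c > 0 \<and> b * int n + d > 0}"
    have Ef1: "norm Ef \<le> 1" and Eg1: "norm Eg \<le> 1" unfolding Ef_def Eg_def by (rule emf emg)+
    have split: "(\<Prod>p | prime p \<and> p \<le> N. L p) = prod L X * LY"
    proof -
      have "{p. prime p \<and> p \<le> N} = X \<union> {p. prime p \<and> y < p \<and> p \<le> N}"
        using elim(4) by (auto simp: X_def)
      then show ?thesis unfolding LY_def using finX by (simp add: prod.union_disjoint X_def disjoint_iff)
    qed
    have pt: "norm (F n - V n * S n * (Ef * Eg))
        \<le> (if n \<in> G then norm (rough_part y f0 (P n) - Ef) + norm (rough_part y g0 (Q n) - Eg) else 0)"
      if "n < N" for n
    proof (cases "n \<in> G")
      case True
      then have pos: "a * int n + c > 0" "b * int n + d > 0" "P n > 0" "Q n > 0" by (auto simp: G_def P_def Q_def)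
      define A where "A = rough_part y f0 (P n)"
      define B where "B = rough_part y g0 (Q n)"
      have AB: "norm A \<le> 1" unfolding A_def using f0(2) by (rule norm_rough_part_le)
      have "F n = (n_it t (P n) * n_it u (Q n)) * (f0 (P n) * g0 (Q n))"
        using pos by (simp add: F_def f g)
      also have "n_it t (P n) * n_it u (Q n) = V n"
        using pos by (simp add: V_def twist_def P_def Q_def)
      also have "f0 (P n) * g0 (Q n) = S n * (A * B)"
        unfolding smooth_rough_factorization[OF f0(1) pos(3), of y] smooth_rough_factorization[OF g0(1) pos(4), of y]
          Seq A_def B_def X_def by (simp only: mult_ac)
      finally have "F n - V n * S n * (Ef * Eg) = V n * S n * (A * (B - Eg) + (A - Ef) * Eg)"
        by (simp add: algebra_simps)
      also have "norm \<dots> \<le> 1 * (1 * norm (B - Eg) + norm (A - Ef) * 1)"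
      proof -
        have "norm (V n * S n) \<le> 1" unfolding norm_mult by (intro mult_le_one V1 S1 norm_ge_zero)
        moreover have "norm (A * (B - Eg) + (A - Ef) * Eg) \<le> 1 * norm (B - Eg) + norm (A - Ef) * 1"
          by (intro order_trans[OF norm_triangle_ineq] add_mono)
             (use AB Eg1 in \<open>auto simp: norm_mult intro: mult_left_le mult_left_le_one_le\<close>)
        ultimately show ?thesis unfolding norm_mult[of "V n * S n"] by (intro mult_mono) auto
      qed
      finally show ?thesis using True by (simp add: A_def B_def add.commute)
    next
      case False
      then have "F n = 0" "V n = 0" using that by (auto simp: F_def V_def twist_def G_def)
      then show ?thesis using False by simp
    qed
    have finG: "finite G" by (simp add: G_def)
    have "norm (\<Sum>n<N. F n - V n * S n * (Ef * Eg))
        \<le> (\<Sum>n<N. if n \<in> G then norm (rough_part y f0 (P n) - Ef) + norm (rough_part y g0 (Q n) - Eg) else 0)"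
      using pt by (intro sum_norm_le) auto
    also have "\<dots> = (\<Sum>n\<in>G. norm (rough_part y f0 (P n) - Ef) + norm (rough_part y g0 (Q n) - Eg))"
      by (intro sum.mono_neutral_cong_right) (auto simp: G_def)
    also have "\<dots> = (\<Sum>n\<in>G. norm (rough_part y f0 (P n) - Ef)) + (\<Sum>n\<in>G. norm (rough_part y g0 (Q n) - Eg))"
      by (rule sum.distrib)
    also have "\<dots> \<le> e / 6 * real N + e / 6 * real N"
    proof (intro add_mono)
      have "(\<Sum>n\<in>G. norm (rough_part y f0 (P n) - Ef))
          \<le> (\<Sum>n | n < N \<and> a * int n + c > 0. norm (rough_part y f0 (P n) - Ef))"
        by (intro sum_mono2) (auto simp: G_def)
      then show "(\<Sum>n\<in>G. norm (rough_part y f0 (P n) - Ef)) \<le> e / 6 * real N"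
        using elim(1) unfolding Ef_def by linarith
      have "(\<Sum>n\<in>G. norm (rough_part y g0 (Q n) - Eg))
          \<le> (\<Sum>n | n < N \<and> b * int n + d > 0. norm (rough_part y g0 (Q n) - Eg))"
        by (intro sum_mono2) (auto simp: G_def)
      then show "(\<Sum>n\<in>G. norm (rough_part y g0 (Q n) - Eg)) \<le> e / 6 * real N"
        using elim(2) unfolding Eg_def by linarith
    qed
    finally have 1: "norm ((\<Sum>n<N. F n - V n * S n * (Ef * Eg)) / of_nat N) \<le> e / 3"
      using N0 by (simp add: norm_divide divide_le_eq)
    define mV where "mV = (\<Sum>n<N. V n) / of_nat N"
    have "norm (\<Sum>n<N. V n) \<le> real N" using sum_norm_le[of "{..<N}" V "\<lambda>_. 1"] V1 by simp
    then have mV: "norm mV \<le> 1" using N0 by (simp add: norm_divide mV_def)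
    have LX: "norm (prod L X) \<le> 1"
      unfolding prod_norm[symmetric] using L1 by (intro prod_le_1) (auto simp: X_def)
    have 2: "norm (((\<Sum>n<N. V n * S n) / of_nat N - mV * prod L X) * (Ef * Eg)) \<le> e / 6"
    proof -
      have "norm (Ef * Eg) \<le> 1" unfolding norm_mult using Ef1 Eg1 by (intro mult_le_one) auto
      then have "norm (((\<Sum>n<N. V n * S n) / of_nat N - mV * prod L X) * (Ef * Eg)) \<le> e / 6 * 1"
        unfolding norm_mult[of _ "Ef * Eg"] using elim(3) e by (intro mult_mono) (auto simp: mV_def)
      then show ?thesis by simp
    qed
    have 3: "norm (mV * prod L X * (Ef * Eg - LY)) \<le> e / 6"
    proof -
      have "norm (mV * prod L X) \<le> 1" unfolding norm_mult using mV LX by (intro mult_le_one) auto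
      then have "norm (mV * prod L X * (Ef * Eg - LY)) \<le> 1 * (e / 6)"
        unfolding norm_mult[of _ "Ef * Eg - LY"] using tail[of N]
        by (intro mult_mono) (auto simp: Ef_def Eg_def LY_def)
      then show ?thesis by simp
    qed
    \<comment> \<open>Replace the rough parts by \<open>Ef\<close> and \<open>Eg\<close>, then the mean of the smooth part by its limit, then \<open>Ef * Eg\<close> by the product of the local factors beyond \<open>y\<close>.\<close>
    have decomp: "(\<Sum>n<N. F n) / of_nat N - mV * (prod L X * LY)
        = (\<Sum>n<N. F n - V n * S n * (Ef * Eg)) / of_nat N
          + (((\<Sum>n<N. V n * S n) / of_nat N - mV * prod L X) * (Ef * Eg)
             + mV * prod L X * (Ef * Eg - LY))"
      by (simp add: sum_subtractf diff_divide_distrib algebra_simps flip: sum_distrib_left sum_distrib_right)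
    have tri: "norm (\<alpha> + (\<beta> + \<eta>)) < e"
      if "norm \<alpha> \<le> e / 3" "norm \<beta> \<le> e / 6" "norm \<eta> \<le> e / 6" for \<alpha> \<beta> \<eta> :: complex
      using that e norm_triangle_ineq[of \<alpha> "\<beta> + \<eta>"] norm_triangle_ineq[of \<beta> \<eta>] by linarith
    show ?case unfolding split mV_def[symmetric] decomp using 1 2 3 by (rule tri)
  qed
  then show "\<exists>no. \<forall>N\<ge>no. norm (?lhs N - 0) < e"
    unfolding eventually_sequentially F_def P_def Q_def V_def by simp
qed

theorem corollary1p4:
  fixes f g f\<^sub>0 g\<^sub>0 :: "nat \<Rightarrow> complex" and t u :: real and a b c d :: int
    and P Q :: "nat \<Rightarrow> int"
  assumes "multiplicative_fun f" and "\<forall>n>0. norm (f n) \<le> 1"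
    and "multiplicative_fun g" and "\<forall>n>0. norm (g n) \<le> 1"
    and "pret_dist f (n_it t) < \<infinity>" and "pret_dist g (n_it u) < \<infinity>"
    and "f\<^sub>0 = (\<lambda>n. f n / n_it t n)" and "g\<^sub>0 = (\<lambda>n. g n / n_it u n)"
    and "a \<ge> 1" and "b \<ge> 1" and "gcd a c = 1" and "gcd b d = 1" and "a * d \<noteq> b * c"
    and "P = (\<lambda>n. a * int n + c)" and "Q = (\<lambda>n. b * int n + d)"
  shows
    \<comment> \<open>the limits defining the local factors exist\<close>
    "(\<forall>p. prime p \<longrightarrow>
        (corr_along (local_part p f\<^sub>0) P (local_part p g\<^sub>0) Q \<longlongrightarrow> local_corr p f\<^sub>0 P g\<^sub>0 Q) at_top \<and>
        (mean_along (local_part p f\<^sub>0) P \<longlongrightarrow> local_mean p f\<^sub>0 P) at_top \<and>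
        (mean_along (local_part p g\<^sub>0) Q \<longlongrightarrow> local_mean p g\<^sub>0 Q) at_top) \<and>
    (\<lambda>x. corr_along f P g Q x
        - corr_along (n_it t) P (n_it u) Q x
          * (\<Prod>p | prime p \<and> real p \<le> x. local_corr p f\<^sub>0 P g\<^sub>0 Q)) \<in> o[at_top](\<lambda>_. 1) \<and>
    corr_along (n_it t) P (n_it u) Q \<sim>[at_top]
      (\<lambda>x. of_int a powr (\<i> * of_real t) * of_int b powr (\<i> * of_real u)
            * of_real x powr (\<i> * of_real (t + u)) / (1 + \<i> * of_real (t + u))) \<and>
    \<comment> \<open>(i)\<close>
    (\<forall>p. prime p \<longrightarrow> int p dvd gcd a b \<longrightarrow> local_corr p f\<^sub>0 P g\<^sub>0 Q = 1) \<and>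
    \<comment> \<open>(ii)\<close>
    (\<forall>p. prime p \<longrightarrow> \<not> int p dvd a * b * (a * d - b * c) \<longrightarrow>
        local_corr p f\<^sub>0 P g\<^sub>0 Q = local_mean p f\<^sub>0 P + local_mean p g\<^sub>0 Q - 1 \<and>
        local_mean p f\<^sub>0 P + local_mean p g\<^sub>0 Q - 1 =
          1 - 2 / of_nat p + (1 - 1 / of_nat p)
            * ((\<Sum>\<^sub>\<infinity>j\<in>{1..}. f\<^sub>0 (p ^ j) / of_nat p ^ j)
               + (\<Sum>\<^sub>\<infinity>j\<in>{1..}. g\<^sub>0 (p ^ j) / of_nat p ^ j))) \<and>
    \<comment> \<open>(iii)\<close>
    (\<forall>p k \<theta> \<gamma>. prime p \<longrightarrow> \<not> int p dvd gcd a b \<longrightarrow>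
        int p ^ k dvd a * d - b * c \<longrightarrow> \<not> int p ^ (k + 1) dvd a * d - b * c \<longrightarrow>
        (\<forall>n>0. f\<^sub>0 n = dirichlet_conv (\<lambda>_. 1) \<theta> n) \<longrightarrow>
        (\<forall>n>0. g\<^sub>0 n = dirichlet_conv (\<lambda>_. 1) \<gamma> n) \<longrightarrow>
        local_corr p f\<^sub>0 P g\<^sub>0 Q =
          (\<Sum>i = 0..k.
             \<theta> (p ^ i) * \<gamma> (p ^ i) / of_nat p ^ i
             + (if int p dvd b then 0 else 1) * (\<Sum>\<^sub>\<infinity>j\<in>{i<..}. \<theta> (p ^ i) * \<gamma> (p ^ j) / of_nat p ^ j)
             + (if int p dvd a then 0 else 1) * (\<Sum>\<^sub>\<infinity>j\<in>{i<..}. \<gamma> (p ^ i) * \<theta> (p ^ j) / of_nat p ^ j)))"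
proof -
  have F0: "multiplicative_fun f\<^sub>0" "\<And>n. n > 0 \<Longrightarrow> norm (f\<^sub>0 n) \<le> 1"
    "(\<lambda>p. (norm (f\<^sub>0 p - 1))\<^sup>2 / real p) summable_on {p. prime p}"
    "\<And>n. n > 0 \<Longrightarrow> f n = n_it t n * f\<^sub>0 n"
    using untwisted_properties[OF assms(1,2,5,7)] by blast+
  have G0: "multiplicative_fun g\<^sub>0" "\<And>n. n > 0 \<Longrightarrow> norm (g\<^sub>0 n) \<le> 1"
    "(\<lambda>p. (norm (g\<^sub>0 p - 1))\<^sup>2 / real p) summable_on {p. prime p}"
    "\<And>n. n > 0 \<Longrightarrow> g n = n_it u n * g\<^sub>0 n"
    using untwisted_properties[OF assms(3,4,6,8)] by blast+
  note a = \<open>a \<ge> 1\<close> and b = \<open>b \<ge> 1\<close> and ac = \<open>gcd a c = 1\<close> and bd = \<open>gcd b d = 1\<close>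
  note P = \<open>P = (\<lambda>n. a * int n + c)\<close> and Q = \<open>Q = (\<lambda>n. b * int n + d)\<close>
  have D: "a * (b + d) - b * (a + c) \<noteq> 0"
    unfolding shifted_determinant using \<open>a * d \<noteq> b * c\<close> by simp
  have ac': "gcd a (a + c) = 1" and bd': "gcd b (b + d) = 1" using ac bd by (simp_all add: gcd_add2)
  have f1: "f\<^sub>0 1 = 1" and g1: "g\<^sub>0 1 = 1" using F0(1) G0(1) by (auto simp: multiplicative_fun_def)
  have incf: "norm (\<Sum>i\<le>j. increment f\<^sub>0 p i) \<le> 1"
    and incg: "norm (\<Sum>i\<le>j. increment g\<^sub>0 p i) \<le> 1" if "prime p" for p j
    using norm_sum_increment_le[of f\<^sub>0 p j] norm_sum_increment_le[of g\<^sub>0 p j] f1 g1 F0(2) G0(2) that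
    by blast+

  define CM where "CM p = cut_mean p (increment f\<^sub>0 p) (increment g\<^sub>0 p) a (a + c) b (b + d)" for p
  have corr_lim: "(corr_along (local_part p f\<^sub>0) P (local_part p g\<^sub>0) Q \<longlongrightarrow> L) at_top"
    if "prime p" "CM p \<longlonglongrightarrow> L" for p L
    unfolding P Q using that eventually_linear_form_pos[OF a, of "a + c"] eventually_linear_form_pos[OF b, of "b + d"]
      f1 g1 F0(2) G0(2) ac bd
    by (intro corr_local_part_tendsto) (auto simp: CM_def)
  have corr_eq: "local_corr p f\<^sub>0 P g\<^sub>0 Q = L" if "prime p" "CM p \<longlonglongrightarrow> L" for p L
    using corr_lim[OF that] by (rule local_corr_eqI)
  have CM_ex: "\<exists>L. CM p \<longlonglongrightarrow> L" if "prime p" for p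
    unfolding CM_def using that f1 g1 F0(2) G0(2) ac' bd' D by (intro cut_mean_limit_exists) auto
  have CM: "CM p \<longlonglongrightarrow> local_corr p f\<^sub>0 P g\<^sub>0 Q" if "prime p" for p
    using CM_ex[OF that] corr_eq[OF that] by metis
  have exact: "local_corr p f\<^sub>0 P g\<^sub>0 Q = euler_factor p k (increment f\<^sub>0 p) (increment g\<^sub>0 p) a b"
    if "prime p" "\<not> int p dvd gcd a b" "int p ^ k dvd a * d - b * c" "\<not> int p ^ Suc k dvd a * d - b * c" for p k
    using that incf[OF that(1)] incg[OF that(1)] unfolding shifted_determinant[symmetric, of a d b c]
    by (intro corr_eq[OF that(1)]) (auto simp only: CM_def intro!: cut_mean_tendsto ac' bd')

  have limits: "\<forall>p. prime p \<longrightarrow>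
        (corr_along (local_part p f\<^sub>0) P (local_part p g\<^sub>0) Q \<longlongrightarrow> local_corr p f\<^sub>0 P g\<^sub>0 Q) at_top \<and>
        (mean_along (local_part p f\<^sub>0) P \<longlongrightarrow> local_mean p f\<^sub>0 P) at_top \<and>
        (mean_along (local_part p g\<^sub>0) Q \<longlongrightarrow> local_mean p g\<^sub>0 Q) at_top"
    using corr_lim[OF _ CM] local_mean_tendsto(1)[of f\<^sub>0 _ a c] local_mean_tendsto(1)[of g\<^sub>0 _ b d]
      f1 g1 F0(2) G0(2) a b ac bd unfolding P Q by auto

  have twist_corr: "corr_along (n_it t) P (n_it u) Q x = of_real (real (nat \<lfloor>x\<rfloor>) / x)
      * ((\<Sum>n<nat \<lfloor>x\<rfloor>. twist t u a (a + c) b (b + d) n) / of_nat (nat \<lfloor>x\<rfloor>))" if "x > 0" for x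
    unfolding P Q corr_along_eq[OF that] twist_def ..

  have main: "(\<lambda>x. corr_along f P g Q x
        - corr_along (n_it t) P (n_it u) Q x
          * (\<Prod>p | prime p \<and> real p \<le> x. local_corr p f\<^sub>0 P g\<^sub>0 Q)) \<in> o[at_top](\<lambda>_. 1)"
  proof (rule smalloI_tendsto)
    define s where "s N = (\<Sum>n<N. if a * int n + (a + c) > 0 \<and> b * int n + (b + d) > 0
                then f (nat (a * int n + (a + c))) * g (nat (b * int n + (b + d))) else 0) / of_nat N
            - (\<Sum>n<N. twist t u a (a + c) b (b + d) n) / of_nat N
              * (\<Prod>p | prime p \<and> p \<le> N. local_corr p f\<^sub>0 P g\<^sub>0 Q)" for N
    have "s \<longlonglongrightarrow> 0"
      unfolding s_def
      by (rule correlation_asymptotics[where L = "\<lambda>p. local_corr p f\<^sub>0 P g\<^sub>0 Q"])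
         (use F0 G0 a b ac' bd' D CM in \<open>auto simp only: CM_def\<close>)
    from filterlim_compose[OF this filterlim_nat_floor]
    have "((\<lambda>x :: real. s (nat \<lfloor>x\<rfloor>)) \<longlongrightarrow> 0) at_top" .
    with tendsto_of_real[OF tendsto_nat_floor_div, where ?'a = complex]
    have "((\<lambda>x. of_real (real (nat \<lfloor>x\<rfloor>) / x) * s (nat \<lfloor>x\<rfloor>)) \<longlongrightarrow> of_real 1 * 0) at_top"
      by (rule tendsto_mult)
    moreover have "\<forall>\<^sub>F x in at_top. of_real (real (nat \<lfloor>x\<rfloor>) / x) * s (nat \<lfloor>x\<rfloor>)
        = (corr_along f P g Q x - corr_along (n_it t) P (n_it u) Q x
          * (\<Prod>p | prime p \<and> real p \<le> x. local_corr p f\<^sub>0 P g\<^sub>0 Q)) / 1"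
      using eventually_gt_at_top[of 0]
    proof eventually_elim
      case (elim x)
      have set: "{p. prime p \<and> real p \<le> x} = {p. prime p \<and> p \<le> nat \<lfloor>x\<rfloor>}"
        using elim by (auto simp: le_nat_iff le_floor_iff)
      have fg: "corr_along f P g Q x = of_real (real (nat \<lfloor>x\<rfloor>) / x) * ((\<Sum>n<nat \<lfloor>x\<rfloor>.
           if a * int n + (a + c) > 0 \<and> b * int n + (b + d) > 0
           then f (nat (a * int n + (a + c))) * g (nat (b * int n + (b + d))) else 0) / of_nat (nat \<lfloor>x\<rfloor>))"
        unfolding P Q by (rule corr_along_eq[OF elim])
      show ?case unfolding set fg twist_corr[OF elim] s_def div_by_1 right_diff_distrib
        by (simp only: mult.assoc)
    qed
    ultimately show "((\<lambda>x. (corr_along f P g Q x - corr_along (n_it t) P (n_it u) Q x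
          * (\<Prod>p | prime p \<and> real p \<le> x. local_corr p f\<^sub>0 P g\<^sub>0 Q)) / 1) \<longlongrightarrow> 0) at_top"
      unfolding mult_zero_right by (rule Lim_transform_eventually)
  qed simp

  have archimedean: "corr_along (n_it t) P (n_it u) Q \<sim>[at_top]
      (\<lambda>x. of_int a powr (\<i> * of_real t) * of_int b powr (\<i> * of_real u)
            * of_real x powr (\<i> * of_real (t + u)) / (1 + \<i> * of_real (t + u)))"
  proof -
    define C where "C = cis (t * ln (of_int a) + u * ln (of_int b))"
    define q where "q = 1 + \<i> * complex_of_real (t + u)"
    have q0: "q \<noteq> 0" by (auto simp: q_def complex_eq_iff)
    define R where "R x = C * cis ((t + u) * ln x) / q" for x
    have R: "of_int a powr (\<i> * of_real t) * of_int b powr (\<i> * of_real u)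
            * of_real x powr (\<i> * of_real (t + u)) / (1 + \<i> * of_real (t + u)) = R x" if "x > 0" for x
      using of_real_powr_imaginary[of "of_int a" t] of_real_powr_imaginary[of "of_int b" u]
        of_real_powr_imaginary[OF that, of "t + u"] a b
      by (simp add: R_def C_def q_def cis_mult)
    have normR: "norm (R x) = 1 / norm q" for x by (simp add: R_def C_def norm_divide norm_mult)
    define m where "m N = (\<Sum>n<N. twist t u a (a + c) b (b + d) n) / of_nat N" for N
    define \<rho> where "\<rho> x = complex_of_real (real (nat \<lfloor>x\<rfloor>) / x)" for x
    have \<rho>: "(\<rho> \<longlongrightarrow> 1) at_top"
      using tendsto_of_real[OF tendsto_nat_floor_div, where ?'a = complex]
      unfolding \<rho>_def[abs_def] by (simp only: of_real_1)
    have "(\<lambda>N. m N - R (real N)) \<longlonglongrightarrow> 0"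
      using mean_twist[OF a b, of t u "a + c" "b + d"] by (simp add: m_def R_def C_def q_def)
    from filterlim_compose[OF this filterlim_nat_floor]
    have 1: "((\<lambda>x :: real. m (nat \<lfloor>x\<rfloor>) - R (real (nat \<lfloor>x\<rfloor>))) \<longlongrightarrow> 0) at_top" .
    have "((\<lambda>x :: real. ln (real_of_int \<lfloor>x\<rfloor>) - ln x) \<longlongrightarrow> 0) at_top" by real_asymp
    moreover have "\<forall>\<^sub>F x :: real in at_top. ln (real_of_int \<lfloor>x\<rfloor>) - ln x = ln (real (nat \<lfloor>x\<rfloor>)) - ln x"
      using eventually_ge_at_top[of 0] by eventually_elim simp
    ultimately have "((\<lambda>x. ln (real (nat \<lfloor>x\<rfloor>)) - ln x) \<longlongrightarrow> 0) at_top"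
      by (rule Lim_transform_eventually)
    then have "((\<lambda>x. (t + u) * (ln (real (nat \<lfloor>x\<rfloor>)) - ln x)) \<longlongrightarrow> 0) at_top"
      by (rule tendsto_mult_right_zero)
    then have "((\<lambda>x. (t + u) * ln (real (nat \<lfloor>x\<rfloor>)) - (t + u) * ln x) \<longlongrightarrow> 0) at_top"
      by (simp only: right_diff_distrib)
    from tendsto_mult_right_zero[OF tendsto_cis_diff[OF this], of "C / q"]
    have 2: "((\<lambda>x :: real. R (real (nat \<lfloor>x\<rfloor>)) - R x) \<longlongrightarrow> 0) at_top"
      by (simp add: R_def right_diff_distrib)
    have 3: "((\<lambda>x. (\<rho> x - 1) * R x) \<longlongrightarrow> 0) at_top"
    proof (rule Lim_null_comparison)
      have "((\<lambda>x. \<rho> x - 1) \<longlongrightarrow> 1 - 1) at_top" by (intro tendsto_intros \<rho>)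
      from tendsto_mult_left_zero[OF tendsto_norm_zero[OF this[unfolded diff_self]], of "1 / norm q"]
      show "((\<lambda>x. norm (\<rho> x - 1) * (1 / norm q)) \<longlongrightarrow> 0) at_top" .
    qed (simp add: norm_mult normR)
    have "((\<lambda>x. \<rho> x * ((m (nat \<lfloor>x\<rfloor>) - R (real (nat \<lfloor>x\<rfloor>))) + (R (real (nat \<lfloor>x\<rfloor>)) - R x)) + (\<rho> x - 1) * R x)
        \<longlongrightarrow> 1 * (0 + 0) + 0) at_top"
      by (intro tendsto_intros \<rho> 1 2 3)
    then have diff: "((\<lambda>x. \<rho> x * m (nat \<lfloor>x\<rfloor>) - R x) \<longlongrightarrow> 0) at_top"
      by (simp add: algebra_simps)
    have R0: "R x \<noteq> 0" for x using normR[of x] q0 by auto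
    show ?thesis
    proof (rule asymp_equivI')
      have "((\<lambda>x. (\<rho> x * m (nat \<lfloor>x\<rfloor>) - R x) / R x) \<longlongrightarrow> 0) at_top"
      proof (rule Lim_null_comparison)
        show "((\<lambda>x. norm (\<rho> x * m (nat \<lfloor>x\<rfloor>) - R x) * norm q) \<longlongrightarrow> 0) at_top"
          by (intro tendsto_mult_left_zero tendsto_norm_zero diff)
      qed (simp add: norm_divide normR)
      from tendsto_add[OF this tendsto_const[of 1]]
      have "((\<lambda>x. (\<rho> x * m (nat \<lfloor>x\<rfloor>) - R x) / R x + 1) \<longlongrightarrow> 1) at_top" by simp
      moreover have "\<forall>\<^sub>F x in at_top. (\<rho> x * m (nat \<lfloor>x\<rfloor>) - R x) / R x + 1
          = corr_along (n_it t) P (n_it u) Q x / (of_int a powr (\<i> * of_real t) * of_int b powr (\<i> * of_real u)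
            * of_real x powr (\<i> * of_real (t + u)) / (1 + \<i> * of_real (t + u)))"
        using eventually_gt_at_top[of 0]
      proof eventually_elim
        case (elim x)
        show ?case unfolding R[OF elim] twist_corr[OF elim] \<rho>_def[symmetric] m_def[symmetric]
          using R0[of x] by (simp add: diff_divide_distrib)
      qed
      ultimately show "((\<lambda>x. corr_along (n_it t) P (n_it u) Q x / (of_int a powr (\<i> * of_real t)
            * of_int b powr (\<i> * of_real u) * of_real x powr (\<i> * of_real (t + u)) / (1 + \<i> * of_real (t + u))))
          \<longlongrightarrow> 1) at_top"
        by (rule Lim_transform_eventually)
    qed
  qed

  have common: "\<forall>p. prime p \<longrightarrow> int p dvd gcd a b \<longrightarrow> local_corr p f\<^sub>0 P g\<^sub>0 Q = 1"
  proof (intro allI impI)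
    fix p :: nat assume p: "prime p" "int p dvd gcd a b"
    have "CM p = (\<lambda>_. 1)"
      unfolding CM_def using p by (intro ext cut_mean_common ac' bd') (auto simp: increment_def)
    then show "local_corr p f\<^sub>0 P g\<^sub>0 Q = 1" by (intro corr_eq p) simp
  qed

  have generic: "\<forall>p. prime p \<longrightarrow> \<not> int p dvd a * b * (a * d - b * c) \<longrightarrow>
        local_corr p f\<^sub>0 P g\<^sub>0 Q = local_mean p f\<^sub>0 P + local_mean p g\<^sub>0 Q - 1 \<and>
        local_mean p f\<^sub>0 P + local_mean p g\<^sub>0 Q - 1 =
          1 - 2 / of_nat p + (1 - 1 / of_nat p)
            * ((\<Sum>\<^sub>\<infinity>j\<in>{1..}. f\<^sub>0 (p ^ j) / of_nat p ^ j)
               + (\<Sum>\<^sub>\<infinity>j\<in>{1..}. g\<^sub>0 (p ^ j) / of_nat p ^ j))"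
  proof (intro allI impI)
    fix p :: nat assume p: "prime p" "\<not> int p dvd a * b * (a * d - b * c)"
    then have nd: "\<not> int p dvd a" "\<not> int p dvd b" "\<not> int p dvd a * d - b * c" by auto
    have lf: "local_mean p f\<^sub>0 P = 1 + (\<Sum>\<^sub>\<infinity>j\<in>{0<..}. increment f\<^sub>0 p j / of_nat p ^ j)"
      unfolding P using f1 F0(2) p(1) a ac nd(1) by (intro local_mean_tendsto(2)) auto
    have lg: "local_mean p g\<^sub>0 Q = 1 + (\<Sum>\<^sub>\<infinity>j\<in>{0<..}. increment g\<^sub>0 p j / of_nat p ^ j)"
      unfolding Q using g1 G0(2) p(1) b bd nd(2) by (intro local_mean_tendsto(2)) auto
    have "local_corr p f\<^sub>0 P g\<^sub>0 Q = euler_factor p 0 (increment f\<^sub>0 p) (increment g\<^sub>0 p) a b"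
      using nd by (intro exact p) auto
    then have lc: "local_corr p f\<^sub>0 P g\<^sub>0 Q = local_mean p f\<^sub>0 P + local_mean p g\<^sub>0 Q - 1"
      using euler_factor_coprime[of p a b "increment f\<^sub>0 p" "increment g\<^sub>0 p"] nd
      by (simp add: lf lg increment_def)
    have If: "(\<Sum>\<^sub>\<infinity>j\<in>{0<..}. increment f\<^sub>0 p j / of_nat p ^ j)
        = (1 - 1 / of_nat p) * (\<Sum>\<^sub>\<infinity>j\<in>{1..}. f\<^sub>0 (p ^ j) / of_nat p ^ j) - 1 / of_nat p"
      using p(1) f1 F0(2) by (intro infsum_increment) auto
    have Ig: "(\<Sum>\<^sub>\<infinity>j\<in>{0<..}. increment g\<^sub>0 p j / of_nat p ^ j)
        = (1 - 1 / of_nat p) * (\<Sum>\<^sub>\<infinity>j\<in>{1..}. g\<^sub>0 (p ^ j) / of_nat p ^ j) - 1 / of_nat p"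
      using p(1) g1 G0(2) by (intro infsum_increment) auto
    show "local_corr p f\<^sub>0 P g\<^sub>0 Q = local_mean p f\<^sub>0 P + local_mean p g\<^sub>0 Q - 1 \<and>
        local_mean p f\<^sub>0 P + local_mean p g\<^sub>0 Q - 1 =
          1 - 2 / of_nat p + (1 - 1 / of_nat p)
            * ((\<Sum>\<^sub>\<infinity>j\<in>{1..}. f\<^sub>0 (p ^ j) / of_nat p ^ j)
               + (\<Sum>\<^sub>\<infinity>j\<in>{1..}. g\<^sub>0 (p ^ j) / of_nat p ^ j))"
      using lc unfolding lf lg If Ig by (simp add: algebra_simps)
  qed

  have formula: "\<forall>p k \<theta> \<gamma>. prime p \<longrightarrow> \<not> int p dvd gcd a b \<longrightarrow>
        int p ^ k dvd a * d - b * c \<longrightarrow> \<not> int p ^ (k + 1) dvd a * d - b * c \<longrightarrow>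
        (\<forall>n>0. f\<^sub>0 n = dirichlet_conv (\<lambda>_. 1) \<theta> n) \<longrightarrow>
        (\<forall>n>0. g\<^sub>0 n = dirichlet_conv (\<lambda>_. 1) \<gamma> n) \<longrightarrow>
        local_corr p f\<^sub>0 P g\<^sub>0 Q =
          (\<Sum>i = 0..k.
             \<theta> (p ^ i) * \<gamma> (p ^ i) / of_nat p ^ i
             + (if int p dvd b then 0 else 1) * (\<Sum>\<^sub>\<infinity>j\<in>{i<..}. \<theta> (p ^ i) * \<gamma> (p ^ j) / of_nat p ^ j)
             + (if int p dvd a then 0 else 1) * (\<Sum>\<^sub>\<infinity>j\<in>{i<..}. \<gamma> (p ^ i) * \<theta> (p ^ j) / of_nat p ^ j))"
  proof (intro allI impI)
    fix p k \<theta> \<gamma>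
    assume p: "prime p" "\<not> int p dvd gcd a b" "int p ^ k dvd a * d - b * c" "\<not> int p ^ (k + 1) dvd a * d - b * c"
      and \<theta>: "\<forall>n>0. f\<^sub>0 n = dirichlet_conv (\<lambda>_. 1) \<theta> n" and \<gamma>: "\<forall>n>0. g\<^sub>0 n = dirichlet_conv (\<lambda>_. 1) \<gamma> n"
    have "local_corr p f\<^sub>0 P g\<^sub>0 Q = euler_factor p k (\<lambda>i. \<theta> (p ^ i)) (\<lambda>i. \<gamma> (p ^ i)) a b"
      using exact[OF p(1-3)] p(4)
      by (simp only: Suc_eq_plus1 increment_eq_conv[OF p(1) f1 \<theta>] increment_eq_conv[OF p(1) g1 \<gamma>] simp_thms)
    then show "local_corr p f\<^sub>0 P g\<^sub>0 Q =
          (\<Sum>i = 0..k.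
             \<theta> (p ^ i) * \<gamma> (p ^ i) / of_nat p ^ i
             + (if int p dvd b then 0 else 1) * (\<Sum>\<^sub>\<infinity>j\<in>{i<..}. \<theta> (p ^ i) * \<gamma> (p ^ j) / of_nat p ^ j)
             + (if int p dvd a then 0 else 1) * (\<Sum>\<^sub>\<infinity>j\<in>{i<..}. \<gamma> (p ^ i) * \<theta> (p ^ j) / of_nat p ^ j))"
      by (simp only: euler_factor_def)
  qed

  show ?thesis
    using limits main archimedean common generic formula by blast
qed

end
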